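(* Let $\nu>0$ and consider the problem on $\Omega=(0,\pi)$ $$\omega_t=\nu\,\omega_{xx}-\omega^2,\qquad \omega(0,t)=\omega(\pi,t)=0,\qquad \omega(x,0)=\omega_0(x).$$ There exists an $M>0$ such that if the initial data $\omega_0\in C([0,\pi])$ satisfies $$\int_0^\pi\omega_0(x)\sin(x)\,dx<-M,$$ then the corresponding solution $\omega$ blows up in finite time. More precisely, there exists a time $T^*\in(0,\infty)$ such that $$\lim_{t\to (T^* )^-}\int_0^\pi\omega(x,t)\sin(x)\,dx=-\infty .$$
   Context: The constant $M$ may depend on $\nu$ but not on $\omega_0$. The equation is obtained from the equation $\omega_t+u\omega_x=\nu\omega_{xx}-\omega^2$ satisfied by the derivative $\omega=u_x$ of a solution $u$ of the viscous Burgers equation $u_t+uu_x=\nu u_{xx}$ on $(0,\pi)$ with Neumann boundary conditions, by dropping the term $u\omega_x$. *)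

theory Defs
  imports "HOL-Analysis.Analysis"
begin

text \<open>
  A function of space and time is written \<open>\<omega> x t\<close>. The existence time \<open>T\<close> is extended real,
  so that \<open>T = \<infinity>\<close> stands for a global solution; values of \<open>\<omega>\<close> outside
  \<open>[0,\<pi>] \<times> [0,T)\<close> are irrelevant.
\<close>

text \<open>
  The regularity class \<open>C\<^sup>2\<^sup>,\<^sup>1([0,\<pi>] \<times> (0,T))\<close>, the three derivatives being given explicitly.
  At the end points of \<open>[0,\<pi>]\<close> the space derivatives are one-sided.
\<close>

definition C21_with ::
  "ereal \<Rightarrow> (real \<Rightarrow> real \<Rightarrow> real) \<Rightarrow> (real \<Rightarrow> real \<Rightarrow> real) \<Rightarrow> (real \<Rightarrow> real \<Rightarrow> real)
     \<Rightarrow> (real \<Rightarrow> real \<Rightarrow> real) \<Rightarrow> bool" where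
  "C21_with T \<omega> \<omega>\<^sub>t \<omega>\<^sub>x \<omega>\<^sub>x\<^sub>x \<longleftrightarrow>
     (\<forall>x\<in>{0..pi}. \<forall>t>0. ereal t < T \<longrightarrow>
        ((\<lambda>s. \<omega> x s) has_real_derivative \<omega>\<^sub>t x t) (at t) \<and>
        ((\<lambda>y. \<omega> y t) has_real_derivative \<omega>\<^sub>x x t) (at x within {0..pi}) \<and>
        ((\<lambda>y. \<omega>\<^sub>x y t) has_real_derivative \<omega>\<^sub>x\<^sub>x x t) (at x within {0..pi})) \<and>
     continuous_on ({0..pi} \<times> {t. 0 < t \<and> ereal t < T}) (\<lambda>(x, t). \<omega>\<^sub>t x t) \<and>
     continuous_on ({0..pi} \<times> {t. 0 < t \<and> ereal t < T}) (\<lambda>(x, t). \<omega>\<^sub>x x t) \<and>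
     continuous_on ({0..pi} \<times> {t. 0 < t \<and> ereal t < T}) (\<lambda>(x, t). \<omega>\<^sub>x\<^sub>x x t)"

text \<open>
  Classical solutions on \<open>[0,T)\<close>. The initial data is merely continuous and need not satisfy the
  compatibility condition \<open>\<omega>\<^sub>0(0) = \<omega>\<^sub>0(\<pi>) = 0\<close>, so continuity up to \<open>t = 0\<close> cannot be demanded
  at the two corners; there the solution is only required to stay bounded (without this bound,
  solutions would not be unique). The boundary condition is imposed for \<open>t > 0\<close>.
\<close>

definition classical_solution ::
  "real \<Rightarrow> (real \<Rightarrow> real) \<Rightarrow> ereal \<Rightarrow> (real \<Rightarrow> real \<Rightarrow> real) \<Rightarrow> bool" where
  "classical_solution \<nu> \<omega>\<^sub>0 T \<omega> \<longleftrightarrow>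
     0 < T \<and>
     (\<exists>\<omega>\<^sub>t \<omega>\<^sub>x \<omega>\<^sub>x\<^sub>x. C21_with T \<omega> \<omega>\<^sub>t \<omega>\<^sub>x \<omega>\<^sub>x\<^sub>x \<and>
        (\<forall>x\<in>{0<..<pi}. \<forall>t>0. ereal t < T \<longrightarrow> \<omega>\<^sub>t x t = \<nu> * \<omega>\<^sub>x\<^sub>x x t - (\<omega> x t)\<^sup>2)) \<and>
     (\<forall>t>0. ereal t < T \<longrightarrow> \<omega> 0 t = 0 \<and> \<omega> pi t = 0) \<and>
     (\<forall>x\<in>{0..pi}. \<omega> x 0 = \<omega>\<^sub>0 x) \<and>
     continuous_on ({0..pi} \<times> {t. 0 \<le> t \<and> ereal t < T} - {(0, 0), (pi, 0)}) (\<lambda>(x, t). \<omega> x t) \<and>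
     (\<exists>\<tau>>0. ereal \<tau> < T \<and> bounded ((\<lambda>(x, t). \<omega> x t) ` ({0..pi} \<times> {0..\<tau>})))"

definition maximal_solution ::
  "real \<Rightarrow> (real \<Rightarrow> real) \<Rightarrow> ereal \<Rightarrow> (real \<Rightarrow> real \<Rightarrow> real) \<Rightarrow> bool" where
  "maximal_solution \<nu> \<omega>\<^sub>0 T \<omega> \<longleftrightarrow>
     classical_solution \<nu> \<omega>\<^sub>0 T \<omega> \<and>
     \<not> (\<exists>T' \<omega>'. T < T' \<and> classical_solution \<nu> \<omega>\<^sub>0 T' \<omega>' \<and>
          (\<forall>x\<in>{0..pi}. \<forall>t\<ge>0. ereal t < T \<longrightarrow> \<omega>' x t = \<omega> x t))"

end

theory Submission
  imports Defs
begin

text \<open>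
  Let \<open>F(t) = \<integral> \<omega> sin x dx\<close> and \<open>E(t) = \<integral> \<omega>\<^sup>2 sin x dx\<close>, so that \<open>F' = - \<nu> F - E\<close> and
  \<open>F\<^sup>2 \<le> 2 E\<close>. Then \<open>e\<^bsup>\<nu>t\<^esup> F\<close> is decreasing and satisfies a Riccati inequality, which bounds the existence
  time if \<open>F(0) < - 2 \<nu>\<close>. At the maximal time \<open>T\<close> either \<open>F\<close> tends to \<open>- \<infinity>\<close> or it stays bounded. In
  the second case \<open>E\<close> is integrable in time, and a weighted Ladyzhenskaya inequality turns the energy
  identity into \<open>E' \<le> C E (1 + E)\<close>, so \<open>E\<close> is bounded by Gronwall's inequality. Bootstrapping through the
  equations for the sine coefficients bounds the \<open>k\<close>-th coefficient of \<open>\<omega>(\<sqdot>,t)\<close> by \<open>A/k\<^sup>2\<close> uniformly up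
  to \<open>T\<close>. The existence time of the mild solution starting from such data depends only on \<open>A\<close>, so
  restarting shortly before \<open>T\<close> continues \<open>\<omega>\<close> beyond \<open>T\<close>, which contradicts maximality.
\<close>

section \<open>Sine series\<close>

text \<open>A finite existence time alone does not give the claim: a solution could lose regularity
  while \<open>F\<close> stays bounded, so regularity must be recovered from a single weighted mean.
  Boundedness of \<open>F\<close> controls only the time integral of \<open>E\<close>. This is just
  enough, because once the cubic term has used up the viscous dissipation, the logarithmic
  derivative of 1 + E is at most C E. The threshold 2 \<nu> comes from the damping: the Riccati rate
  1/2 becomes e^(-\<nu> t)/2, whose integral over all times is 1/(2 \<nu>), so global existence is
  excluded as soon as -1/F(0) < 1/(2 \<nu>). Maximality is only the absence of an extension, so a
  classical solution past \<open>T\<close> has to be built and matched with the given one. Both are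
  done mode by mode: over a time d the heat flow gains a factor min(d, 1/(\<nu> k^2)) in mode k,
  these gains are summable, and their sum tends to 0 with d. The same contraction estimate yields
  existence and agreement. Restarting at a positive time keeps the possibly discontinuous corners at
  t = 0 out of the local theory.\<close>

definition sine_coeff :: "(real \<Rightarrow> real) \<Rightarrow> nat \<Rightarrow> real" where
  "sine_coeff f k = 2 / pi * integral {0..pi} (\<lambda>x. f x * sin (real k * x))"

definition sine_series :: "(nat \<Rightarrow> real) \<Rightarrow> real \<Rightarrow> real" where
  "sine_series a x = (\<Sum>k. a k * sin (real k * x))"

lemma sine_coeff_0 [simp]: "sine_coeff f 0 = 0"
  by (simp add: sine_coeff_def)

section \<open>Orthogonality of sines and of cosines on [0,pi]\<close>

lemma sin_npi_integer [simp]: "sin (of_int j * pi) = 0"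
  using sin_npi_int[of j] by (simp add: mult.commute)

lemma has_integral_cos_integer:
  assumes "j \<noteq> (0::int)"
  shows "((\<lambda>x. cos (of_int j * x)) has_integral 0) {0..pi}"
proof -
  have "((\<lambda>x. cos (of_int j * x)) has_integral
      (sin (of_int j * pi) / of_int j - sin (of_int j * 0) / of_int j)) {0..pi}"
    using assms
    by (intro fundamental_theorem_of_calculus)
       (auto intro!: derivative_eq_intros simp: has_real_derivative_iff_has_vector_derivative[symmetric])
  then show ?thesis by simp
qed

lemma has_integral_cos_diff:
  fixes m n :: nat
  shows "((\<lambda>x. cos ((real m - real n) * x)) has_integral (if m = n then pi else 0)) {0..pi}"
proof (cases "m = n")
  case True
  then show ?thesis using has_integral_const_real[of "1::real" 0 pi] by simp
next
  case False
  then have "int m - int n \<noteq> 0" by simp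
  from has_integral_cos_integer[OF this] False show ?thesis by simp
qed

lemma has_integral_cos_add:
  fixes m n :: nat
  assumes "n \<noteq> 0"
  shows "((\<lambda>x. cos ((real m + real n) * x)) has_integral 0) {0..pi}"
proof -
  have "int m + int n \<noteq> 0" using assms by simp
  from has_integral_cos_integer[OF this] show ?thesis by simp
qed

lemma has_integral_sin_sin:
  fixes m n :: nat
  assumes "n \<noteq> 0"
  shows "((\<lambda>x. sin (real m * x) * sin (real n * x)) has_integral (if m = n then pi / 2 else 0)) {0..pi}"
proof -
  have *: "(\<lambda>x. sin (real m * x) * sin (real n * x)) =
     (\<lambda>x. (cos ((real m - real n) * x) - cos ((real m + real n) * x)) * (1/2))"
    by (rule ext) (simp add: sin_times_sin left_diff_distrib distrib_right)
  have "((if m = n then pi else 0) - 0) * (1/2) = (if m = n then pi / 2 else 0)" by simp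
  then show ?thesis unfolding *
    using has_integral_mult_left[OF has_integral_diff[OF has_integral_cos_diff[of m n] has_integral_cos_add[OF assms, of m]], of "1/2"]
    by (simp only:)
qed

lemma has_integral_cos_cos:
  fixes m n :: nat
  assumes "n \<noteq> 0"
  shows "((\<lambda>x. cos (real m * x) * cos (real n * x)) has_integral (if m = n then pi / 2 else 0)) {0..pi}"
proof -
  have *: "(\<lambda>x. cos (real m * x) * cos (real n * x)) =
     (\<lambda>x. (cos ((real m - real n) * x) + cos ((real m + real n) * x)) * (1/2))"
    by (rule ext) (simp add: cos_times_cos left_diff_distrib distrib_right)
  have "((if m = n then pi else 0) + 0) * (1/2) = (if m = n then pi / 2 else 0)" by simp
  then show ?thesis unfolding *
    using has_integral_mult_left[OF has_integral_add[OF has_integral_cos_diff[of m n] has_integral_cos_add[OF assms, of m]], of "1/2"]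
    by (simp only:)
qed

text \<open>
  The functions \<open>sin x (cos x)\<^sup>n\<close> lie in the span of the functions \<open>sin (k x)\<close>, and the
  polynomials in \<open>cos x\<close> are dense in the continuous functions on \<open>[0,\<pi>]\<close>.
\<close>

lemma sine_coeff_zero_imp_zero:
  assumes cont: "continuous_on {0..pi} h" and zero: "\<And>k. sine_coeff h k = 0"
    and x: "x \<in> {0..pi}"
  shows "h x = 0"
proof -
  \<comment> \<open>Multiplication by cos x turns sin (k x) into the mean of its two neighbours of
    frequency k + 1 and k - 1, so the induction on n must range over all k.\<close>
  have int0: "integral {0..pi} (\<lambda>x. h x * (sin (real k * x) * cos x ^ n)) = 0" for k n
  proof (induction n arbitrary: k)
    case 0
    show ?case using zero[of k] by (simp add: sine_coeff_def)
  next
    case (Suc n)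
    show ?case
    proof (cases k)
      case 0 then show ?thesis by simp
    next
      case (Suc j)
      have "(\<lambda>x. h x * (sin (real k * x) * cos x ^ Suc n)) =
        (\<lambda>x. h x * (sin (real (k + 1) * x) * cos x ^ n) * (1/2) + h x * (sin (real j * x) * cos x ^ n) * (1/2))"
      proof (rule ext)
        fix x :: real
        have "sin (real k * x) * cos x = (sin (real (k + 1) * x) + sin (real j * x)) / 2"
          by (simp add: sin_times_cos Suc add.commute distrib_right left_diff_distrib)
        then have "h x * (sin (real k * x) * cos x) * cos x ^ n = h x * ((sin (real (k + 1) * x) + sin (real j * x)) / 2) * cos x ^ n"
          by simp
        then show "h x * (sin (real k * x) * cos x ^ Suc n) =
            h x * (sin (real (k + 1) * x) * cos x ^ n) * (1/2) + h x * (sin (real j * x) * cos x ^ n) * (1/2)"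
          by (simp add: algebra_simps add_divide_distrib)
      qed
      moreover have "integral {0..pi} \<dots> = 
          integral {0..pi} (\<lambda>x. h x * (sin (real (k + 1) * x) * cos x ^ n)) * (1/2) +
          integral {0..pi} (\<lambda>x. h x * (sin (real j * x) * cos x ^ n)) * (1/2)"
        by (subst integral_add)
           (auto intro!: integrable_continuous_real continuous_intros cont)
      ultimately show ?thesis using Suc.IH[of "k + 1"] Suc.IH[of j] by simp
    qed
  qed
  have poly0: "integral {0..pi} (\<lambda>x. h x * sin x * p (cos x)) = 0" if p: "real_polynomial_function p" for p
  proof -
    obtain a n where p: "p = (\<lambda>x. \<Sum>i\<le>n. a i * x ^ i)"
      using p real_polynomial_function_iff_sum by blast
    have "(\<lambda>x. h x * sin x * p (cos x)) = (\<lambda>x. \<Sum>i\<le>n. a i * (h x * (sin (real 1 * x) * cos x ^ i)))"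
      by (simp add: p sum_distrib_left algebra_simps)
    moreover have "integral {0..pi} \<dots> = (\<Sum>i\<le>n. integral {0..pi} (\<lambda>x. a i * (h x * (sin (real 1 * x) * cos x ^ i))))"
      by (rule integral_sum) (auto intro!: integrable_continuous_real continuous_intros cont)
    moreover have "\<dots> = (\<Sum>i\<le>n. a i * integral {0..pi} (\<lambda>x. (h x * (sin (real 1 * x) * cos x ^ i))))"
      by (simp only: integral_mult_right)
    ultimately show ?thesis using int0[of 1] by simp
  qed
  let ?I = "integral {0..pi} (\<lambda>x. (h x)\<^sup>2 * sin x)"
  let ?J = "integral {0..pi} (\<lambda>x. \<bar>h x\<bar> * sin x)"
  have sin_ge: "sin x \<ge> 0" if "x \<in> {0..pi}" for x :: real using that sin_ge_zero by simp
  \<comment> \<open>A polynomial p approximating h(arccos y) on [-1,1] gives h(x) close to p(cos x).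
    As h sin p(cos) integrates to 0, only the error h - p(cos) survives in
    \<open>?I\<close>.\<close>
  have le: "?I \<le> e * ?J" if e: "e > 0" for e
  proof -
    have "continuous_on {-1..1} (\<lambda>y. h (arccos y))"
      by (intro continuous_on_compose2[OF cont] continuous_on_arccos')
         (auto simp: arccos_lbound arccos_ubound)
    then obtain p where p: "real_polynomial_function p" "\<And>y. y \<in> {-1..1} \<Longrightarrow> \<bar>h (arccos y) - p y\<bar> < e"
      using Stone_Weierstrass_real_polynomial_function[of "{-1..1}" "\<lambda>y. h (arccos y)" e] e by auto
    have pc: "continuous_on S (\<lambda>x. p (cos x))" for S
      by (rule continuous_on_compose2[OF continuous_on_polymonial_function[of p UNIV]])
         (auto intro!: continuous_intros simp: p real_polynomial_function_eq[symmetric])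
    have "?I = integral {0..pi} (\<lambda>x. h x * sin x * (h x - p (cos x)) + h x * sin x * p (cos x))"
      by (rule integral_cong) (simp add: power2_eq_square algebra_simps)
    also have "\<dots> = integral {0..pi} (\<lambda>x. h x * sin x * (h x - p (cos x)))"
      by (subst integral_add) (auto intro!: integrable_continuous_real continuous_intros cont pc simp: poly0[OF p(1)])
    also have "\<dots> \<le> integral {0..pi} (\<lambda>x. e * (\<bar>h x\<bar> * sin x))"
    proof (rule integral_le)
      show "h x * sin x * (h x - p (cos x)) \<le> e * (\<bar>h x\<bar> * sin x)" if x: "x \<in> {0..pi}" for x
      proof -
        have "\<bar>h x - p (cos x)\<bar> \<le> e" using p(2)[of "cos x"] x by (simp add: arccos_cos)
        then have "(\<bar>h x\<bar> * sin x) * \<bar>h x - p (cos x)\<bar> \<le> (\<bar>h x\<bar> * sin x) * e"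
          using sin_ge[OF x] by (intro mult_left_mono) auto
        then have "\<bar>h x * sin x * (h x - p (cos x))\<bar> \<le> e * (\<bar>h x\<bar> * sin x)"
          using sin_ge[OF x] by (simp add: abs_mult mult.commute)
        then show ?thesis by linarith
      qed
    qed (auto intro!: integrable_continuous_real continuous_intros cont pc)
    also have "\<dots> = e * ?J" by simp
    finally show ?thesis .
  qed
  have J0: "?J \<ge> 0"
  proof (rule integral_nonneg)
    show "0 \<le> \<bar>h x\<bar> * sin x" if "x \<in> {0..pi}" for x using sin_ge[OF that] by simp
  qed (auto intro!: integrable_continuous_real continuous_intros cont)
  have "?I \<le> 0"
  proof (rule field_le_epsilon)
    fix e :: real assume e: "e > 0"
    \<comment> \<open>The summand 1 avoids a division by zero when \<open>?J\<close> = 0.\<close>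
    have "?I \<le> e / (?J + 1) * ?J" using le[of "e / (?J + 1)"] e J0 by simp
    also have "\<dots> \<le> e" using e J0 by (simp add: field_simps)
    finally show "?I \<le> 0 + e" by simp
  qed
  moreover have "?I \<ge> 0"
  proof (rule integral_nonneg)
    show "0 \<le> (h x)\<^sup>2 * sin x" if "x \<in> {0..pi}" for x using sin_ge[OF that] by simp
  qed (auto intro!: integrable_continuous_real continuous_intros cont)
  ultimately have "?I = 0" by simp
  then have z: "(h y)\<^sup>2 * sin y = 0" if "y \<in> {0..pi}" for y
  proof -
    have "\<forall>y\<in>{0..pi}. (h y)\<^sup>2 * sin y = 0"
    proof (subst integral_eq_0_iff[symmetric])
      show "0 \<le> (h x)\<^sup>2 * sin x" if "x \<in> {0..pi}" for x using sin_ge[OF that] by simp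
    qed (use \<open>?I = 0\<close> in \<open>auto intro!: continuous_intros cont\<close>)
    with that show ?thesis by blast
  qed
  \<comment> \<open>The weight vanishes at both ends, so the end points are reached by continuity
    only.\<close>
  have "h y = 0" if "y \<in> {0<..<pi}" for y
    using z[of y] that sin_gt_zero[of y] by auto
  moreover have "closure {0<..<pi} = {0..pi}" by (simp add: closure_greaterThanLessThan)
  ultimately show ?thesis
    using continuous_constant_on_closure[of "{0<..<pi}" h 0 x] cont x by simp
qed

section \<open>Absolutely convergent sine series\<close>

lemma uniform_limit_sine_series:
  assumes "summable (\<lambda>k. \<bar>a k\<bar>)"
  shows "uniform_limit S (\<lambda>n x. \<Sum>k<n. a k * sin (real k * x)) (sine_series a) sequentially"
  unfolding sine_series_def
proof (rule Weierstrass_m_test[OF _ assms])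
  show "norm (a k * sin (real k * x)) \<le> \<bar>a k\<bar>" for k x
    using abs_sin_le_one[of "real k * x"] by (simp add: abs_mult mult_left_le)
qed

lemma summable_sine_series:
  assumes "summable (\<lambda>k. \<bar>a k\<bar>)"
  shows "summable (\<lambda>k. a k * sin (real k * x))"
proof (rule summable_comparison_test'[OF assms, of 0])
  show "norm (a k * sin (real k * x)) \<le> \<bar>a k\<bar>" for k
    using abs_sin_le_one[of "real k * x"] by (simp add: abs_mult mult_left_le)
qed

lemma continuous_on_sine_series:
  assumes "summable (\<lambda>k. \<bar>a k\<bar>)"
  shows "continuous_on S (sine_series a)"
  by (rule uniform_limit_theorem[OF _ uniform_limit_sine_series[OF assms]])
     (auto intro!: always_eventually continuous_intros)

lemma abs_sine_series_le:
  assumes "summable (\<lambda>k. \<bar>a k\<bar>)"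
  shows "\<bar>sine_series a x\<bar> \<le> (\<Sum>k. \<bar>a k\<bar>)"
proof -
  have le: "\<bar>a k * sin (real k * x)\<bar> \<le> \<bar>a k\<bar>" for k
    using abs_sin_le_one[of "real k * x"] by (simp add: abs_mult mult_left_le)
  have s: "summable (\<lambda>k. \<bar>a k * sin (real k * x)\<bar>)"
    by (rule summable_comparison_test'[OF assms, of 0]) (use le in auto)
  show ?thesis unfolding sine_series_def
    using summable_rabs[OF s] suminf_le[OF le s assms] by linarith
qed

lemma sine_series_boundary [simp]: "sine_series a 0 = 0" "sine_series a pi = 0"
  by (simp_all add: sine_series_def)

lemma sine_series_diff:
  assumes "summable (\<lambda>k. \<bar>a k\<bar>)" "summable (\<lambda>k. \<bar>b k\<bar>)"
  shows "sine_series a x - sine_series b x = sine_series (\<lambda>k. a k - b k) x"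
  unfolding sine_series_def
  using suminf_diff[OF summable_sine_series[OF assms(1), of x] summable_sine_series[OF assms(2), of x]]
  by (simp add: algebra_simps)

text \<open>Uniform convergence of the partial sums allows termwise integration against g. With g a
  sine this recovers the coefficients of a series; with g the function itself it is Parseval's
  identity.\<close>

lemma sums_integral_sine_series:
  assumes a: "summable (\<lambda>k. \<bar>a k\<bar>)" and g: "continuous_on {0..pi} g"
  shows "(\<lambda>k. a k * sine_coeff g k) sums (2 / pi * integral {0..pi} (\<lambda>x. g x * sine_series a x))"
proof -
  have bg: "bounded (g ` {0..pi})"
    using compact_continuous_image[OF g compact_Icc] compact_imp_bounded by blast
  have bs: "bounded (sine_series a ` {0..pi})"
    using compact_continuous_image[OF continuous_on_sine_series[OF a] compact_Icc] compact_imp_bounded by blast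
  have "uniform_limit {0..pi} (\<lambda>n x. g x * (\<Sum>k<n. a k * sin (real k * x))) (\<lambda>x. g x * sine_series a x) sequentially"
    by (intro uniform_limit_intros uniform_limit_sine_series a bg bs)
  then have "uniform_limit (cbox 0 pi) (\<lambda>n x. g x * (\<Sum>k<n. a k * sin (real k * x))) (\<lambda>x. g x * sine_series a x) sequentially"
    by simp
  then obtain I J where I: "\<And>n. ((\<lambda>x. g x * (\<Sum>k<n. a k * sin (real k * x))) has_integral I n) (cbox 0 pi)"
     and J: "((\<lambda>x. g x * sine_series a x) has_integral J) (cbox 0 pi)" and lim: "I \<longlonglongrightarrow> J"
    by (rule uniform_limit_integral_cbox) (auto intro!: continuous_intros g)
  have "I n = (\<Sum>k<n. pi / 2 * (a k * sine_coeff g k))" for n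
  proof -
    have "I n = integral {0..pi} (\<lambda>x. \<Sum>k<n. a k * (g x * sin (real k * x)))"
      using integral_unique[OF I[of n]] by (simp add: sum_distrib_left algebra_simps)
    also have "\<dots> = (\<Sum>k<n. integral {0..pi} (\<lambda>x. a k * (g x * sin (real k * x))))"
      by (rule integral_sum) (auto intro!: integrable_continuous_real continuous_intros g)
    finally show ?thesis by (simp add: sine_coeff_def)
  qed
  then have "I = (\<lambda>n. \<Sum>k<n. pi / 2 * (a k * sine_coeff g k))" by (rule ext)
  with lim have "(\<lambda>k. pi / 2 * (a k * sine_coeff g k)) sums J"
    unfolding sums_def by (simp only:)
  from sums_mult[OF this, of "2/pi"] integral_unique[OF J] show ?thesis by simp
qed

lemma sine_coeff_sin:
  "sine_coeff (\<lambda>x. sin (real n * x)) k = (if k = n \<and> k \<noteq> 0 then 1 else 0)"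
proof (cases "k = 0")
  case False
  have "sine_coeff (\<lambda>x. sin (real n * x)) k = 2 / pi * (if n = k then pi / 2 else 0)"
    unfolding sine_coeff_def integral_unique[OF has_integral_sin_sin[OF False, of n]] ..
  with False show ?thesis by (cases "n = k") simp_all
qed simp

lemma sine_coeff_sine_series:
  assumes a: "summable (\<lambda>k. \<bar>a k\<bar>)" and n: "n \<noteq> 0"
  shows "sine_coeff (sine_series a) n = a n"
proof -
  have "(\<lambda>k. a k * sine_coeff (\<lambda>x. sin (real n * x)) k) sums sine_coeff (sine_series a) n"
    using sums_integral_sine_series[OF a, of "\<lambda>x. sin (real n * x)"]
    by (simp add: sine_coeff_def[of "sine_series a"] continuous_intros mult.commute)
  moreover have "(\<lambda>k. a k * sine_coeff (\<lambda>x. sin (real n * x)) k) = (\<lambda>k. if k = n then a k else 0)"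
    using n by (auto simp: sine_coeff_sin)
  ultimately show ?thesis using sums_single[of n a] sums_unique2 by metis
qed

lemma sine_coeff_diff:
  assumes "continuous_on {0..pi} f" "continuous_on {0..pi} g"
  shows "sine_coeff (\<lambda>x. f x - g x) k = sine_coeff f k - sine_coeff g k"
proof -
  have "integral {0..pi} (\<lambda>x. f x * sin (real k * x) - g x * sin (real k * x)) =
      integral {0..pi} (\<lambda>x. f x * sin (real k * x)) - integral {0..pi} (\<lambda>x. g x * sin (real k * x))"
    by (rule integral_diff) (auto intro!: integrable_continuous_real continuous_intros assms)
  then show ?thesis unfolding sine_coeff_def left_diff_distrib right_diff_distrib[symmetric] by simp
qed

text \<open>The difference between f and its series is continuous and all its coefficients vanish,
  so completeness of the sines applies.\<close>

lemma sine_series_sine_coeff: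
  assumes f: "continuous_on {0..pi} f" and s: "summable (\<lambda>k. \<bar>sine_coeff f k\<bar>)" and x: "x \<in> {0..pi}"
  shows "sine_series (sine_coeff f) x = f x"
proof -
  let ?h = "\<lambda>x. f x - sine_series (sine_coeff f) x"
  have zero: "sine_coeff ?h k = 0" for k
    unfolding sine_coeff_diff[OF f continuous_on_sine_series[OF s]]
    using sine_coeff_sine_series[OF s, of k] by (cases "k = 0") simp_all
  have "?h x = 0"
    by (rule sine_coeff_zero_imp_zero[OF _ zero x]) (intro continuous_intros f continuous_on_sine_series s)
  then show ?thesis by simp
qed

lemma parseval_sine:
  assumes f: "continuous_on {0..pi} f" and s: "summable (\<lambda>k. \<bar>sine_coeff f k\<bar>)"
  shows "(\<lambda>k. (sine_coeff f k)\<^sup>2) sums (2 / pi * integral {0..pi} (\<lambda>x. (f x)\<^sup>2))"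
proof -
  have "integral {0..pi} (\<lambda>x. f x * sine_series (sine_coeff f) x) = integral {0..pi} (\<lambda>x. (f x)\<^sup>2)"
    by (rule integral_cong) (simp add: sine_series_sine_coeff[OF f s] power2_eq_square)
  then show ?thesis
    using sums_integral_sine_series[OF s f] by (simp add: power2_eq_square)
qed

lemma abs_integral_le:
  assumes f: "continuous_on {0..pi} f" and le: "\<And>x. x \<in> {0..pi} \<Longrightarrow> \<bar>f x\<bar> \<le> B"
  shows "\<bar>integral {0..pi} f\<bar> \<le> B * pi"
proof -
  have "norm (integral {0..pi} f) \<le> B * (pi - 0)"
    using integral_bound[of 0 pi f B] f le by simp
  then show ?thesis by simp
qed

lemma abs_sine_coeff_le:
  assumes f: "continuous_on {0..pi} f" and le: "\<And>x. x \<in> {0..pi} \<Longrightarrow> \<bar>f x\<bar> \<le> B"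
  shows "\<bar>sine_coeff f k\<bar> \<le> 2 * B"
proof -
  have B: "B \<ge> 0" using le[of 0] by simp
  have "\<bar>integral {0..pi} (\<lambda>x. f x * sin (real k * x))\<bar> \<le> B * pi"
  proof (rule abs_integral_le)
    show "\<bar>f x * sin (real k * x)\<bar> \<le> B" if "x \<in> {0..pi}" for x
      using mult_mono[OF le[OF that] abs_sin_le_one[of "real k * x"]] B by (simp add: abs_mult)
  qed (auto intro!: continuous_intros f)
  then have "2 / pi * \<bar>integral {0..pi} (\<lambda>x. f x * sin (real k * x))\<bar> \<le> 2 / pi * (B * pi)"
    by (intro mult_left_mono) auto
  then show ?thesis by (simp add: sine_coeff_def abs_mult)
qed

section \<open>Decay of coefficients\<close>

text \<open>The integrand is the derivative of f' sin (k x) - k f cos (k x), and the Dirichlet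
  conditions remove the boundary terms. This is what makes the Laplacian diagonal in the sine
  basis.\<close>

lemma sine_coeff_second_derivative:
  assumes f1: "\<And>x. x \<in> {0..pi} \<Longrightarrow> (f has_real_derivative f' x) (at x within {0..pi})"
    and f2: "\<And>x. x \<in> {0..pi} \<Longrightarrow> (f' has_real_derivative f'' x) (at x within {0..pi})"
    and c2: "continuous_on {0..pi} f''" and bc: "f 0 = 0" "f pi = 0"
  shows "sine_coeff f'' k = - (real k)\<^sup>2 * sine_coeff f k"
proof -
  have cf: "continuous_on {0..pi} f" by (rule DERIV_continuous_on[OF f1])
  have "((\<lambda>x. f'' x * sin (real k * x) + (real k)\<^sup>2 * (f x * sin (real k * x))) has_integral
      ((f' pi * sin (real k * pi) - real k * f pi * cos (real k * pi)) -
       (f' 0 * sin (real k * 0) - real k * f 0 * cos (real k * 0)))) {0..pi}"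
  proof (rule fundamental_theorem_of_calculus)
    fix x :: real assume x: "x \<in> {0..pi}"
    show "((\<lambda>x. f' x * sin (real k * x) - real k * f x * cos (real k * x)) has_vector_derivative
       f'' x * sin (real k * x) + (real k)\<^sup>2 * (f x * sin (real k * x))) (at x within {0..pi})"
      unfolding has_real_derivative_iff_has_vector_derivative[symmetric]
      by (rule derivative_eq_intros f1 f2 x refl)+ (simp add: power2_eq_square algebra_simps)
  qed simp
  then have "integral {0..pi} (\<lambda>x. f'' x * sin (real k * x) + (real k)\<^sup>2 * (f x * sin (real k * x))) = 0"
    using bc by (simp add: integral_unique)
  moreover have "integral {0..pi} (\<lambda>x. f'' x * sin (real k * x) + (real k)\<^sup>2 * (f x * sin (real k * x))) =
      integral {0..pi} (\<lambda>x. f'' x * sin (real k * x)) + integral {0..pi} (\<lambda>x. (real k)\<^sup>2 * (f x * sin (real k * x)))"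
    by (rule integral_add) (auto intro!: integrable_continuous_real continuous_intros c2 cf)
  ultimately have "integral {0..pi} (\<lambda>x. f'' x * sin (real k * x)) = - (real k)\<^sup>2 * integral {0..pi} (\<lambda>x. f x * sin (real k * x))"
    by simp
  then show ?thesis by (simp add: sine_coeff_def)
qed

text \<open>Stated for a general e so that it serves a sine sum and its cosine derivative alike. The
  condition on b 0 removes index 0, for which a cosine has a different norm.\<close>

lemma has_integral_square_sum:
  assumes orth: "\<And>m n. m \<noteq> 0 \<Longrightarrow> n \<noteq> 0 \<Longrightarrow>
      ((\<lambda>x. e (real m * x) * e (real n * x)) has_integral (if m = n then pi / 2 else 0)) {0..pi}"
    and b: "b 0 = 0"
  shows "((\<lambda>x. (\<Sum>k<N. b k * e (real k * x))\<^sup>2) has_integral pi / 2 * (\<Sum>k<N. (b k)\<^sup>2)) {0..pi::real}"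
proof -
  have *: "(\<lambda>x. (\<Sum>k<N. b k * e (real k * x))\<^sup>2) =
      (\<lambda>x. \<Sum>m<N. \<Sum>n<N. b m * b n * (e (real m * x) * e (real n * x)))"
    by (simp add: power2_eq_square sum_product algebra_simps)
  have "((\<lambda>x. b m * b n * (e (real m * x) * e (real n * x))) has_integral
      b m * b n * (if m = n then pi / 2 else 0)) {0..pi}" for m n
  proof (cases "m = 0 \<or> n = 0")
    case False
    then show ?thesis by (intro has_integral_mult_right orth) auto
  next
    case True
    then have 0: "b m * b n = 0" using b by auto
    show ?thesis unfolding 0 by simp
  qed
  then have "((\<lambda>x. (\<Sum>k<N. b k * e (real k * x))\<^sup>2) has_integral
      (\<Sum>m<N. \<Sum>n<N. b m * b n * (if m = n then pi / 2 else 0))) {0..pi}"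
    unfolding * by (intro has_integral_sum) auto
  moreover have "(\<Sum>m<N. \<Sum>n<N. b m * b n * (if m = n then pi / 2 else 0)) = pi / 2 * (\<Sum>k<N. (b k)\<^sup>2)"
    by (simp add: if_distrib[of "\<lambda>y. _ * y"] sum.delta power2_eq_square sum_distrib_left algebra_simps cong: if_cong)
  ultimately show ?thesis by simp
qed

lemmas has_integral_square_sin_sum = has_integral_square_sum[of sin, OF has_integral_sin_sin]
lemmas has_integral_square_cos_sum = has_integral_square_sum[of cos, OF has_integral_cos_cos]

text \<open>The decay estimates below differentiate the function; they are proved for finite sums,
  where this is harmless, and pass to the series through this limit.\<close>

lemma tendsto_sine_coeff_square:
  assumes "summable (\<lambda>k. \<bar>a k\<bar>)"
  shows "(\<lambda>N. sine_coeff (\<lambda>x. (\<Sum>k<N. a k * sin (real k * x))\<^sup>2) n)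
     \<longlonglongrightarrow> sine_coeff (\<lambda>x. (sine_series a x)\<^sup>2) n"
proof -
  let ?v = "\<lambda>N x. \<Sum>k<N. a k * sin (real k * x)"
  have bs: "bounded (sine_series a ` {0..pi})"
    using compact_continuous_image[OF continuous_on_sine_series[OF assms] compact_Icc] compact_imp_bounded by blast
  have bs2: "bounded ((\<lambda>x. sine_series a x * sine_series a x) ` {0..pi})"
    by (intro compact_imp_bounded compact_continuous_image continuous_intros continuous_on_sine_series assms) simp
  have bsin: "bounded ((\<lambda>x. sin (real n * x)) ` {0..pi})"
    by (intro compact_imp_bounded compact_continuous_image continuous_intros) simp
  have "uniform_limit {0..pi} (\<lambda>N x. (?v N x * ?v N x) * sin (real n * x)) (\<lambda>x. (sine_series a x * sine_series a x) * sin (real n * x)) sequentially"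
    by (intro uniform_limit_intros uniform_limit_sine_series assms bs bs2 bsin)
  then have "uniform_limit (cbox 0 pi) (\<lambda>N x. (?v N x * ?v N x) * sin (real n * x)) (\<lambda>x. (sine_series a x * sine_series a x) * sin (real n * x)) sequentially"
    by simp
  then obtain I J where I: "\<And>N. ((\<lambda>x. (?v N x * ?v N x) * sin (real n * x)) has_integral I N) (cbox 0 pi)"
     and J: "((\<lambda>x. (sine_series a x * sine_series a x) * sin (real n * x)) has_integral J) (cbox 0 pi)" and lim: "I \<longlonglongrightarrow> J"
    by (rule uniform_limit_integral_cbox) (auto intro!: continuous_intros)
  have "sine_coeff (\<lambda>x. (?v N x)\<^sup>2) n = 2 / pi * I N" for N
    using integral_unique[OF I[of N]] by (simp add: sine_coeff_def power2_eq_square)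
  moreover have "sine_coeff (\<lambda>x. (sine_series a x)\<^sup>2) n = 2 / pi * J"
    using integral_unique[OF J] by (simp add: sine_coeff_def power2_eq_square)
  ultimately show ?thesis by (simp only:) (intro tendsto_intros lim)
qed

text \<open>
  Series run over all \<open>k\<close>, including \<open>0\<close>: since \<open>x / 0 = 0\<close>, a bound \<open>\<bar>a k\<bar> \<le> C / (real k)\<^sup>2\<close> entails \<open>a 0 = 0\<close>.
\<close>

definition zeta2 :: real where "zeta2 = (\<Sum>k. 1 / (real k)\<^sup>2)"

lemma summable_inverse_square: "summable (\<lambda>k. C / (real k)\<^sup>2)"
  using summable_mult[OF inverse_power_summable[of 2, where 'a=real], of C] by (simp add: field_simps)

lemma suminf_inverse_square: "(\<Sum>k. C / (real k)\<^sup>2) = C * zeta2"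
  using suminf_mult[OF summable_inverse_square[of 1], of C] by (simp add: zeta2_def)

lemma zeta2_nonneg: "zeta2 \<ge> 0"
  unfolding zeta2_def by (rule suminf_nonneg[OF summable_inverse_square]) simp

lemma sum_inverse_square_le: "C \<ge> 0 \<Longrightarrow> (\<Sum>k<N. C / (real k)\<^sup>2) \<le> C * zeta2"
  using sum_le_suminf[OF summable_inverse_square[of C], of "{..<N}"] suminf_inverse_square[of C] by simp

lemma summable_of_inverse_square_bound:
  assumes "\<And>k. \<bar>a k\<bar> \<le> C / (real k)\<^sup>2"
  shows "summable (\<lambda>k. \<bar>a k\<bar>)"
  by (rule summable_comparison_test'[OF summable_inverse_square[of C], of 0]) (use assms in simp)

lemma abs_sine_series_inverse_square_le:
  assumes "\<And>k. \<bar>a k\<bar> \<le> C / (real k)\<^sup>2"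
  shows "\<bar>sine_series a x\<bar> \<le> C * zeta2"
  using abs_sine_series_le[OF summable_of_inverse_square_bound[of a C], of x] assms
    suminf_le[OF assms summable_of_inverse_square_bound[of a C] summable_inverse_square, OF assms]
  by (simp add: suminf_inverse_square)

lemma abs_integral_weighted_le:
  assumes f: "continuous_on {0..pi} f" and g: "continuous_on {0..pi} g" and e: "continuous_on {0..pi} e"
    and le: "\<And>x. \<bar>f x\<bar> \<le> g x" and e1: "\<And>x. \<bar>e x\<bar> \<le> (1::real)"
  shows "\<bar>integral {0..pi} (\<lambda>x. f x * e x)\<bar> \<le> integral {0..pi} (g :: real \<Rightarrow> real)"
proof -
  have "norm (integral {0..pi} (\<lambda>x. f x * e x)) \<le> integral {0..pi} g"
  proof (rule integral_norm_bound_integral)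
    show "norm (f x * e x) \<le> g x" for x
      using mult_mono[OF le[of x] e1[of x]] le[of x] by (simp add: abs_mult)
  qed (auto intro!: integrable_continuous_real continuous_intros f g e)
  then show ?thesis by simp
qed

lemma DERIV_sin_sum:
  "((\<lambda>x. \<Sum>k<N. c k * sin (real k * x)) has_real_derivative (\<Sum>k<N. (c k * real k) * cos (real k * x))) (at x within S)"
proof (rule DERIV_sum)
  fix k :: nat
  have "((\<lambda>x. sin (real k * x)) has_real_derivative cos (real k * x) * real k) (at x within S)"
    by (auto intro!: derivative_eq_intros)
  from DERIV_cmult[OF this, of "c k"]
  show "((\<lambda>x. c k * sin (real k * x)) has_real_derivative (c k * real k) * cos (real k * x)) (at x within S)"
    by (simp add: mult_ac)
qed

lemma DERIV_cos_sum:
  "((\<lambda>x. \<Sum>k<N. c k * cos (real k * x)) has_real_derivative (\<Sum>k<N. (- (c k * real k)) * sin (real k * x))) (at x within S)"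
proof (rule DERIV_sum)
  fix k :: nat
  have "((\<lambda>x. cos (real k * x)) has_real_derivative - sin (real k * x) * real k) (at x within S)"
    by (auto intro!: derivative_eq_intros)
  from DERIV_cmult[OF this, of "c k"]
  show "((\<lambda>x. c k * cos (real k * x)) has_real_derivative (- (c k * real k)) * sin (real k * x)) (at x within S)"
    by (simp add: mult_ac)
qed

text \<open>One integration by parts trades the factor n for 2 v v' cos (n x), bounded by v^2 +
  v'^2, whose integral is finite by Parseval: both a_k^2 and (k a_k)^2 are at most A^2/k^2, hence
  the factor 2.\<close>

lemma abs_sine_coeff_square_le1:
  assumes a: "\<And>k. \<bar>a k\<bar> \<le> A / (real k)\<^sup>2"
  shows "\<bar>sine_coeff (\<lambda>x. (sine_series a x)\<^sup>2) n\<bar> \<le> 2 * A\<^sup>2 * zeta2 / real n"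
proof (cases "n = 0")
  case False
  have a0: "a 0 = 0" using a[of 0] by simp
  have A0: "A \<ge> 0" using a[of 1] by simp
  have le: "\<bar>sine_coeff (\<lambda>x. (\<Sum>k<N. a k * sin (real k * x))\<^sup>2) n\<bar> \<le> 2 * A\<^sup>2 * zeta2 / real n" for N
  proof -
    let ?v = "\<lambda>x. \<Sum>k<N. a k * sin (real k * x)"
    let ?v1 = "\<lambda>x. \<Sum>k<N. (a k * real k) * cos (real k * x)"
    have dv: "(?v has_real_derivative ?v1 x) (at x within S)" for x S
      by (rule DERIV_sin_sum)
    have "((\<lambda>x. real n * ((?v x)\<^sup>2 * sin (real n * x)) - 2 * ?v x * ?v1 x * cos (real n * x)) has_integral
      (- (?v pi)\<^sup>2 * cos (real n * pi)) - (- (?v 0)\<^sup>2 * cos (real n * 0))) {0..pi}"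
    proof (rule fundamental_theorem_of_calculus)
      fix x :: real assume x: "x \<in> {0..pi}"
      show "((\<lambda>x. - (?v x)\<^sup>2 * cos (real n * x)) has_vector_derivative
        real n * ((?v x)\<^sup>2 * sin (real n * x)) - 2 * ?v x * ?v1 x * cos (real n * x)) (at x within {0..pi})"
        unfolding has_real_derivative_iff_has_vector_derivative[symmetric]
        by (rule derivative_eq_intros dv refl)+ (simp add: algebra_simps)
    qed simp
    then have "integral {0..pi} (\<lambda>x. real n * ((?v x)\<^sup>2 * sin (real n * x)) - 2 * ?v x * ?v1 x * cos (real n * x)) = 0"
      by (simp add: integral_unique)
    moreover have "integral {0..pi} (\<lambda>x. real n * ((?v x)\<^sup>2 * sin (real n * x)) - 2 * ?v x * ?v1 x * cos (real n * x)) =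
       integral {0..pi} (\<lambda>x. real n * ((?v x)\<^sup>2 * sin (real n * x))) - integral {0..pi} (\<lambda>x. 2 * ?v x * ?v1 x * cos (real n * x))"
      by (rule integral_diff) (auto intro!: integrable_continuous_real continuous_intros)
    ultimately have eq: "real n * integral {0..pi} (\<lambda>x. (?v x)\<^sup>2 * sin (real n * x)) = integral {0..pi} (\<lambda>x. 2 * ?v x * ?v1 x * cos (real n * x))"
      by simp
    have i1: "integral {0..pi} (\<lambda>x. (?v x)\<^sup>2) = pi / 2 * (\<Sum>k<N. (a k)\<^sup>2)"
      by (rule integral_unique[OF has_integral_square_sin_sum[of a, OF _ a0]])
    have i2: "integral {0..pi} (\<lambda>x. (?v1 x)\<^sup>2) = pi / 2 * (\<Sum>k<N. (a k * real k)\<^sup>2)"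
      by (rule integral_unique[OF has_integral_square_cos_sum[of "\<lambda>k. a k * real k"]]) auto
    have "\<bar>integral {0..pi} (\<lambda>x. (2 * ?v x * ?v1 x) * cos (real n * x))\<bar> \<le> integral {0..pi} (\<lambda>x. (?v x)\<^sup>2 + (?v1 x)\<^sup>2)"
    proof (rule abs_integral_weighted_le)
      show "\<bar>2 * ?v x * ?v1 x\<bar> \<le> (?v x)\<^sup>2 + (?v1 x)\<^sup>2" for x
        using sum_squares_bound[of "\<bar>?v x\<bar>" "\<bar>?v1 x\<bar>"] by (simp add: abs_mult)
    qed (auto intro!: continuous_intros)
    also have "\<dots> = integral {0..pi} (\<lambda>x. (?v x)\<^sup>2) + integral {0..pi} (\<lambda>x. (?v1 x)\<^sup>2)"
      by (rule integral_add) (auto intro!: integrable_continuous_real continuous_intros)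
    also have "\<dots> = pi / 2 * (\<Sum>k<N. (a k)\<^sup>2 + (a k * real k)\<^sup>2)"
      unfolding i1 i2 by (simp add: sum.distrib algebra_simps)
    also have "\<dots> \<le> pi / 2 * (\<Sum>k<N. (2 * A\<^sup>2) / (real k)\<^sup>2)"
    proof (intro mult_left_mono sum_mono)
      fix k
      show "(a k)\<^sup>2 + (a k * real k)\<^sup>2 \<le> (2 * A\<^sup>2) / (real k)\<^sup>2"
      proof (cases "k = 0")
        case False
        then have k: "real k \<ge> 1" by simp
        have ak: "\<bar>a k\<bar> * real k \<le> A / real k" using a[of k] k by (simp add: field_simps power2_eq_square)
        have "(\<bar>a k\<bar> * real k)\<^sup>2 \<le> (A / real k)\<^sup>2" using ak by (intro power_mono) auto
        then have "(a k * real k)\<^sup>2 \<le> A\<^sup>2 / (real k)\<^sup>2" by (simp add: power_mult_distrib power_divide)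
        moreover have "(a k)\<^sup>2 * 1 \<le> (a k)\<^sup>2 * (real k)\<^sup>2"
          using k by (intro mult_left_mono) auto
        ultimately show ?thesis by (simp add: power_mult_distrib)
      qed (simp add: a0)
    qed simp
    also have "\<dots> \<le> pi / 2 * ((2 * A\<^sup>2) * zeta2)"
      by (intro mult_left_mono sum_inverse_square_le) auto
    finally have "\<bar>real n * integral {0..pi} (\<lambda>x. (?v x)\<^sup>2 * sin (real n * x))\<bar> \<le> pi * A\<^sup>2 * zeta2"
      unfolding eq by simp
    then show ?thesis using False by (simp add: sine_coeff_def abs_mult field_simps)
  qed
  show ?thesis
    by (rule Lim_bounded[OF tendsto_rabs[OF tendsto_sine_coeff_square[OF summable_of_inverse_square_bound[OF a]]], of 0])
       (use le in auto)
qed simp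

text \<open>The square v^2 vanishes at both ends, so two integrations by parts are free of boundary
  terms. The faster decay puts v, v' and v'' in L^2; the factor 4 counts the terms in 2 v'^2 + v^2 +
  v''^2.\<close>

lemma abs_sine_coeff_square_le2:
  assumes a: "\<And>k. \<bar>a k\<bar> \<le> A / real k ^ 3"
  shows "\<bar>sine_coeff (\<lambda>x. (sine_series a x)\<^sup>2) n\<bar> \<le> 4 * A\<^sup>2 * zeta2 / (real n)\<^sup>2"
proof (cases "n = 0")
  case False
  have a0: "a 0 = 0" using a[of 0] by simp
  have A0: "A \<ge> 0" using a[of 1] by simp
  have le: "\<bar>sine_coeff (\<lambda>x. (\<Sum>k<N. a k * sin (real k * x))\<^sup>2) n\<bar> \<le> 4 * A\<^sup>2 * zeta2 / (real n)\<^sup>2" for N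
  proof -
    let ?v = "\<lambda>x. \<Sum>k<N. a k * sin (real k * x)"
    let ?v1 = "\<lambda>x. \<Sum>k<N. (a k * real k) * cos (real k * x)"
    let ?v2 = "\<lambda>x. \<Sum>k<N. (- (a k * (real k)\<^sup>2)) * sin (real k * x)"
    let ?g = "\<lambda>x. 2 * (?v1 x * ?v1 x + ?v x * ?v2 x)"
    have dv: "(?v has_real_derivative ?v1 x) (at x within S)" for x S
      by (rule DERIV_sin_sum)
    have dv1: "(?v1 has_real_derivative ?v2 x) (at x within S)" for x S
      using DERIV_cos_sum[of "\<lambda>k. a k * real k" N x S] by (simp add: power2_eq_square mult.assoc)
    have d1: "((\<lambda>x. (?v x)\<^sup>2) has_real_derivative 2 * (?v x * ?v1 x)) (at x within S)" for x S
      by (rule derivative_eq_intros dv refl | simp)+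
    have d2: "((\<lambda>x. 2 * (?v x * ?v1 x)) has_real_derivative ?g x) (at x within S)" for x S
      by (rule derivative_eq_intros dv dv1 refl)+ simp
    have eq: "sine_coeff ?g n = - (real n)\<^sup>2 * sine_coeff (\<lambda>x. (?v x)\<^sup>2) n"
      by (rule sine_coeff_second_derivative[OF d1 d2]) (auto intro!: continuous_intros)
    have i1: "integral {0..pi} (\<lambda>x. (?v x)\<^sup>2) = pi / 2 * (\<Sum>k<N. (a k)\<^sup>2)"
      by (rule integral_unique[OF has_integral_square_sin_sum[of a, OF _ a0]])
    have i2: "integral {0..pi} (\<lambda>x. (?v1 x)\<^sup>2) = pi / 2 * (\<Sum>k<N. (a k * real k)\<^sup>2)"
      by (rule integral_unique[OF has_integral_square_cos_sum[of "\<lambda>k. a k * real k"]]) auto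
    have i3: "integral {0..pi} (\<lambda>x. (?v2 x)\<^sup>2) = pi / 2 * (\<Sum>k<N. (- (a k * (real k)\<^sup>2))\<^sup>2)"
      by (rule integral_unique[OF has_integral_square_sin_sum[of "\<lambda>k. - (a k * (real k)\<^sup>2)"]]) auto
    have "\<bar>integral {0..pi} (\<lambda>x. ?g x * sin (real n * x))\<bar> \<le> integral {0..pi} (\<lambda>x. 2 * (?v1 x)\<^sup>2 + ((?v x)\<^sup>2 + (?v2 x)\<^sup>2))"
    proof (rule abs_integral_weighted_le)
      show "\<bar>?g x\<bar> \<le> 2 * (?v1 x)\<^sup>2 + ((?v x)\<^sup>2 + (?v2 x)\<^sup>2)" for x
      proof -
        have "\<bar>2 * (r * r + p * q)\<bar> \<le> 2 * r\<^sup>2 + (p\<^sup>2 + q\<^sup>2)" for p q r :: real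
          using zero_le_square[of "p + q"] zero_le_square[of "p - q"] zero_le_square[of r]
          unfolding abs_le_iff power2_eq_square by (simp only: algebra_simps) linarith
        then show ?thesis .
      qed
    qed (auto intro!: continuous_intros)
    also have "\<dots> = 2 * integral {0..pi} (\<lambda>x. (?v1 x)\<^sup>2) + (integral {0..pi} (\<lambda>x. (?v x)\<^sup>2) + integral {0..pi} (\<lambda>x. (?v2 x)\<^sup>2))"
      by (subst integral_add, (auto intro!: integrable_continuous_real continuous_intros)[2],
          subst integral_add, (auto intro!: integrable_continuous_real continuous_intros)[2]) simp
    also have "\<dots> = pi / 2 * (\<Sum>k<N. 2 * (a k * real k)\<^sup>2 + ((a k)\<^sup>2 + (a k * (real k)\<^sup>2)\<^sup>2))"
    proof -
      have "(\<Sum>k<N. 2 * (a k * real k)\<^sup>2 + ((a k)\<^sup>2 + (a k * (real k)\<^sup>2)\<^sup>2)) =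
          2 * (\<Sum>k<N. (a k * real k)\<^sup>2) + ((\<Sum>k<N. (a k)\<^sup>2) + (\<Sum>k<N. (a k * (real k)\<^sup>2)\<^sup>2))"
        by (simp add: sum.distrib sum_distrib_left)
      then show ?thesis unfolding i1 i2 i3 power2_minus by (simp only:) (simp add: field_simps)
    qed
    also have "\<dots> \<le> pi / 2 * (\<Sum>k<N. (4 * A\<^sup>2) / (real k)\<^sup>2)"
    proof (intro mult_left_mono sum_mono)
      fix k
      show "2 * (a k * real k)\<^sup>2 + ((a k)\<^sup>2 + (a k * (real k)\<^sup>2)\<^sup>2) \<le> (4 * A\<^sup>2) / (real k)\<^sup>2"
      proof (cases "k = 0")
        case False
        then have k: "real k \<ge> 1" by simp
        have ak: "\<bar>a k\<bar> * (real k)\<^sup>2 \<le> A / real k" using a[of k] k by (simp add: field_simps power2_eq_square power3_eq_cube)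
        have "(\<bar>a k\<bar> * (real k)\<^sup>2)\<^sup>2 \<le> (A / real k)\<^sup>2" using ak by (intro power_mono) auto
        then have 1: "(a k * (real k)\<^sup>2)\<^sup>2 \<le> A\<^sup>2 / (real k)\<^sup>2" by (simp add: power_mult_distrib power_divide)
        have k2: "(real k)\<^sup>2 \<ge> 1" using k by simp
        have 2: "(a k * real k)\<^sup>2 \<le> (a k * (real k)\<^sup>2)\<^sup>2"
          using mult_left_mono[OF k2, of "(a k * real k)\<^sup>2"] by (simp add: power2_eq_square algebra_simps)
        have 3: "(a k)\<^sup>2 \<le> (a k * real k)\<^sup>2"
          using mult_left_mono[OF k2, of "(a k)\<^sup>2"] by (simp add: power2_eq_square algebra_simps)
        have "(4 * A\<^sup>2) / (real k)\<^sup>2 = 4 * (A\<^sup>2 / (real k)\<^sup>2)" by simp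
        then show ?thesis using 1 2 3 by linarith
      qed (simp add: a0)
    qed simp
    also have "\<dots> \<le> pi / 2 * ((4 * A\<^sup>2) * zeta2)"
      by (intro mult_left_mono sum_inverse_square_le) auto
    finally have "\<bar>sine_coeff ?g n\<bar> \<le> 2 / pi * (pi / 2 * ((4 * A\<^sup>2) * zeta2))"
      unfolding sine_coeff_def abs_mult by (intro mult_mono) auto
    then show ?thesis using False unfolding eq by (simp add: abs_mult field_simps)
  qed
  show ?thesis
  proof (rule Lim_bounded[OF tendsto_rabs[OF tendsto_sine_coeff_square], of _ 0])
    show "summable (\<lambda>k. \<bar>a k\<bar>)"
    proof (rule summable_of_inverse_square_bound)
      show "\<bar>a k\<bar> \<le> A / (real k)\<^sup>2" for k
      proof (cases "k = 0")
        case False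
        then have "A / real k ^ 3 \<le> A / (real k)\<^sup>2"
          using A0 by (intro divide_left_mono power_increasing) auto
        then show ?thesis using a[of k] by linarith
      qed (simp add: a0)
    qed
  qed (use le in auto)
qed simp

section \<open>Scalar linear equations with damping, and the Cauchy-Schwarz inequality\<close>

lemma derivative_nonpos_imp_decreasing:
  fixes f :: "real \<Rightarrow> real"
  assumes "a \<le> b"
    and f: "\<And>s. s \<in> {a..b} \<Longrightarrow> (f has_real_derivative f' s) (at s within {a..b})"
    and le: "\<And>s. s \<in> {a..b} \<Longrightarrow> f' s \<le> 0"
  shows "f b \<le> f a"
proof (rule DERIV_nonpos_imp_decreasing_open[OF \<open>a \<le> b\<close>])
  fix x assume x: "a < x" "x < b"
  then have "at x within {a..b} = at x" by (intro at_within_interior) auto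
  with f[of x] le[of x] x show "\<exists>y. (f has_real_derivative y) (at x) \<and> y \<le> 0" by auto
next
  show "continuous_on {a..b} f" by (rule DERIV_continuous_on[OF f])
qed

text \<open>The function e^(\<mu> s) (y - Q/\<mu>) is nonincreasing, Q/\<mu> being the equilibrium
  under the worst constant forcing.\<close>

lemma damped_ode_upper:
  assumes ab: "a \<le> b" and mu: "\<mu> > 0"
    and y: "\<And>s. s \<in> {a..b} \<Longrightarrow> (y has_real_derivative - \<mu> * y s - q s) (at s within {a..b})"
    and q: "\<And>s. s \<in> {a..b} \<Longrightarrow> \<bar>q s\<bar> \<le> Q"
  shows "y b \<le> exp (- \<mu> * (b - a)) * y a + Q * ((1 - exp (- \<mu> * (b - a))) / \<mu>)"
proof -
  let ?w = "\<lambda>s. exp (\<mu> * s) * y s - Q / \<mu> * exp (\<mu> * s)"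
  have "?w b \<le> ?w a"
  proof (rule derivative_nonpos_imp_decreasing[OF ab])
    fix s assume s: "s \<in> {a..b}"
    show "(?w has_real_derivative exp (\<mu> * s) * (- q s - Q)) (at s within {a..b})"
      by (rule derivative_eq_intros y[OF s] refl)+ (use mu in \<open>simp add: field_simps\<close>)
    show "exp (\<mu> * s) * (- q s - Q) \<le> 0"
      using q[OF s] by (intro mult_nonneg_nonpos) auto
  qed
  then have "exp (- (\<mu> * b)) * ?w b \<le> exp (- (\<mu> * b)) * ?w a"
    by (intro mult_left_mono) auto
  moreover have "exp (- (\<mu> * b)) * ?w s = exp (- \<mu> * (b - s)) * (y s - Q / \<mu>)" for s
  proof -
    have "exp (- \<mu> * (b - s)) = exp (- (\<mu> * b)) * exp (\<mu> * s)"
      by (simp add: mult_exp_exp right_diff_distrib)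
    then show ?thesis by (simp only: right_diff_distrib mult_ac)
  qed
  ultimately have "exp (- \<mu> * (b - b)) * (y b - Q / \<mu>) \<le> exp (- \<mu> * (b - a)) * (y a - Q / \<mu>)"
    by (simp only:)
  moreover have "exp (- \<mu> * (b - a)) * (y a - Q / \<mu>) =
      exp (- \<mu> * (b - a)) * y a + Q * ((1 - exp (- \<mu> * (b - a))) / \<mu>) - Q / \<mu>"
    using mu by (simp add: field_simps)
  ultimately show ?thesis by simp
qed

lemma damped_ode_bound:
  assumes ab: "a \<le> b" and mu: "\<mu> > 0"
    and y: "\<And>s. s \<in> {a..b} \<Longrightarrow> (y has_real_derivative - \<mu> * y s - q s) (at s within {a..b})"
    and q: "\<And>s. s \<in> {a..b} \<Longrightarrow> \<bar>q s\<bar> \<le> Q"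
  shows "\<bar>y b\<bar> \<le> exp (- \<mu> * (b - a)) * \<bar>y a\<bar> + Q * ((1 - exp (- \<mu> * (b - a))) / \<mu>)"
proof -
  have "y b \<le> exp (- \<mu> * (b - a)) * y a + Q * ((1 - exp (- \<mu> * (b - a))) / \<mu>)"
    by (rule damped_ode_upper[OF ab mu y q])
  moreover have "- y b \<le> exp (- \<mu> * (b - a)) * - y a + Q * ((1 - exp (- \<mu> * (b - a))) / \<mu>)"
  proof (rule damped_ode_upper[OF ab mu])
    fix s assume s: "s \<in> {a..b}"
    show "((\<lambda>s. - y s) has_real_derivative - \<mu> * - y s - (- q s)) (at s within {a..b})"
      by (rule derivative_eq_intros y[OF s] refl)+ simp
    show "\<bar>- q s\<bar> \<le> Q" using q[OF s] by simp
  qed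
  moreover have "exp (- \<mu> * (b - a)) * y a \<le> exp (- \<mu> * (b - a)) * \<bar>y a\<bar>"
    "exp (- \<mu> * (b - a)) * - y a \<le> exp (- \<mu> * (b - a)) * \<bar>y a\<bar>"
    by (intro mult_left_mono; simp)+
  ultimately show ?thesis by linarith
qed

lemma one_minus_exp_div_le:
  fixes \<mu> t :: real
  assumes "\<mu> > 0" "t \<ge> 0"
  shows "(1 - exp (- \<mu> * t)) / \<mu> \<le> min t (1 / \<mu>)"
  using assms exp_ge_add_one_self[of "- \<mu> * t"] by (simp add: field_simps)

text \<open>Both arguments of the minimum matter: the elapsed time makes the forcing small on short
  intervals, and 1/\<mu>, with \<mu> = \<nu> k^2, gains two orders of decay in k.\<close>

lemma damped_ode_bound':
  assumes "a \<le> b" "\<mu> > 0"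
    and "\<And>s. s \<in> {a..b} \<Longrightarrow> (y has_real_derivative - \<mu> * y s - q s) (at s within {a..b})"
    and q: "\<And>s. s \<in> {a..b} \<Longrightarrow> \<bar>q s\<bar> \<le> Q"
  shows "\<bar>y b\<bar> \<le> exp (- \<mu> * (b - a)) * \<bar>y a\<bar> + Q * min (b - a) (1 / \<mu>)"
proof -
  have "Q \<ge> 0" using q[of a] assms(1) by simp
  then have "Q * ((1 - exp (- \<mu> * (b - a))) / \<mu>) \<le> Q * min (b - a) (1 / \<mu>)"
    using assms(1,2) by (intro mult_left_mono one_minus_exp_div_le) auto
  with damped_ode_bound[OF assms] show ?thesis by linarith
qed

lemma integral_Cauchy_Schwarz:
  fixes f g :: "real \<Rightarrow> real"
  assumes f: "continuous_on {a..b} f" and g: "continuous_on {a..b} g"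
  shows "(integral {a..b} (\<lambda>x. f x * g x))\<^sup>2 \<le> integral {a..b} (\<lambda>x. (f x)\<^sup>2) * integral {a..b} (\<lambda>x. (g x)\<^sup>2)"
proof -
  let ?A = "integral {a..b} (\<lambda>x. (f x)\<^sup>2)" and ?B = "integral {a..b} (\<lambda>x. f x * g x)"
    and ?C = "integral {a..b} (\<lambda>x. (g x)\<^sup>2)"
  have nn: "0 \<le> p\<^sup>2 * ?A + 2 * (p * q) * ?B + q\<^sup>2 * ?C" for p q
  proof -
    have "0 \<le> integral {a..b} (\<lambda>x. (p * f x + q * g x)\<^sup>2)"
      by (rule integral_nonneg) (auto intro!: integrable_continuous_real continuous_intros f g)
    also have "\<dots> = integral {a..b} (\<lambda>x. p\<^sup>2 * (f x)\<^sup>2 + 2 * (p * q) * (f x * g x) + q\<^sup>2 * (g x)\<^sup>2)"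
      by (rule integral_cong) (simp add: power2_eq_square algebra_simps)
    also have "\<dots> = p\<^sup>2 * ?A + 2 * (p * q) * ?B + q\<^sup>2 * ?C"
      by (subst integral_add, (auto intro!: integrable_continuous_real continuous_intros f g)[2],
          subst integral_add, (auto intro!: integrable_continuous_real continuous_intros f g)[2]) simp
    finally show ?thesis .
  qed
  have C0: "?C \<ge> 0" using nn[of 0 1] by simp
  show ?thesis
  proof (cases "?C = 0")
    case True
    have "?B = 0"
    proof (rule ccontr)
      assume B: "?B \<noteq> 0"
      \<comment> \<open>With this choice the quadratic form equals ?A - (?A + 1) = -1, against
        nonnegativity.\<close>
      from nn[of 1 "- (?A + 1) / (2 * ?B)"] True B show False by (simp add: field_simps)
    qed
    then show ?thesis using True by simp
  next
    case False
    then have C: "?C > 0" using C0 by simp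
    have "0 \<le> ?C * (?A * ?C - ?B\<^sup>2)"
      using nn[of "?C" "- ?B"] by (simp add: power2_eq_square algebra_simps)
    then show ?thesis using C by (simp add: zero_le_mult_iff)
  qed
qed

section \<open>A priori bounds\<close>

lemma abs_sin_mult_le: "\<bar>sin (real k * x)\<bar> \<le> real k * \<bar>sin x\<bar>"
proof (induction k)
  case (Suc k)
  have "\<bar>sin (real (Suc k) * x)\<bar> = \<bar>sin (real k * x) * cos x + cos (real k * x) * sin x\<bar>"
    using sin_add[of "real k * x" x] by (simp add: distrib_right add.commute)
  also have "\<dots> \<le> \<bar>sin (real k * x)\<bar> * 1 + 1 * \<bar>sin x\<bar>"
    using mult_left_mono[OF abs_cos_le_one[of x], of "\<bar>sin (real k * x)\<bar>"]
      mult_right_mono[OF abs_cos_le_one[of "real k * x"], of "\<bar>sin x\<bar>"]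
      abs_triangle_ineq[of "sin (real k * x) * cos x" "cos (real k * x) * sin x"]
    by (simp add: abs_mult)
  finally show ?case using Suc by (simp add: distrib_right)
qed simp

text \<open>
  With the weight \<open>sin x\<close>, which vanishes linearly at the boundary, the interval behaves like a
  two-dimensional domain: this is a form of Ladyzhenskaya's inequality
  \<open>\<parallel>u\<parallel>\<^sub>3\<^sup>3 \<le> C \<parallel>u\<parallel>\<^sub>2\<^sup>2 \<parallel>\<nabla>u\<parallel>\<^sub>2\<close>.
\<close>

lemma weighted_cubic_bound:
  fixes u u1 :: "real \<Rightarrow> real"
  assumes nu: "\<nu> > 0"
    and du: "\<And>x. x \<in> {0..pi} \<Longrightarrow> (u has_real_derivative u1 x) (at x within {0..pi})"
    and c1: "continuous_on {0..pi} u1"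
  defines "E \<equiv> integral {0..pi} (\<lambda>x. (u x)\<^sup>2 * sin x)"
    and "D \<equiv> integral {0..pi} (\<lambda>x. (u1 x)\<^sup>2 * sin x)"
  shows "2 * \<bar>integral {0..pi} (\<lambda>x. u x ^ 3 * sin x)\<bar> \<le> 2 * \<nu> * D + (8 / \<nu> + 2) * (E * (1 + E))"
proof -
  have c: "continuous_on {0..pi} u" by (rule DERIV_continuous_on[OF du])
  have sin_ge: "sin x \<ge> 0" if "x \<in> {0..pi}" for x :: real using that sin_ge_zero by simp
  have sq: "sqrt (sin x) * sqrt (sin x) = sin x" if "x \<in> {0..pi}" for x :: real using sin_ge[OF that] by simp
  note ci = integrable_continuous_real continuous_intros c c1
  have cs: "continuous_on {0..pi} (\<lambda>x. \<bar>u x\<bar> * sqrt (sin x))" "continuous_on {0..pi} (\<lambda>x. \<bar>u1 x\<bar> * sqrt (sin x))"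
    "continuous_on {0..pi} (\<lambda>x. (u x)\<^sup>2 * sqrt (sin x))"
    by (intro continuous_intros c c1)+
  have E0: "E \<ge> 0" unfolding E_def
    by (intro integral_nonneg mult_nonneg_nonneg sin_ge) (auto intro!: ci)
  have D0: "D \<ge> 0" unfolding D_def
    by (intro integral_nonneg mult_nonneg_nonneg sin_ge) (auto intro!: ci)
  \<comment> \<open>All estimates below reduce to E and to X, the Cauchy-Schwarz bound for the
    weighted integral of |u u'|.\<close>
  define X where "X = sqrt E * sqrt D"
  define L where "L = integral {0..pi} (\<lambda>x. (u x)\<^sup>2)"
  define J where "J = integral {0..pi} (\<lambda>x. \<bar>u x * u1 x\<bar> * sin x)"
  define Q where "Q = integral {0..pi} (\<lambda>x. u x ^ 4 * sin x)"
  have X0: "X \<ge> 0" unfolding X_def using E0 D0 by simp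
  have J: "J \<le> X"
  proof -
    have "J = integral {0..pi} (\<lambda>x. (\<bar>u x\<bar> * sqrt (sin x)) * (\<bar>u1 x\<bar> * sqrt (sin x)))"
      unfolding J_def
    proof (rule integral_cong)
      fix x :: real assume x: "x \<in> {0..pi}"
      have "\<bar>u x\<bar> * sqrt (sin x) * (\<bar>u1 x\<bar> * sqrt (sin x)) = \<bar>u x * u1 x\<bar> * (sqrt (sin x) * sqrt (sin x))"
        by (simp only: abs_mult mult_ac)
      then show "\<bar>u x * u1 x\<bar> * sin x = \<bar>u x\<bar> * sqrt (sin x) * (\<bar>u1 x\<bar> * sqrt (sin x))"
        using sq[OF x] by simp
    qed
    then have "J\<^sup>2 \<le> integral {0..pi} (\<lambda>x. (\<bar>u x\<bar> * sqrt (sin x))\<^sup>2) * integral {0..pi} (\<lambda>x. (\<bar>u1 x\<bar> * sqrt (sin x))\<^sup>2)"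
      using integral_Cauchy_Schwarz[OF cs(1,2)] by simp
    also have "integral {0..pi} (\<lambda>x. (\<bar>u x\<bar> * sqrt (sin x))\<^sup>2) = E" unfolding E_def
      by (rule integral_cong) (use sin_ge in \<open>simp add: power_mult_distrib\<close>)
    also have "integral {0..pi} (\<lambda>x. (\<bar>u1 x\<bar> * sqrt (sin x))\<^sup>2) = D" unfolding D_def
      by (rule integral_cong) (use sin_ge in \<open>simp add: power_mult_distrib\<close>)
    also have "E * D = X\<^sup>2" using E0 D0 by (simp add: X_def power_mult_distrib)
    finally show ?thesis using X0 by (rule power2_le_imp_le)
  qed
  \<comment> \<open>The unweighted norm is recovered from weighted quantities by differentiating sin
    x cos x u^2: the factor cos^2 - sin^2 = 1 - 2 sin^2 produces u^2 itself, and sin removes the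
    boundary terms whatever the values of u there.\<close>
  have L: "L \<le> 2 * E + 2 * X"
  proof -
    let ?h = "\<lambda>x. ((cos x)\<^sup>2 - (sin x)\<^sup>2) * (u x)\<^sup>2 + 2 * sin x * cos x * u x * u1 x"
    have "(?h has_integral (sin pi * cos pi * (u pi)\<^sup>2 - sin 0 * cos 0 * (u 0)\<^sup>2)) {0..pi}"
    proof (rule fundamental_theorem_of_calculus)
      fix x :: real assume x: "x \<in> {0..pi}"
      show "((\<lambda>x. sin x * cos x * (u x)\<^sup>2) has_vector_derivative ?h x) (at x within {0..pi})"
        unfolding has_real_derivative_iff_has_vector_derivative[symmetric]
        by (rule derivative_eq_intros du x refl)+ (simp add: power2_eq_square algebra_simps)
    qed simp
    then have h0: "integral {0..pi} ?h = 0" by (simp add: integral_unique)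
    have "L \<le> integral {0..pi} (\<lambda>x. ?h x + (2 * ((u x)\<^sup>2 * sin x) + 2 * (\<bar>u x * u1 x\<bar> * sin x)))"
      unfolding L_def
    proof (rule integral_le)
      fix x :: real assume x: "x \<in> {0..pi}"
      have s: "0 \<le> sin x" "sin x \<le> 1" using sin_ge[OF x] by auto
      have "(sin x)\<^sup>2 * (u x)\<^sup>2 \<le> sin x * (u x)\<^sup>2"
        using s mult_left_le[OF s(2) s(1)] by (intro mult_right_mono) (auto simp: power2_eq_square)
      moreover have "- (sin x * cos x * u x * u1 x) \<le> \<bar>u x * u1 x\<bar> * sin x"
      proof -
        have "\<bar>sin x * cos x * u x * u1 x\<bar> = (\<bar>u x * u1 x\<bar> * sin x) * \<bar>cos x\<bar>"
          using s by (simp add: abs_mult)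
        also have "\<dots> \<le> (\<bar>u x * u1 x\<bar> * sin x) * 1" using s by (intro mult_left_mono) auto
        finally show ?thesis by linarith
      qed
      moreover have "(u x)\<^sup>2 = ((cos x)\<^sup>2 - (sin x)\<^sup>2) * (u x)\<^sup>2 + 2 * ((sin x)\<^sup>2 * (u x)\<^sup>2)"
        using sin_cos_squared_add[of x] by (simp add: cos_squared_eq algebra_simps)
      ultimately show "(u x)\<^sup>2 \<le> ?h x + (2 * ((u x)\<^sup>2 * sin x) + 2 * (\<bar>u x * u1 x\<bar> * sin x))"
        by (simp add: mult_ac) 
    qed (auto intro!: ci)
    also have "\<dots> = 2 * E + 2 * J"
      unfolding E_def J_def
      by (subst integral_add, (auto intro!: ci)[2], subst integral_add, (auto intro!: ci)[2]) (simp add: h0)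
    finally show ?thesis using J by linarith
  qed
  \<comment> \<open>A pointwise bound with the degenerate weight, by integrating the derivative of
    sin x u^2 from 0, where it vanishes.\<close>
  have sup: "sin x * (u x)\<^sup>2 \<le> L + 2 * X" if x: "x \<in> {0..pi}" for x
  proof -
    let ?h = "\<lambda>x. cos x * (u x)\<^sup>2 + 2 * (sin x * (u x * u1 x))"
    let ?g = "\<lambda>x. (u x)\<^sup>2 + 2 * (\<bar>u x * u1 x\<bar> * sin x)"
    have ss: "{0..x} \<subseteq> {0..pi}" using x by auto
    have "(?h has_integral (sin x * (u x)\<^sup>2 - sin 0 * (u 0)\<^sup>2)) {0..x}"
    proof (rule fundamental_theorem_of_calculus)
      fix y :: real assume y: "y \<in> {0..x}"
      have dy: "(u has_real_derivative u1 y) (at y within {0..x})"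
        using has_field_derivative_subset[OF du[of y] ss] y ss by auto
      show "((\<lambda>x. sin x * (u x)\<^sup>2) has_vector_derivative ?h y) (at y within {0..x})"
        unfolding has_real_derivative_iff_has_vector_derivative[symmetric]
        by (rule derivative_eq_intros dy refl)+ (simp add: power2_eq_square algebra_simps)
    qed (use x in simp)
    then have "sin x * (u x)\<^sup>2 = integral {0..x} ?h" by (simp add: integral_unique)
    also have "\<dots> \<le> integral {0..x} ?g"
    proof (rule integral_le)
      fix y :: real assume "y \<in> {0..x}"
      then have s: "0 \<le> sin y" using sin_ge ss by auto
      have "cos y * (u y)\<^sup>2 \<le> 1 * (u y)\<^sup>2" by (intro mult_right_mono) auto
      moreover have "sin y * (u y * u1 y) \<le> sin y * \<bar>u y * u1 y\<bar>" using s by (intro mult_left_mono) auto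
      ultimately show "?h y \<le> ?g y" by (simp add: mult_ac)
    qed (auto intro!: ci continuous_on_subset[OF c ss] continuous_on_subset[OF c1 ss])
    also have "\<dots> \<le> integral {0..pi} ?g"
      by (rule integral_subset_le[OF ss])
         (auto intro!: ci continuous_on_subset[OF c ss] continuous_on_subset[OF c1 ss] add_nonneg_nonneg mult_nonneg_nonneg simp: sin_ge_zero)
    also have "\<dots> = L + 2 * J" unfolding L_def J_def
      by (subst integral_add, (auto intro!: ci)[2]) simp
    finally show ?thesis using J by linarith
  qed
  have L0: "L \<ge> 0" unfolding L_def by (intro integral_nonneg) (auto intro!: ci)
  have Q: "Q \<le> (L + 2 * X) * L"
  proof -
    have "Q \<le> integral {0..pi} (\<lambda>x. (L + 2 * X) * (u x)\<^sup>2)" unfolding Q_def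
    proof (rule integral_le)
      fix x :: real assume x: "x \<in> {0..pi}"
      have "(sin x * (u x)\<^sup>2) * (u x)\<^sup>2 \<le> (L + 2 * X) * (u x)\<^sup>2"
        by (intro mult_right_mono sup x) simp
      then show "u x ^ 4 * sin x \<le> (L + 2 * X) * (u x)\<^sup>2"
        by (simp add: power4_eq_xxxx power2_eq_square mult_ac)
    qed (auto intro!: ci)
    then show ?thesis by (simp add: L_def)
  qed
  define Z where "Z = integral {0..pi} (\<lambda>x. \<bar>u x\<bar> ^ 3 * sin x)"
  have Z0: "Z \<ge> 0" unfolding Z_def
    by (intro integral_nonneg mult_nonneg_nonneg sin_ge) (auto intro!: ci)
  \<comment> \<open>Cauchy-Schwarz splits the cubic integral into E and the quartic one Q. Both
    factors in the bound for Q are at most 2 E + 4 X.\<close>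
  have Zle: "Z \<le> sqrt E * (2 * E + 4 * X)"
  proof (rule power2_le_imp_le)
    have "Z = integral {0..pi} (\<lambda>x. (\<bar>u x\<bar> * sqrt (sin x)) * ((u x)\<^sup>2 * sqrt (sin x)))"
      unfolding Z_def
    proof (rule integral_cong)
      fix x :: real assume x: "x \<in> {0..pi}"
      have "\<bar>u x\<bar> * sqrt (sin x) * ((u x)\<^sup>2 * sqrt (sin x)) = \<bar>u x\<bar> * \<bar>u x\<bar>\<^sup>2 * (sqrt (sin x) * sqrt (sin x))"
        by (simp only: power2_abs mult_ac)
      then show "\<bar>u x\<bar> ^ 3 * sin x = \<bar>u x\<bar> * sqrt (sin x) * ((u x)\<^sup>2 * sqrt (sin x))"
        using sq[OF x] by (simp add: power3_eq_cube power2_eq_square)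
    qed
    then have "Z\<^sup>2 \<le> integral {0..pi} (\<lambda>x. (\<bar>u x\<bar> * sqrt (sin x))\<^sup>2) * integral {0..pi} (\<lambda>x. ((u x)\<^sup>2 * sqrt (sin x))\<^sup>2)"
      using integral_Cauchy_Schwarz[OF cs(1,3)] by simp
    also have "integral {0..pi} (\<lambda>x. (\<bar>u x\<bar> * sqrt (sin x))\<^sup>2) = E" unfolding E_def
      by (rule integral_cong) (use sin_ge in \<open>simp add: power_mult_distrib\<close>)
    also have "integral {0..pi} (\<lambda>x. ((u x)\<^sup>2 * sqrt (sin x))\<^sup>2) = Q" unfolding Q_def
      by (rule integral_cong) (use sin_ge in \<open>simp add: power_mult_distrib power_mult[symmetric]\<close>)
    also have "E * Q \<le> E * ((2 * E + 4 * X) * (2 * E + 4 * X))"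
    proof (intro mult_left_mono E0)
      show "Q \<le> (2 * E + 4 * X) * (2 * E + 4 * X)"
        by (rule order.trans[OF Q]) (intro mult_mono; use L X0 E0 L0 in linarith)
    qed
    also have "\<dots> = (sqrt E * (2 * E + 4 * X))\<^sup>2" using E0 by (simp add: power_mult_distrib power2_eq_square)
    finally show "Z\<^sup>2 \<le> (sqrt E * (2 * E + 4 * X))\<^sup>2" .
    show "0 \<le> sqrt E * (2 * E + 4 * X)" using E0 X0 by simp
  qed
  have Zabs: "\<bar>integral {0..pi} (\<lambda>x. u x ^ 3 * sin x)\<bar> \<le> Z"
  proof -
    have "norm (integral {0..pi} (\<lambda>x. u x ^ 3 * sin x)) \<le> Z" unfolding Z_def
      by (rule integral_norm_bound_integral) (auto intro!: ci simp: abs_mult power_abs sin_ge_zero)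
    then show ?thesis by simp
  qed
  have "sqrt E * (2 * E + 4 * X) = 2 * (E * sqrt E) + 4 * (E * sqrt D)"
    using E0 by (simp add: X_def algebra_simps)
  moreover have "2 * (E * sqrt E) \<le> E * (1 + E)"
  proof -
    have "2 * sqrt E \<le> 1 + E"
      using zero_le_power2[of "1 - sqrt E"] E0 by (simp add: power2_diff)
    from mult_left_mono[OF this E0] show ?thesis by (simp add: mult_ac)
  qed
  \<comment> \<open>Young's inequality, tuned so that the D term is exactly the dissipation 2 \<nu>
    D of the energy identity; this fixes the constant 8/\<nu>. The other constant 2 comes from the E
    sqrt E term.\<close>
  moreover have "8 * (E * sqrt D) \<le> 2 * \<nu> * D + 8 / \<nu> * (E * (1 + E))"
  proof -
    have "0 \<le> 2 * \<nu> * (sqrt D - 2 * E / \<nu>)\<^sup>2" using nu by simp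
    also have "\<dots> = 2 * \<nu> * D - 8 * (E * sqrt D) + 8 / \<nu> * (E * E)"
      using nu D0 by (simp add: power2_diff field_simps power2_eq_square)
    finally have "8 * (E * sqrt D) \<le> 2 * \<nu> * D + 8 / \<nu> * (E * E)" by simp
    also have "\<dots> \<le> 2 * \<nu> * D + 8 / \<nu> * (E * (1 + E))"
      using nu E0 by (intro add_left_mono mult_left_mono) auto
    finally show ?thesis .
  qed
  moreover have "(8 / \<nu> + 2) * (E * (1 + E)) = 8 / \<nu> * (E * (1 + E)) + 2 * (E * (1 + E))"
    by (simp add: distrib_right)
  ultimately show ?thesis using Zabs Zle by linarith
qed

section \<open>Weighted integrals and sine coefficients of a smooth solution\<close>

lemma has_derivative_weighted_integral:
  fixes f ft :: "real \<Rightarrow> real \<Rightarrow> real"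
  assumes dt: "\<And>x t. x \<in> {0..pi} \<Longrightarrow> t \<in> {a<..<b} \<Longrightarrow> ((\<lambda>s. f x s) has_real_derivative ft x t) (at t)"
    and cx: "\<And>t. t \<in> {a<..<b} \<Longrightarrow> continuous_on {0..pi} (\<lambda>x. f x t)"
    and ct: "continuous_on ({0..pi} \<times> {a<..<b}) (\<lambda>(x, t). ft x t)"
    and m: "continuous_on {0..pi} m" and t: "t \<in> {a<..<b}"
  shows "((\<lambda>t. integral {0..pi} (\<lambda>x. f x t * m x)) has_real_derivative
    integral {0..pi} (\<lambda>x. ft x t * m x)) (at t)"
proof -
  have "((\<lambda>t. integral (cbox 0 pi) (\<lambda>x. f x t * m x)) has_real_derivative
    integral (cbox 0 pi) (\<lambda>x. ft x t * m x)) (at t within {a<..<b})"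
  proof (rule leibniz_rule_field_derivative[OF _ _ _ t])
    fix s x :: real assume s: "s \<in> {a<..<b}" and x: "x \<in> cbox 0 pi"
    have "((\<lambda>s. f x s) has_real_derivative ft x s) (at s within {a<..<b})"
      using dt[of x s] s x by (auto intro: has_field_derivative_at_within)
    then show "((\<lambda>s. f x s * m x) has_real_derivative ft x s * m x) (at s within {a<..<b})"
      by (rule DERIV_cmult_right)
  next
    fix s assume "s \<in> {a<..<b}"
    then show "(\<lambda>x. f x s * m x) integrable_on cbox 0 pi"
      by (simp only: cbox_interval) (intro integrable_continuous_real continuous_intros cx m)
  next
    have "continuous_on ({a<..<b} \<times> {0..pi}) (\<lambda>p. (\<lambda>(x, t). ft x t) (snd p, fst p) * m (snd p))"
      by (intro continuous_intros continuous_on_compose2[OF ct] continuous_on_compose2[OF m]) auto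
    then show "continuous_on ({a<..<b} \<times> cbox 0 pi) (\<lambda>(s, x). ft x s * m x)"
      by (simp add: case_prod_beta')
  qed simp
  moreover have "at t within {a<..<b} = at t" using t by (intro at_within_open) auto
  ultimately show ?thesis by simp
qed

locale dirichlet_solution =
  fixes \<nu> a b :: real and w wt wx wxx :: "real \<Rightarrow> real \<Rightarrow> real"
  assumes nu: "\<nu> > 0"
    and dt: "\<And>x t. x \<in> {0..pi} \<Longrightarrow> t \<in> {a<..<b} \<Longrightarrow> ((\<lambda>s. w x s) has_real_derivative wt x t) (at t)"
    and dx: "\<And>x t. x \<in> {0..pi} \<Longrightarrow> t \<in> {a<..<b} \<Longrightarrow> ((\<lambda>y. w y t) has_real_derivative wx x t) (at x within {0..pi})"
    and dxx: "\<And>x t. x \<in> {0..pi} \<Longrightarrow> t \<in> {a<..<b} \<Longrightarrow> ((\<lambda>y. wx y t) has_real_derivative wxx x t) (at x within {0..pi})"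
    and cw: "continuous_on ({0..pi} \<times> {a<..<b}) (\<lambda>(x, t). w x t)"
    and cwt: "continuous_on ({0..pi} \<times> {a<..<b}) (\<lambda>(x, t). wt x t)"
    and cwxx: "continuous_on ({0..pi} \<times> {a<..<b}) (\<lambda>(x, t). wxx x t)"
    and pde: "\<And>x t. x \<in> {0<..<pi} \<Longrightarrow> t \<in> {a<..<b} \<Longrightarrow> wt x t = \<nu> * wxx x t - (w x t)\<^sup>2"
    and bc: "\<And>t. t \<in> {a<..<b} \<Longrightarrow> w 0 t = 0" "\<And>t. t \<in> {a<..<b} \<Longrightarrow> w pi t = 0"
begin

lemma cont_space:
  assumes "t \<in> {a<..<b}"
  shows "continuous_on {0..pi} (\<lambda>x. w x t)" "continuous_on {0..pi} (\<lambda>x. wx x t)"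
    "continuous_on {0..pi} (\<lambda>x. wt x t)" "continuous_on {0..pi} (\<lambda>x. wxx x t)"
proof -
  show "continuous_on {0..pi} (\<lambda>x. w x t)" by (rule DERIV_continuous_on[OF dx[OF _ assms]])
  show "continuous_on {0..pi} (\<lambda>x. wx x t)" by (rule DERIV_continuous_on[OF dxx[OF _ assms]])
  have "continuous_on {0..pi} (\<lambda>x. (\<lambda>(x, t). wt x t) (x, t))"
    by (intro continuous_on_compose2[OF cwt] continuous_intros) (use assms in auto)
  then show "continuous_on {0..pi} (\<lambda>x. wt x t)" by simp
  have "continuous_on {0..pi} (\<lambda>x. (\<lambda>(x, t). wxx x t) (x, t))"
    by (intro continuous_on_compose2[OF cwxx] continuous_intros) (use assms in auto)
  then show "continuous_on {0..pi} (\<lambda>x. wxx x t)" by simp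
qed

definition coeff :: "nat \<Rightarrow> real \<Rightarrow> real" where "coeff k t = sine_coeff (\<lambda>x. w x t) k"

definition sq_coeff :: "nat \<Rightarrow> real \<Rightarrow> real" where "sq_coeff k t = sine_coeff (\<lambda>x. (w x t)\<^sup>2) k"

definition E :: "real \<Rightarrow> real" where "E t = integral {0..pi} (\<lambda>x. (w x t)\<^sup>2 * sin x)"

definition F :: "real \<Rightarrow> real" where "F t = integral {0..pi} (\<lambda>x. w x t * sin x)"

text \<open>The equation is known only in the open interval, but at the end points both sides are
  multiplied by 0, so integrals over the closed interval can be rewritten.\<close>

lemma pde_sin:
  assumes "x \<in> {0..pi}" "t \<in> {a<..<b}"
  shows "wt x t * sin (real k * x) = (\<nu> * wxx x t - (w x t)\<^sup>2) * sin (real k * x)"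
proof (cases "x = 0 \<or> x = pi")
  case False
  then show ?thesis using pde[of x t] assms by auto
qed auto

lemma coeff_wxx:
  assumes t: "t \<in> {a<..<b}"
  shows "sine_coeff (\<lambda>x. wxx x t) k = - (real k)\<^sup>2 * coeff k t"
  unfolding coeff_def
  by (rule sine_coeff_second_derivative[where f' = "\<lambda>x. wx x t"]) (use t dx dxx bc cont_space in auto)

lemma coeff_deriv:
  assumes t: "t \<in> {a<..<b}"
  shows "(coeff k has_real_derivative - (\<nu> * (real k)\<^sup>2) * coeff k t - sq_coeff k t) (at t)"
proof -
  have "((\<lambda>t. integral {0..pi} (\<lambda>x. w x t * sin (real k * x))) has_real_derivative
    integral {0..pi} (\<lambda>x. wt x t * sin (real k * x))) (at t)"
    by (rule has_derivative_weighted_integral[OF dt _ cwt _ t]) (auto intro!: continuous_intros cont_space)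
  then have "(coeff k has_real_derivative 2 / pi * integral {0..pi} (\<lambda>x. wt x t * sin (real k * x))) (at t)"
    unfolding coeff_def sine_coeff_def by (rule DERIV_cmult)
  moreover have "2 / pi * integral {0..pi} (\<lambda>x. wt x t * sin (real k * x)) =
    \<nu> * sine_coeff (\<lambda>x. wxx x t) k - sq_coeff k t"
  proof -
    have "integral {0..pi} (\<lambda>x. wt x t * sin (real k * x)) =
      integral {0..pi} (\<lambda>x. \<nu> * (wxx x t * sin (real k * x)) - (w x t)\<^sup>2 * sin (real k * x))"
      by (rule integral_cong) (use pde_sin[OF _ t] in \<open>simp add: left_diff_distrib\<close>)
    also have "\<dots> = integral {0..pi} (\<lambda>x. \<nu> * (wxx x t * sin (real k * x))) - integral {0..pi} (\<lambda>x. (w x t)\<^sup>2 * sin (real k * x))"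
      by (rule integral_diff) (auto intro!: integrable_continuous_real continuous_intros cont_space t)
    finally show ?thesis by (simp add: sine_coeff_def sq_coeff_def right_diff_distrib)
  qed
  ultimately show ?thesis unfolding coeff_wxx[OF t] by (simp add: mult_ac)
qed

lemma F_deriv:
  assumes t: "t \<in> {a<..<b}"
  shows "(F has_real_derivative - \<nu> * F t - E t) (at t)"
proof -
  have F: "F = (\<lambda>t. pi / 2 * coeff 1 t)" by (simp add: F_def coeff_def sine_coeff_def fun_eq_iff)
  have E: "E t = pi / 2 * sq_coeff 1 t" by (simp add: E_def sq_coeff_def sine_coeff_def)
  show ?thesis
    using DERIV_cmult[OF coeff_deriv[OF t, of 1], of "pi / 2"] unfolding F E
    by (simp add: algebra_simps)
qed

lemma E_nonneg: "t \<in> {a<..<b} \<Longrightarrow> E t \<ge> 0"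
  unfolding E_def
  by (intro integral_nonneg integrable_continuous_real continuous_intros cont_space) (auto simp: sin_ge_zero)

text \<open>Cauchy-Schwarz for the measure sin x dx, of total mass 2: it is the nonnegativity of the
  weighted variance around the mean F/2.\<close>

lemma F_square_le:
  assumes t: "t \<in> {a<..<b}"
  shows "(F t)\<^sup>2 \<le> 2 * E t"
proof -
  have "((\<lambda>x. sin x) has_integral (- cos pi - - cos 0)) {0..pi}"
    by (rule fundamental_theorem_of_calculus)
       (auto intro!: derivative_eq_intros simp: has_real_derivative_iff_has_vector_derivative[symmetric])
  then have s: "integral {0..pi} sin = (2::real)" by (simp add: integral_unique)
  note ci = integrable_continuous_real continuous_intros cont_space[OF t]
  have "0 \<le> integral {0..pi} (\<lambda>x. (w x t - F t / 2)\<^sup>2 * sin x)"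
    by (intro integral_nonneg ci) (auto simp: sin_ge_zero)
  also have "\<dots> = integral {0..pi} (\<lambda>x. (w x t)\<^sup>2 * sin x - F t * (w x t * sin x) + (F t)\<^sup>2 / 4 * sin x)"
    by (rule integral_cong) (simp add: power2_diff algebra_simps power_divide)
  also have "\<dots> = E t - F t * F t + (F t)\<^sup>2 / 4 * 2"
  proof -
    have "integral {0..pi} (\<lambda>x. (w x t)\<^sup>2 * sin x - F t * (w x t * sin x) + (F t)\<^sup>2 / 4 * sin x) =
      integral {0..pi} (\<lambda>x. (w x t)\<^sup>2 * sin x - F t * (w x t * sin x)) + integral {0..pi} (\<lambda>x. (F t)\<^sup>2 / 4 * sin x)"
      by (intro integral_add ci)
    also have "integral {0..pi} (\<lambda>x. (w x t)\<^sup>2 * sin x - F t * (w x t * sin x)) =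
      integral {0..pi} (\<lambda>x. (w x t)\<^sup>2 * sin x) - integral {0..pi} (\<lambda>x. F t * (w x t * sin x))"
      by (intro integral_diff ci)
    finally show ?thesis using s by (simp add: E_def F_def)
  qed
  finally show ?thesis by (simp add: power2_eq_square)
qed

text \<open>With D and Z the weighted integrals of \<open>wx\<close>^2 and of w^3, the identity is
  E' = -2 \<nu> D - \<nu> E - 2 Z. The cubic term has no sign; the dissipation 2 \<nu> D absorbs the
  part of it that E does not control.\<close>

lemma E_deriv:
  assumes t: "t \<in> {a<..<b}"
  shows "\<exists>E'. (E has_real_derivative E') (at t) \<and> E' \<le> (8 / \<nu> + 2) * (E t * (1 + E t))"
proof -
  note ci = integrable_continuous_real continuous_intros cont_space[OF t]
  let ?D = "integral {0..pi} (\<lambda>x. (wx x t)\<^sup>2 * sin x)"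
  let ?Z = "integral {0..pi} (\<lambda>x. w x t ^ 3 * sin x)"
  let ?W = "integral {0..pi} (\<lambda>x. w x t * wxx x t * sin x)"
  have "(E has_real_derivative integral {0..pi} (\<lambda>x. (2 * w x t * wt x t) * sin x)) (at t)"
    unfolding E_def[abs_def]
  proof (rule has_derivative_weighted_integral[OF _ _ _ _ t])
    fix x s assume "x \<in> {0..pi}" "s \<in> {a<..<b}"
    from dt[OF this] show "((\<lambda>s. (w x s)\<^sup>2) has_real_derivative 2 * w x s * wt x s) (at s)"
      by (auto intro!: derivative_eq_intros)
  next
    have "continuous_on ({0..pi} \<times> {a<..<b}) (\<lambda>p. 2 * (\<lambda>(x, t). w x t) p * (\<lambda>(x, t). wt x t) p)"
      by (intro continuous_intros cw cwt)
    then show "continuous_on ({0..pi} \<times> {a<..<b}) (\<lambda>(x, t). 2 * w x t * wt x t)"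
      by (simp add: case_prod_beta')
  qed (auto intro!: continuous_intros cont_space)
  moreover have "integral {0..pi} (\<lambda>x. (2 * w x t * wt x t) * sin x) = 2 * \<nu> * ?W - 2 * ?Z"
  proof -
    have "integral {0..pi} (\<lambda>x. (2 * w x t * wt x t) * sin x) =
      integral {0..pi} (\<lambda>x. 2 * \<nu> * (w x t * wxx x t * sin x) - 2 * (w x t ^ 3 * sin x))"
    proof (rule integral_cong)
      fix x assume x: "x \<in> {0..pi}"
      have "wt x t * sin x = (\<nu> * wxx x t - (w x t)\<^sup>2) * sin x" using pde_sin[OF x t, of 1] by simp
      then have "2 * w x t * (wt x t * sin x) = 2 * w x t * ((\<nu> * wxx x t - (w x t)\<^sup>2) * sin x)" by simp
      then show "(2 * w x t * wt x t) * sin x = 2 * \<nu> * (w x t * wxx x t * sin x) - 2 * (w x t ^ 3 * sin x)"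
        by (simp add: algebra_simps power2_eq_square power3_eq_cube)
    qed
    also have "\<dots> = integral {0..pi} (\<lambda>x. 2 * \<nu> * (w x t * wxx x t * sin x)) - integral {0..pi} (\<lambda>x. 2 * (w x t ^ 3 * sin x))"
      by (intro integral_diff ci)
    finally show ?thesis by simp
  qed
  moreover have "?W = - ?D - E t / 2"
  proof -
    \<comment> \<open>Derivative of w wx sin - w^2 cos / 2. The second term cancels the mixed
      product w wx cos and leaves half of w^2 sin, the source of E/2.\<close>
    let ?h = "\<lambda>x. w x t * wxx x t * sin x + ((wx x t)\<^sup>2 * sin x + (w x t)\<^sup>2 * sin x * (1 / 2))"
    have "(?h has_integral ((w pi t * wx pi t * sin pi - (w pi t)\<^sup>2 * cos pi * (1 / 2))
        - (w 0 t * wx 0 t * sin 0 - (w 0 t)\<^sup>2 * cos 0 * (1 / 2)))) {0..pi}"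
    proof (rule fundamental_theorem_of_calculus)
      fix x :: real assume x: "x \<in> {0..pi}"
      show "((\<lambda>x. w x t * wx x t * sin x - (w x t)\<^sup>2 * cos x * (1 / 2)) has_vector_derivative ?h x) (at x within {0..pi})"
        unfolding has_real_derivative_iff_has_vector_derivative[symmetric]
        by (rule derivative_eq_intros dx[OF x t] dxx[OF x t] refl)+ (simp add: power2_eq_square algebra_simps)
    qed simp
    then have "0 = integral {0..pi} ?h" using bc[OF t] by (simp add: integral_unique)
    also have "\<dots> = ?W + integral {0..pi} (\<lambda>x. (wx x t)\<^sup>2 * sin x + (w x t)\<^sup>2 * sin x * (1 / 2))"
      by (intro integral_add ci)
    also have "integral {0..pi} (\<lambda>x. (wx x t)\<^sup>2 * sin x + (w x t)\<^sup>2 * sin x * (1 / 2)) =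
      ?D + integral {0..pi} (\<lambda>x. (w x t)\<^sup>2 * sin x * (1 / 2))"
      by (intro integral_add ci)
    finally show ?thesis by (simp add: E_def)
  qed
  moreover have "2 * \<bar>?Z\<bar> \<le> 2 * \<nu> * ?D + (8 / \<nu> + 2) * (E t * (1 + E t))"
    unfolding E_def by (rule weighted_cubic_bound[OF nu dx[OF _ t] cont_space(2)[OF t]])
  moreover have "\<nu> * E t \<ge> 0" using nu E_nonneg[OF t] by simp
  ultimately have 1: "(E has_real_derivative 2 * \<nu> * (- ?D - E t / 2) - 2 * ?Z) (at t)"
    and 2: "2 * \<bar>?Z\<bar> \<le> 2 * \<nu> * ?D + (8 / \<nu> + 2) * (E t * (1 + E t))" and 3: "\<nu> * E t \<ge> 0"
    by simp_all
  have "2 * \<nu> * (- ?D - E t / 2) = - (2 * \<nu> * ?D) - \<nu> * E t" by (simp add: right_diff_distrib)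
  then have "2 * \<nu> * (- ?D - E t / 2) - 2 * ?Z \<le> (8 / \<nu> + 2) * (E t * (1 + E t))"
    using 2 3 by linarith
  with 1 show ?thesis by blast
qed

lemma exp_F_deriv:
  assumes t: "t \<in> {a<..<b}"
  shows "((\<lambda>t. exp (\<nu> * t) * F t) has_real_derivative - exp (\<nu> * t) * E t) (at t)"
  by (rule derivative_eq_intros F_deriv[OF t] refl)+ (simp add: algebra_simps)

lemma exp_F_antimono:
  assumes "s \<in> {a<..<b}" "t \<in> {a<..<b}" "s \<le> t"
  shows "exp (\<nu> * t) * F t \<le> exp (\<nu> * s) * F s"
proof (rule DERIV_nonpos_imp_nonincreasing[OF assms(3)])
  fix r assume "s \<le> r" "r \<le> t"
  then have r: "r \<in> {a<..<b}" using assms by auto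
  show "\<exists>y. ((\<lambda>t. exp (\<nu> * t) * F t) has_real_derivative y) (at r) \<and> y \<le> 0"
    using exp_F_deriv[OF r] E_nonneg[OF r] by (intro exI conjI) auto
qed

text \<open>Gronwall's inequality for \<open>E' \<le> C (1 + E) E\<close>, where the second factor \<open>E\<close> is integrable in time.\<close>

lemma E_bounded:
  assumes a: "a \<ge> 0" and s: "s \<in> {a<..<b}"
    and low: "\<And>t. t \<in> {s..<b} \<Longrightarrow> exp (\<nu> * t) * F t \<ge> - G"
  shows "\<exists>Es. \<forall>t\<in>{s..<b}. E t \<le> Es"
proof -
  define C where "C = 8 / \<nu> + 2"
  have C: "C > 0" using nu by (simp add: C_def add_pos_pos)
  \<comment> \<open>The derivative of ln (1 + E) is at most C E, and \<open>exp_F_deriv\<close>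
    makes C e^(\<nu> t) F decrease at least at the rate C E, as e^(\<nu> t) \<ge> 1 for t \<ge> 0.
    So \<open>\<Psi>\<close> is nonincreasing, and the lower bound on e^(\<nu> t) F turns this into
    an upper bound on E.\<close>
  define \<Psi> where "\<Psi> = (\<lambda>t. ln (1 + E t) + C * (exp (\<nu> * t) * F t))"
  have "E t \<le> exp (\<Psi> s + C * G)" if t: "t \<in> {s..<b}" for t
  proof -
    have "\<Psi> t \<le> \<Psi> s"
    proof (rule DERIV_nonpos_imp_nonincreasing[where f = \<Psi>])
      show "s \<le> t" using t by simp
      fix r assume "s \<le> r" "r \<le> t"
      then have r: "r \<in> {a<..<b}" using s t by auto
      obtain E' where E': "(E has_real_derivative E') (at r)" "E' \<le> C * (E r * (1 + E r))"
        using E_deriv[OF r] unfolding C_def by blast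
      have E0: "E r \<ge> 0" by (rule E_nonneg[OF r])
      have "(\<Psi> has_real_derivative E' / (1 + E r) + C * (- exp (\<nu> * r) * E r)) (at r)"
        unfolding \<Psi>_def
      proof (rule DERIV_add[OF _ DERIV_cmult[OF exp_F_deriv[OF r]]])
        have "((\<lambda>t. 1 + E t) has_real_derivative E') (at r)"
          using DERIV_add[OF DERIV_const E'(1), of 1] by simp
        from DERIV_chain2[OF DERIV_ln_divide this] E0
        show "((\<lambda>t. ln (1 + E t)) has_real_derivative E' / (1 + E r)) (at r)" by simp
      qed
      moreover have "E' / (1 + E r) \<le> C * E r" using E' E0 by (simp add: field_simps)
      moreover have "C * E r * 1 \<le> C * E r * exp (\<nu> * r)"
        using C E0 nu a r by (intro mult_left_mono) auto
      ultimately show "\<exists>y. (\<Psi> has_real_derivative y) (at r) \<and> y \<le> 0"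
        by (intro exI conjI) (assumption, simp add: mult_ac)
    qed
    moreover have "C * (exp (\<nu> * t) * F t) \<ge> C * (- G)" using C low[OF t] by (intro mult_left_mono) auto
    ultimately have "ln (1 + E t) \<le> \<Psi> s + C * G" unfolding \<Psi>_def[THEN fun_cong, of t] by simp
    moreover have "E t \<ge> 0" using t s by (intro E_nonneg) auto
    ultimately have "1 + E t \<le> exp (\<Psi> s + C * G)" by (metis add_pos_nonneg exp_le_cancel_iff exp_ln zero_less_one)
    then show ?thesis by simp
  qed
  then show ?thesis by blast
qed

text \<open>With G = e^(\<nu> t) F, the bound F^2 \<le> 2 E gives G' \<le> -e^(-\<nu> t) G^2 / 2, so
  1/G + e^(-\<nu> t)/(2 \<nu>) is nondecreasing; compare its limit at 0 with its value at t, where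
  1/G < 0. For F0 < -2 \<nu> the right-hand side is below 1, the limit of the left-hand side, so t
  cannot be arbitrarily large.\<close>

lemma blow_up_time_bound:
  assumes a: "a = 0" and lim: "(F \<longlongrightarrow> F0) (at_right 0)" and F0: "F0 < 0" and t: "t \<in> {0<..<b}"
  shows "1 - exp (- \<nu> * t) \<le> - 2 * \<nu> / F0"
proof -
  define G where "G = (\<lambda>t. exp (\<nu> * t) * F t)"
  have dG: "(G has_real_derivative - exp (\<nu> * r) * E r) (at r)" if "r \<in> {0<..<b}" for r
    unfolding G_def using exp_F_deriv that a by simp
  have "((\<lambda>t. exp (\<nu> * t)) \<longlongrightarrow> exp (\<nu> * 0)) (at_right 0)" by (intro tendsto_intros)
  from tendsto_mult[OF this lim] have limG: "(G \<longlongrightarrow> F0) (at_right 0)" by (simp add: G_def)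
  have ev: "eventually (\<lambda>s. s \<in> {0<..<t}) (at_right 0)"
    using t by (intro eventually_at_right_real) auto
  \<comment> \<open>G starts at F0 and does not increase, so it stays negative and 1/G is
    differentiable.\<close>
  have le: "G r \<le> F0" if r: "r \<in> {0<..<b}" for r
  proof (rule tendsto_lowerbound[OF limG])
    show "eventually (\<lambda>s. G r \<le> G s) (at_right 0)"
      using eventually_at_right_real[of 0 r] r
      by (auto elim!: eventually_mono simp: G_def a intro!: exp_F_antimono)
  qed simp
  define P where "P = (\<lambda>t. inverse (G t) + exp (- \<nu> * t) / (2 * \<nu>))"
  have mono: "P s \<le> P t" if s: "s \<in> {0<..<t}" for s
  proof (rule DERIV_nonneg_imp_nondecreasing[where f = P])
    show "s \<le> t" using s by simp
    fix r assume "s \<le> r" "r \<le> t"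
    then have r: "r \<in> {0<..<b}" using s t by auto
    have neg: "G r < 0" using le[OF r] F0 by linarith
    have "(P has_real_derivative exp (\<nu> * r) * E r / (G r)\<^sup>2 - exp (- \<nu> * r) / 2) (at r)"
    proof -
      have 1: "((\<lambda>t. inverse (G t)) has_real_derivative - (inverse (G r) * (- exp (\<nu> * r) * E r) * inverse (G r))) (at r)"
        using neg by (intro DERIV_inverse' dG r) auto
      have 2: "((\<lambda>t. exp (- \<nu> * t) / (2 * \<nu>)) has_real_derivative - exp (- \<nu> * r) / 2) (at r)"
        using nu by (auto intro!: derivative_eq_intros)
      show ?thesis unfolding P_def
        by (rule DERIV_cong[OF DERIV_add[OF 1 2]]) (use neg in \<open>simp add: field_simps power2_eq_square\<close>)
    qed
    moreover have "exp (- \<nu> * r) / 2 \<le> exp (\<nu> * r) * E r / (G r)\<^sup>2"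
    proof -
      have "exp (- \<nu> * r) / 2 * (G r)\<^sup>2 = exp (\<nu> * r) * ((F r)\<^sup>2 / 2)"
        by (simp add: G_def power_mult_distrib power2_eq_square exp_minus field_simps)
      also have "\<dots> \<le> exp (\<nu> * r) * E r" using F_square_le[of r] r a by (intro mult_left_mono) auto
      finally show ?thesis using neg by (simp add: pos_le_divide_eq)
    qed
    ultimately show "\<exists>y. (P has_real_derivative y) (at r) \<and> y \<ge> 0"
      by (intro exI conjI) (assumption, simp)
  qed
  have "((\<lambda>t. exp (- \<nu> * t) / (2 * \<nu>)) \<longlongrightarrow> exp (- \<nu> * 0) / (2 * \<nu>)) (at_right 0)"
    by (intro tendsto_intros) (use nu in auto)
  from tendsto_add[OF tendsto_inverse[OF limG] this]
  have "(P \<longlongrightarrow> inverse F0 + 1 / (2 * \<nu>)) (at_right 0)" using F0 by (simp add: P_def)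
  then have "inverse F0 + 1 / (2 * \<nu>) \<le> P t"
    by (rule tendsto_upperbound[OF _ eventually_mono[OF ev mono]]) auto
  moreover have "inverse (G t) < 0" using le[OF t] F0 by simp
  ultimately have "inverse F0 + 1 / (2 * \<nu>) \<le> exp (- \<nu> * t) / (2 * \<nu>)"
    unfolding P_def by linarith
  then have "2 * \<nu> * (inverse F0 + 1 / (2 * \<nu>)) \<le> 2 * \<nu> * (exp (- \<nu> * t) / (2 * \<nu>))"
    using nu by (intro mult_left_mono) auto
  moreover have "2 * \<nu> * (inverse F0 + 1 / (2 * \<nu>)) = 2 * \<nu> / F0 + 1" using nu F0 by (simp add: field_simps)
  moreover have "2 * \<nu> * (exp (- \<nu> * t) / (2 * \<nu>)) = exp (- \<nu> * t)" using nu by simp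
  moreover have "- 2 * \<nu> / F0 = - (2 * \<nu> / F0)" by simp
  ultimately show ?thesis by linarith
qed

text \<open>
  Since \<open>\<bar>sin (k x)\<bar> \<le> k sin x\<close>, the bound on \<open>E\<close> gives \<open>coeff k = O(1/k)\<close>; then \<open>w(\<sqdot>,t)\<close> is
  bounded in the unweighted \<open>L\<^sup>2\<close> norm by Parseval, and this in turn gives \<open>coeff k = O(1/k\<^sup>2)\<close>.
\<close>

lemma coeff_inverse_square_ex:
  assumes t: "t \<in> {a<..<b}"
  shows "\<exists>B. \<forall>k. \<bar>coeff k t\<bar> \<le> B / (real k)\<^sup>2"
proof -
  \<comment> \<open>This bound depends on t without control as t approaches b. It serves as starting
    value at one fixed time and justifies the series expansion at each time.\<close>
  have "bounded ((\<lambda>x. wxx x t) ` {0..pi})"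
    by (intro compact_imp_bounded compact_continuous_image cont_space t) simp
  then obtain B where "\<forall>x\<in>{0..pi}. \<bar>wxx x t\<bar> \<le> B" by (auto simp: bounded_iff)
  then have B: "\<bar>wxx x t\<bar> \<le> B" if "x \<in> {0..pi}" for x using that by blast
  have "\<bar>coeff k t\<bar> \<le> 2 * B / (real k)\<^sup>2" for k
  proof (cases "k = 0")
    case False
    have "(real k)\<^sup>2 * \<bar>coeff k t\<bar> \<le> 2 * B"
      using abs_sine_coeff_le[OF cont_space(4)[OF t] B, of k] unfolding coeff_wxx[OF t] by (simp add: abs_mult)
    then show ?thesis using False by (simp add: pos_le_divide_eq mult.commute)
  qed (simp add: coeff_def)
  then show ?thesis by blast
qed

lemma summable_coeff: "t \<in> {a<..<b} \<Longrightarrow> summable (\<lambda>k. \<bar>coeff k t\<bar>)"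
  using coeff_inverse_square_ex[of t] summable_of_inverse_square_bound[of "\<lambda>k. coeff k t"] by blast

lemma sine_series_coeff: "t \<in> {a<..<b} \<Longrightarrow> x \<in> {0..pi} \<Longrightarrow> sine_series (\<lambda>k. coeff k t) x = w x t"
  using sine_series_sine_coeff[OF cont_space(1)[of t], of x] summable_coeff[of t]
  unfolding coeff_def by blast

text \<open>Damping never amplifies the value at s and divides the forcing by \<nu> k^2, uniformly
  in time: each bound on the square's coefficients improves by two orders.\<close>

lemma coeff_bound:
  assumes s: "s \<in> {a<..<b}" and t: "t \<in> {s..<b}" and k: "k \<noteq> 0"
    and Q: "\<And>r. r \<in> {s..<b} \<Longrightarrow> \<bar>sq_coeff k r\<bar> \<le> Q"
  shows "\<bar>coeff k t\<bar> \<le> \<bar>coeff k s\<bar> + Q / (\<nu> * (real k)\<^sup>2)"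
proof -
  have "\<bar>coeff k t\<bar> \<le> exp (- (\<nu> * (real k)\<^sup>2) * (t - s)) * \<bar>coeff k s\<bar> + Q * min (t - s) (1 / (\<nu> * (real k)\<^sup>2))"
  proof (rule damped_ode_bound')
    fix r assume r: "r \<in> {s..t}"
    show "(coeff k has_real_derivative - (\<nu> * (real k)\<^sup>2) * coeff k r - sq_coeff k r) (at r within {s..t})"
      by (rule has_field_derivative_at_within[OF coeff_deriv]) (use r s t in auto)
    show "\<bar>sq_coeff k r\<bar> \<le> Q" using Q[of r] r t by auto
  qed (use s t k nu in auto)
  also have "\<dots> \<le> 1 * \<bar>coeff k s\<bar> + Q * (1 / (\<nu> * (real k)\<^sup>2))"
  proof (intro add_mono mult_right_mono mult_left_mono)
    show "Q \<ge> 0" using Q[of s] s by auto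
    show "exp (- (\<nu> * (real k)\<^sup>2) * (t - s)) \<le> 1" using nu t by simp
  qed auto
  finally show ?thesis by simp
qed

lemma coeff_uniform_bound:
  assumes s: "s \<in> {a<..<b}" and Es: "\<And>t. t \<in> {s..<b} \<Longrightarrow> E t \<le> Es"
  shows "\<exists>A. \<forall>t\<in>{s..<b}. \<forall>k. \<bar>coeff k t\<bar> \<le> A / (real k)\<^sup>2"
proof -
  have dom: "t \<in> {a<..<b}" if "t \<in> {s..<b}" for t using that s by auto
  obtain B where B: "\<And>k. \<bar>coeff k s\<bar> \<le> B / (real k)\<^sup>2" using coeff_inverse_square_ex[OF s] by blast
  have B0: "B \<ge> 0" using B[of 1] by simp
  have Es0: "Es \<ge> 0" using Es[of s] E_nonneg[OF s] s by simp
  \<comment> \<open>B covers the value at time s; the other summand is the bound on the square's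
    coefficient, linear in k, divided by \<nu> k^2.\<close>
  define C where "C = B + 2 / pi * Es / \<nu>"
  have q1: "\<bar>sq_coeff k t\<bar> \<le> 2 / pi * (real k * Es)" if t: "t \<in> {s..<b}" for k t
  proof -
    note ci = integrable_continuous_real continuous_intros cont_space[OF dom[OF t]]
    have "norm (integral {0..pi} (\<lambda>x. (w x t)\<^sup>2 * sin (real k * x))) \<le> integral {0..pi} (\<lambda>x. real k * ((w x t)\<^sup>2 * sin x))"
    proof (rule integral_norm_bound_integral)
      fix x :: real assume x: "x \<in> {0..pi}"
      have "(w x t)\<^sup>2 * \<bar>sin (real k * x)\<bar> \<le> (w x t)\<^sup>2 * (real k * \<bar>sin x\<bar>)"
        by (intro mult_left_mono abs_sin_mult_le) auto
      then show "norm ((w x t)\<^sup>2 * sin (real k * x)) \<le> real k * ((w x t)\<^sup>2 * sin x)"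
        using x by (simp add: abs_mult sin_ge_zero mult_ac)
    qed (intro ci)+
    also have "\<dots> = real k * E t" by (simp add: E_def)
    also have "\<dots> \<le> real k * Es" by (intro mult_left_mono Es t) auto
    finally show ?thesis unfolding sq_coeff_def sine_coeff_def abs_mult by (intro mult_mono) auto
  qed
  have c1: "\<bar>coeff k t\<bar> \<le> C / real k" if t: "t \<in> {s..<b}" for k t
  proof (cases "k = 0")
    case False
    then have k: "real k \<ge> 1" by simp
    have "\<bar>coeff k t\<bar> \<le> \<bar>coeff k s\<bar> + 2 / pi * (real k * Es) / (\<nu> * (real k)\<^sup>2)"
      by (rule coeff_bound[OF s t False q1])
    also have "\<dots> \<le> B / real k + 2 / pi * Es / \<nu> / real k"
    proof (rule add_mono)
      have "B / (real k)\<^sup>2 \<le> B / (real k)" using k B0 by (intro divide_left_mono) (auto simp: power2_eq_square)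
      then show "\<bar>coeff k s\<bar> \<le> B / real k" using B[of k] by linarith
    qed (use k in \<open>simp add: power2_eq_square\<close>)
    finally show ?thesis by (simp add: C_def add_divide_distrib)
  qed (simp add: coeff_def)
  \<comment> \<open>The 1/k decay is square summable, so Parseval bounds the unweighted integral of
    w^2, and the factor k in the previous bound on \<open>sq_coeff\<close> disappears.\<close>
  have q2: "\<bar>sq_coeff k t\<bar> \<le> C\<^sup>2 * zeta2" if t: "t \<in> {s..<b}" for k t
  proof -
    note ci = integrable_continuous_real continuous_intros cont_space[OF dom[OF t]]
    have "norm (integral {0..pi} (\<lambda>x. (w x t)\<^sup>2 * sin (real k * x))) \<le> integral {0..pi} (\<lambda>x. (w x t)\<^sup>2)"
      by (rule integral_norm_bound_integral) (auto intro!: ci simp: abs_mult mult_left_le)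
    then have "\<bar>sq_coeff k t\<bar> \<le> 2 / pi * integral {0..pi} (\<lambda>x. (w x t)\<^sup>2)"
      unfolding sq_coeff_def sine_coeff_def abs_mult by (intro mult_mono) auto
    also have "\<dots> = (\<Sum>k. (coeff k t)\<^sup>2)"
      using parseval_sine[OF cont_space(1)[OF dom[OF t]]] summable_coeff[OF dom[OF t]]
      unfolding coeff_def by (simp add: sums_iff)
    also have "\<dots> \<le> (\<Sum>k. C\<^sup>2 / (real k)\<^sup>2)"
    proof (rule suminf_le[OF _ _ summable_inverse_square])
      show "(coeff k t)\<^sup>2 \<le> C\<^sup>2 / (real k)\<^sup>2" for k
        using power_mono[OF c1[OF t, of k], of 2] by (simp add: power_divide)
      show "summable (\<lambda>k. (coeff k t)\<^sup>2)"
        using parseval_sine[OF cont_space(1)[OF dom[OF t]]] summable_coeff[OF dom[OF t]]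
        unfolding coeff_def by (simp add: sums_iff)
    qed
    also have "\<dots> = C\<^sup>2 * zeta2" by (rule suminf_inverse_square)
    finally show ?thesis .
  qed
  have "\<bar>coeff k t\<bar> \<le> (B + C\<^sup>2 * zeta2 / \<nu>) / (real k)\<^sup>2" if t: "t \<in> {s..<b}" for k t
  proof (cases "k = 0")
    case False
    have "\<bar>coeff k t\<bar> \<le> \<bar>coeff k s\<bar> + C\<^sup>2 * zeta2 / (\<nu> * (real k)\<^sup>2)"
      by (rule coeff_bound[OF s t False q2])
    also have "\<dots> \<le> B / (real k)\<^sup>2 + C\<^sup>2 * zeta2 / (\<nu> * (real k)\<^sup>2)" using B[of k] by simp
    finally show ?thesis by (simp add: add_divide_distrib)
  qed (simp add: coeff_def)
  then show ?thesis by blast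
qed

end

section \<open>Local existence and regularity\<close>

text \<open>Bounds the Duhamel operator on [0,d] from forcings with uniformly bounded coefficients
  to absolutely summable coefficient sequences. At k = 0 the term is min d 0, that is 0 for d \<ge>
  0.\<close>

definition duhamel_sum :: "real \<Rightarrow> real \<Rightarrow> real" where
  "duhamel_sum \<nu> d = (\<Sum>k. min d (1 / (\<nu> * (real k)\<^sup>2)))"

lemma summable_min_inverse_square:
  assumes "\<nu> > 0" "d \<ge> 0"
  shows "summable (\<lambda>k. min d (1 / (\<nu> * (real k)\<^sup>2)))"
proof (rule summable_comparison_test'[OF summable_inverse_square[of "1 / \<nu>"], of 0])
  show "norm (min d (1 / (\<nu> * (real k)\<^sup>2))) \<le> 1 / \<nu> / (real k)\<^sup>2" for k
    using assms by (simp add: min_def)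
qed

text \<open>The tail is small uniformly in d because of the 1/(\<nu> k^2) bound; each of the
  remaining N terms is at most d.\<close>

lemma duhamel_sum_small:
  assumes nu: "\<nu> > 0" and e: "e > 0"
  shows "\<exists>d>0. duhamel_sum \<nu> d \<le> e"
proof -
  let ?f = "\<lambda>k. 1 / \<nu> / (real k)\<^sup>2"
  have sf: "summable ?f" by (rule summable_inverse_square)
  obtain N where N: "norm (\<Sum>i. ?f (i + N)) < e / 2"
    using suminf_exist_split[OF _ sf, of "e / 2"] e by auto
  define d where "d = e / (2 * (real N + 1))"
  have d: "d > 0" using e by (simp add: d_def)
  let ?m = "\<lambda>k. min d (1 / (\<nu> * (real k)\<^sup>2))"
  have sm: "summable ?m" by (rule summable_min_inverse_square) (use nu d in auto)
  have "duhamel_sum \<nu> d = (\<Sum>i. ?m (i + N)) + (\<Sum>i<N. ?m i)"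
    unfolding duhamel_sum_def by (rule suminf_split_initial_segment[OF sm])
  also have "(\<Sum>i. ?m (i + N)) \<le> (\<Sum>i. ?f (i + N))"
    by (rule suminf_le[OF _ summable_ignore_initial_segment[OF sm] summable_ignore_initial_segment[OF sf]])
       (simp add: min_def)
  also have "(\<Sum>i<N. ?m i) \<le> (\<Sum>i<N. d)" by (rule sum_mono) simp
  also have "(\<Sum>i<N. d) \<le> e / 2" using e by (simp add: d_def field_simps)
  finally have "duhamel_sum \<nu> d \<le> (\<Sum>i. ?f (i + N)) + e / 2" by simp
  then have "duhamel_sum \<nu> d \<le> e" using N by simp
  with d show ?thesis by blast
qed

text \<open>The variation of constants formula for y' = -\<mu> y - q with y(0) = g. The factor
  e^(-\<mu> t) is kept outside the integral so that t enters the integral only as its upper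
  limit.\<close>

definition duhamel :: "real \<Rightarrow> real \<Rightarrow> (real \<Rightarrow> real) \<Rightarrow> real \<Rightarrow> real" where
  "duhamel \<mu> g q t = exp (- \<mu> * t) * (g - integral {0..t} (\<lambda>s. exp (\<mu> * s) * q s))"

lemma duhamel_deriv:
  assumes q: "continuous_on {0..d} q" and t: "t \<in> {0..d}"
  shows "(duhamel \<mu> g q has_real_derivative - \<mu> * duhamel \<mu> g q t - q t) (at t within {0..d})"
proof -
  have "((\<lambda>t. integral {0..t} (\<lambda>s. exp (\<mu> * s) * q s)) has_real_derivative exp (\<mu> * t) * q t) (at t within {0..d})"
    by (rule integral_has_real_derivative[OF _ t]) (intro continuous_intros q)
  from DERIV_diff[OF DERIV_const this, of g]
  have 1: "((\<lambda>t. g - integral {0..t} (\<lambda>s. exp (\<mu> * s) * q s)) has_real_derivative - (exp (\<mu> * t) * q t)) (at t within {0..d})"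
    by simp
  have 2: "((\<lambda>t. exp (- \<mu> * t)) has_real_derivative exp (- \<mu> * t) * - \<mu>) (at t within {0..d})"
    by (auto intro!: derivative_eq_intros)
  have "exp (- \<mu> * t) * - \<mu> * (g - integral {0..t} (\<lambda>s. exp (\<mu> * s) * q s)) + - (exp (\<mu> * t) * q t) * exp (- \<mu> * t)
    = - \<mu> * duhamel \<mu> g q t - q t * (exp (\<mu> * t) * exp (- \<mu> * t))"
    by (simp only: duhamel_def) (simp add: algebra_simps)
  also have "exp (\<mu> * t) * exp (- \<mu> * t) = 1" by (simp add: mult_exp_exp)
  finally have eq: "exp (- \<mu> * t) * - \<mu> * (g - integral {0..t} (\<lambda>s. exp (\<mu> * s) * q s)) + - (exp (\<mu> * t) * q t) * exp (- \<mu> * t)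
    = - \<mu> * duhamel \<mu> g q t - q t" by (simp only: mult_1_right)
  show ?thesis
    using DERIV_mult[OF 2 1] unfolding eq by (simp only: duhamel_def[abs_def])
qed

lemma duhamel_0 [simp]: "duhamel \<mu> g q 0 = g"
  by (simp add: duhamel_def)

lemma continuous_on_duhamel: "continuous_on {0..d} q \<Longrightarrow> continuous_on {0..d} (duhamel \<mu> g q)"
  by (rule DERIV_continuous_on[OF duhamel_deriv])

lemma abs_duhamel_le:
  assumes "\<mu> > 0" and q: "continuous_on {0..d} q" and Q: "\<And>s. s \<in> {0..d} \<Longrightarrow> \<bar>q s\<bar> \<le> Q" and t: "t \<in> {0..d}"
  shows "\<bar>duhamel \<mu> g q t\<bar> \<le> \<bar>g\<bar> + Q * min d (1 / \<mu>)"
proof -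
  have Q0: "Q \<ge> 0" using Q[OF t] by simp
  have ss: "{0..t} \<subseteq> {0..d}" using t by auto
  have "\<bar>duhamel \<mu> g q t\<bar> \<le> exp (- \<mu> * (t - 0)) * \<bar>duhamel \<mu> g q 0\<bar> + Q * min (t - 0) (1 / \<mu>)"
  proof (rule damped_ode_bound')
    fix s assume s: "s \<in> {0..t}"
    then show "(duhamel \<mu> g q has_real_derivative - \<mu> * duhamel \<mu> g q s - q s) (at s within {0..t})"
      by (intro duhamel_deriv continuous_on_subset[OF q ss])
    show "\<bar>q s\<bar> \<le> Q" using Q[of s] s ss by auto
  qed (use t assms in auto)
  also have "\<dots> \<le> 1 * \<bar>g\<bar> + Q * min d (1 / \<mu>)"
  proof (intro add_mono mult_mono mult_left_mono)
    show "exp (- \<mu> * (t - 0)) \<le> 1" using assms(1) t by simp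
  qed (use t Q0 assms(1) in auto)
  finally show ?thesis by simp
qed

lemma abs_duhamel_diff_le:
  assumes "\<mu> > 0" and q: "continuous_on {0..d} q" and q': "continuous_on {0..d} q'"
    and Q: "\<And>s. s \<in> {0..d} \<Longrightarrow> \<bar>q s - q' s\<bar> \<le> Q" and t: "t \<in> {0..d}"
  shows "\<bar>duhamel \<mu> g q t - duhamel \<mu> g q' t\<bar> \<le> Q * min d (1 / \<mu>)"
proof -
  have ss: "{0..t} \<subseteq> {0..d}" using t by auto
  have i: "(\<lambda>s. exp (\<mu> * s) * q s) integrable_on {0..t}" "(\<lambda>s. exp (\<mu> * s) * q' s) integrable_on {0..t}"
    by (intro integrable_continuous_real continuous_intros continuous_on_subset[OF q ss] continuous_on_subset[OF q' ss])+
  have eq: "integral {0..t} (\<lambda>s. exp (\<mu> * s) * (q s - q' s)) =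
      integral {0..t} (\<lambda>s. exp (\<mu> * s) * q s) - integral {0..t} (\<lambda>s. exp (\<mu> * s) * q' s)"
    using integral_diff[OF i] by (simp only: right_diff_distrib)
  have "duhamel \<mu> g q t - duhamel \<mu> g q' t = duhamel \<mu> 0 (\<lambda>s. q s - q' s) t"
    unfolding duhamel_def eq by (simp add: algebra_simps)
  then show ?thesis
    using abs_duhamel_le[OF assms(1) continuous_on_diff[OF q q'] Q t, of 0] by simp
qed

lemma continuous_on_sine_coeff:
  fixes f :: "real \<Rightarrow> real \<Rightarrow> real"
  assumes "continuous_on ({0..pi} \<times> S) (\<lambda>(x, t). f x t)"
  shows "continuous_on S (\<lambda>t. sine_coeff (\<lambda>x. f x t) k)"
proof -
  have "continuous_on (S \<times> {0..pi}) (\<lambda>p. (\<lambda>(x, t). f x t) (snd p, fst p))"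
    by (rule continuous_on_compose2[OF assms]) (auto intro!: continuous_intros)
  then have "continuous_on (S \<times> {0..pi}) (\<lambda>p. (\<lambda>(x, t). f x t) (snd p, fst p) * sin (real k * snd p))"
    by (intro continuous_intros)
  then have "continuous_on (S \<times> cbox 0 pi) (\<lambda>(t, x). f x t * sin (real k * x))"
    by (simp add: case_prod_beta')
  from integral_continuous_on_param[OF this] show ?thesis
    unfolding sine_coeff_def by (intro continuous_intros) simp
qed

lemma continuous_on_suminf:
  fixes f :: "nat \<Rightarrow> 'a::topological_space \<Rightarrow> real"
  assumes c: "\<And>k. continuous_on S (f k)" and le: "\<And>k p. p \<in> S \<Longrightarrow> \<bar>f k p\<bar> \<le> M k" and M: "summable M"
  shows "continuous_on S (\<lambda>p. \<Sum>k. f k p)"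
proof (rule uniform_limit_theorem[OF _ Weierstrass_m_test[where M = M]])
  show "\<forall>\<^sub>F n in sequentially. continuous_on S (\<lambda>p. \<Sum>i<n. f i p)"
    by (intro always_eventually allI continuous_intros c)
qed (use le M in auto)

lemma continuous_on_sine_series2:
  fixes a :: "nat \<Rightarrow> real \<Rightarrow> real"
  assumes c: "\<And>k. continuous_on S (a k)" and le: "\<And>k t. t \<in> S \<Longrightarrow> \<bar>a k t\<bar> \<le> M k" and M: "summable M"
  shows "continuous_on (UNIV \<times> S) (\<lambda>(x, t). sine_series (\<lambda>k. a k t) x)"
proof -
  have "continuous_on (UNIV \<times> S) (\<lambda>p. \<Sum>k. a k (snd p) * sin (real k * fst p))"
  proof (rule continuous_on_suminf[OF _ _ M])
    show "continuous_on (UNIV \<times> S) (\<lambda>p. a k (snd p) * sin (real k * fst p))" for k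
    proof -
      have "continuous_on (UNIV \<times> S) (\<lambda>p. a k (snd p))"
        by (rule continuous_on_compose2[OF c[of k]]) (auto intro!: continuous_intros)
      then show ?thesis by (intro continuous_intros)
    qed
    show "\<bar>a k (snd p) * sin (real k * fst p)\<bar> \<le> M k" if "p \<in> UNIV \<times> S" for k and p :: "real \<times> real"
    proof -
      have "\<bar>a k (snd p)\<bar> * \<bar>sin (real k * fst p)\<bar> \<le> M k * 1"
        using le[of "snd p" k] that by (intro mult_mono) (auto intro: order.trans[OF abs_ge_zero])
      then show ?thesis by (simp add: abs_mult)
    qed
  qed
  then show ?thesis by (simp add: sine_series_def case_prod_beta')
qed

text \<open>
  Mild solutions: the ordinary differential equations are the sine coefficients of the partial
  differential equation, and no smoothness of \<open>v\<close> is assumed.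
\<close>

locale fourier_solution =
  fixes \<nu> d B :: real and v :: "real \<Rightarrow> real \<Rightarrow> real" and a :: "nat \<Rightarrow> real \<Rightarrow> real"
  assumes nu: "\<nu> > 0" and d: "d > 0"
    and series: "\<And>x t. t \<in> {0..d} \<Longrightarrow> v x t = sine_series (\<lambda>k. a k t) x"
    and ode: "\<And>k t. t \<in> {0..d} \<Longrightarrow> (a k has_real_derivative
        - (\<nu> * (real k)\<^sup>2) * a k t - sine_coeff (\<lambda>x. (v x t)\<^sup>2) k) (at t within {0..d})"
    and bound: "\<And>k t. t \<in> {0..d} \<Longrightarrow> \<bar>a k t\<bar> \<le> B / (real k)\<^sup>2"

text \<open>
  Banach's fixed point theorem. Truncating the nonlinearity at height \<open>R\<close> makes it globally
  Lipschitz, and the fixed point stays below \<open>R\<close>; clamping time to \<open>[0,d]\<close> moves the problem to the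
  complete space of bounded continuous functions on the plane.
\<close>

lemma fourier_solution_exists:
  fixes g :: "nat \<Rightarrow> real"
  assumes nu: "\<nu> > 0" and d: "d > 0" and g: "\<And>k. \<bar>g k\<bar> \<le> A / (real k)\<^sup>2"
    and R: "R \<ge> A * zeta2 + 1" and small1: "2 * R\<^sup>2 * duhamel_sum \<nu> d \<le> 1"
    and small2: "4 * R * duhamel_sum \<nu> d \<le> 1 / 2"
  shows "\<exists>v a B. fourier_solution \<nu> d B v a \<and> (\<forall>k. a k 0 = g k) \<and> (\<forall>x. \<forall>t\<in>{0..d}. \<bar>v x t\<bar> \<le> R)"
proof -
  have A0: "A \<ge> 0" using g[of 1] by simp
  have R0: "R \<ge> 1" using R A0 zeta2_nonneg mult_nonneg_nonneg[OF A0 zeta2_nonneg] by linarith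
  define h where "h y = (max (- R) (min y R))\<^sup>2" for y
  have h_cont: "continuous_on UNIV h"
    unfolding h_def by (intro continuous_intros)
  have h_le: "\<bar>h y\<bar> \<le> R\<^sup>2" for y
  proof -
    have "\<bar>max (- R) (min y R)\<bar> \<le> R" using R0 by auto
    then show ?thesis unfolding h_def by (metis abs_power2 power2_abs abs_ge_zero power_mono)
  qed
  have h_lip: "\<bar>h y - h z\<bar> \<le> 2 * R * \<bar>y - z\<bar>" for y z
  proof -
    let ?y = "max (- R) (min y R)" and ?z = "max (- R) (min z R)"
    have "\<bar>h y - h z\<bar> = \<bar>?y + ?z\<bar> * \<bar>?y - ?z\<bar>"
      by (simp add: h_def power2_eq_square abs_mult[symmetric] algebra_simps)
    also have "\<dots> \<le> (2 * R) * \<bar>y - z\<bar>" by (intro mult_mono) (use R0 in auto)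
    finally show ?thesis .
  qed
  define c where "c t = max 0 (min t d)" for t :: real
  have c: "c t \<in> {0..d}" for t using d by (auto simp: c_def)
  have c_id: "c t = t" if "t \<in> {0..d}" for t using that by (auto simp: c_def)
  have c_cont: "continuous_on S c" for S unfolding c_def by (intro continuous_intros)
  define q where "q v k t = sine_coeff (\<lambda>x. h (apply_bcontfun v (x, t))) k" for v :: "(real \<times> real) \<Rightarrow>\<^sub>C real" and k t
  have vcont: "continuous_on S (apply_bcontfun v)" for S and v :: "(real \<times> real) \<Rightarrow>\<^sub>C real"
    using apply_bcontfun[of v] by (auto simp: bcontfun_def intro: continuous_on_subset)
  have hv_cont: "continuous_on S (\<lambda>x. h (apply_bcontfun v (x, t)))" for S and v :: "(real \<times> real) \<Rightarrow>\<^sub>C real" and t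
  proof -
    have "continuous_on S (\<lambda>x::real. (x, t))" by (intro continuous_intros)
    from continuous_on_compose2[OF vcont[of UNIV v] this]
    have "continuous_on S (\<lambda>x. apply_bcontfun v (x, t))" by simp
    from continuous_on_compose2[OF h_cont this] show ?thesis by simp
  qed
  have q_cont: "continuous_on S (q v k)" for S v k
    unfolding q_def
  proof (rule continuous_on_sine_coeff)
    show "continuous_on ({0..pi} \<times> S) (\<lambda>(x, t). h (apply_bcontfun v (x, t)))"
      using continuous_on_compose2[OF h_cont vcont[of "{0..pi} \<times> S" v]] by (simp add: case_prod_beta')
  qed
  have q_le: "\<bar>q v k t\<bar> \<le> 2 * R\<^sup>2" for v k t
    unfolding q_def by (rule abs_sine_coeff_le[OF hv_cont h_le])
  have q_lip: "\<bar>q v k t - q w k t\<bar> \<le> 2 * (2 * R * dist v w)" for v w k t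
  proof -
    have "q v k t - q w k t = sine_coeff (\<lambda>x. h (apply_bcontfun v (x, t)) - h (apply_bcontfun w (x, t))) k"
      unfolding q_def by (rule sine_coeff_diff[symmetric]) (rule hv_cont)+
    also have "\<bar>\<dots>\<bar> \<le> 2 * (2 * R * dist v w)"
    proof (rule abs_sine_coeff_le)
      show "\<bar>h (apply_bcontfun v (x, t)) - h (apply_bcontfun w (x, t))\<bar> \<le> 2 * R * dist v w" for x
      proof (rule order.trans[OF h_lip])
        show "2 * R * \<bar>apply_bcontfun v (x, t) - apply_bcontfun w (x, t)\<bar> \<le> 2 * R * dist v w"
          using dist_bounded[of v "(x, t)" w] R0 by (intro mult_left_mono) (auto simp: dist_real_def)
      qed
    qed (intro continuous_intros hv_cont)
    finally show ?thesis .
  qed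
  define a where "a v k t = duhamel (\<nu> * (real k)\<^sup>2) (g k) (q v k) t" for v k t
  have a_le: "\<bar>a v k t\<bar> \<le> A / (real k)\<^sup>2 + 2 * R\<^sup>2 * min d (1 / (\<nu> * (real k)\<^sup>2))" if t: "t \<in> {0..d}" for v k t
  proof (cases "k = 0")
    case True
    then show ?thesis using g[of 0] d by (simp add: a_def duhamel_def q_def)
  next
    case False
    have "\<bar>a v k t\<bar> \<le> \<bar>g k\<bar> + 2 * R\<^sup>2 * min d (1 / (\<nu> * (real k)\<^sup>2))"
      unfolding a_def by (rule abs_duhamel_le[OF _ q_cont q_le t]) (use nu False in simp)
    then show ?thesis using g[of k] by linarith
  qed
  \<comment> \<open>One majorant for all v and t: it gives joint continuity in space and time as
    well as the sup bound.\<close>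
  have sM: "summable (\<lambda>k. A / (real k)\<^sup>2 + 2 * R\<^sup>2 * min d (1 / (\<nu> * (real k)\<^sup>2)))"
    by (intro summable_add summable_inverse_square summable_mult summable_min_inverse_square) (use nu d in auto)
  have sa: "summable (\<lambda>k. \<bar>a v k t\<bar>)" if t: "t \<in> {0..d}" for v t
    by (rule summable_comparison_test'[OF sM, of 0]) (use a_le[OF t] in simp)
  \<comment> \<open>The truncated nonlinearity is at most R^2 whatever v is, so every image under
    the map, and in particular the fixed point, lies in the range where the truncation does
    nothing.\<close>
  have v_le: "\<bar>sine_series (\<lambda>k. a v k t) x\<bar> \<le> R" if t: "t \<in> {0..d}" for v t x
  proof -
    have "\<bar>sine_series (\<lambda>k. a v k t) x\<bar> \<le> (\<Sum>k. \<bar>a v k t\<bar>)" by (rule abs_sine_series_le[OF sa[OF t]])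
    also have "\<dots> \<le> (\<Sum>k. A / (real k)\<^sup>2 + 2 * R\<^sup>2 * min d (1 / (\<nu> * (real k)\<^sup>2)))"
      by (rule suminf_le[OF a_le[OF t] sa[OF t] sM])
    also have "\<dots> = A * zeta2 + 2 * R\<^sup>2 * duhamel_sum \<nu> d"
    proof -
      have sd: "summable (\<lambda>k. min d (1 / (\<nu> * (real k)\<^sup>2)))"
        by (rule summable_min_inverse_square) (use nu d in auto)
      show ?thesis
        unfolding suminf_inverse_square[symmetric] duhamel_sum_def suminf_mult[OF sd, symmetric]
        by (rule suminf_add[symmetric]) (intro summable_inverse_square summable_mult sd)+
    qed
    also have "\<dots> \<le> R" using R small1 by linarith
    finally show ?thesis .
  qed
  define \<Phi> where "\<Phi> v = Bcontfun (\<lambda>(x, t). sine_series (\<lambda>k. a v k (c t)) x)" for v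
  have \<Phi>: "apply_bcontfun (\<Phi> v) (x, t) = sine_series (\<lambda>k. a v k (c t)) x" for v x t
  proof -
    have "(\<lambda>(x, t). sine_series (\<lambda>k. a v k (c t)) x) \<in> bcontfun"
    proof (rule bcontfun_normI)
      have "continuous_on (UNIV \<times> UNIV) (\<lambda>(x, t). sine_series (\<lambda>k. a v k (c t)) x)"
      proof (rule continuous_on_sine_series2[OF _ _ sM])
        show "continuous_on UNIV (\<lambda>t. a v k (c t))" for k
          unfolding a_def
          by (rule continuous_on_compose2[OF continuous_on_duhamel[OF q_cont[of "{0..d}"]] c_cont]) (use c in auto)
        show "\<bar>a v k (c t)\<bar> \<le> A / (real k)\<^sup>2 + 2 * R\<^sup>2 * min d (1 / (\<nu> * (real k)\<^sup>2))" for k t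
          by (rule a_le[OF c])
      qed
      then show "continuous_on UNIV (\<lambda>(x, t). sine_series (\<lambda>k. a v k (c t)) x)" by simp
      show "norm (case p of (x, t) \<Rightarrow> sine_series (\<lambda>k. a v k (c t)) x) \<le> R" for p
        using v_le[OF c] by (cases p) simp
    qed
    then show ?thesis by (simp add: \<Phi>_def Bcontfun_inverse)
  qed
  have "\<exists>!v. \<Phi> v = v"
  proof (rule banach_fix_type[of "1 / 2"]; (intro allI)?)
    fix v w
    show "dist (\<Phi> v) (\<Phi> w) \<le> 1 / 2 * dist v w"
    proof (rule dist_bound)
      fix p :: "real \<times> real"
      obtain x t where p: "p = (x, t)" by (cases p)
      have diff: "\<bar>a v k (c t) - a w k (c t)\<bar> \<le> 4 * R * dist v w * min d (1 / (\<nu> * (real k)\<^sup>2))" for k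
      proof (cases "k = 0")
        case True
        then show ?thesis using d by (simp add: a_def duhamel_def q_def)
      next
        case False
        have "\<bar>a v k (c t) - a w k (c t)\<bar> \<le> 2 * (2 * R * dist v w) * min d (1 / (\<nu> * (real k)\<^sup>2))"
          unfolding a_def by (rule abs_duhamel_diff_le[OF _ q_cont q_cont q_lip c]) (use nu False in simp)
        then show ?thesis by simp
      qed
      have sd: "summable (\<lambda>k. min d (1 / (\<nu> * (real k)\<^sup>2)))"
        by (rule summable_min_inverse_square) (use nu d in auto)
      have sdiff: "summable (\<lambda>k. \<bar>a v k (c t) - a w k (c t)\<bar>)"
        by (rule summable_comparison_test'[OF summable_mult[OF sd, of "4 * R * dist v w"], of 0]) (use diff in simp)
      have "dist (apply_bcontfun (\<Phi> v) p) (apply_bcontfun (\<Phi> w) p) = \<bar>sine_series (\<lambda>k. a v k (c t) - a w k (c t)) x\<bar>"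
        unfolding p \<Phi> dist_real_def by (simp add: sine_series_diff[OF sa[OF c] sa[OF c]])
      also have "\<dots> \<le> (\<Sum>k. \<bar>a v k (c t) - a w k (c t)\<bar>)" by (rule abs_sine_series_le[OF sdiff])
      also have "\<dots> \<le> (\<Sum>k. 4 * R * dist v w * min d (1 / (\<nu> * (real k)\<^sup>2)))"
        by (rule suminf_le[OF diff sdiff summable_mult[OF sd]])
      also have "\<dots> = 4 * R * duhamel_sum \<nu> d * dist v w"
        by (simp add: suminf_mult[OF sd] duhamel_sum_def)
      also have "\<dots> \<le> 1 / 2 * dist v w" by (intro mult_right_mono small2) simp
      finally show "dist (apply_bcontfun (\<Phi> v) p) (apply_bcontfun (\<Phi> w) p) \<le> 1 / 2 * dist v w" .
    qed
  qed auto
  then obtain v where v: "\<Phi> v = v" by blast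
  define u where "u x t = apply_bcontfun v (x, t)" for x t
  have u: "u x t = sine_series (\<lambda>k. a v k t) x" if "t \<in> {0..d}" for x t
    using \<Phi>[of v x t] c_id[OF that] v by (simp add: u_def)
  have u_le: "\<bar>u x t\<bar> \<le> R" if "t \<in> {0..d}" for x t
    using v_le[OF that] u[OF that] by simp
  have q_eq: "q v k t = sine_coeff (\<lambda>x. (u x t)\<^sup>2) k" if "t \<in> {0..d}" for k t
  proof -
    have "h (u x t) = (u x t)\<^sup>2" for x
      using u_le[OF that, of x] unfolding h_def by (simp add: max_def min_def abs_le_iff)
    then show ?thesis by (simp add: q_def u_def)
  qed
  \<comment> \<open>The decay constant arises by bounding the minimum in \<open>a_le\<close> by
    1/(\<nu> k^2).\<close>
  have "fourier_solution \<nu> d (A + 2 * R\<^sup>2 / \<nu>) u (a v)"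
  proof
    fix k t assume t: "t \<in> {0..d}"
    show "u x t = sine_series (\<lambda>k. a v k t) x" for x by (rule u[OF t])
    show "(a v k has_real_derivative - (\<nu> * (real k)\<^sup>2) * a v k t - sine_coeff (\<lambda>x. (u x t)\<^sup>2) k) (at t within {0..d})"
      using duhamel_deriv[OF q_cont t, of "\<nu> * (real k)\<^sup>2" "g k" v k] q_eq[OF t] unfolding a_def[abs_def] by simp
    have "2 * R\<^sup>2 * min d (1 / (\<nu> * (real k)\<^sup>2)) \<le> 2 * R\<^sup>2 * (1 / (\<nu> * (real k)\<^sup>2))"
      by (intro mult_left_mono) auto
    then show "\<bar>a v k t\<bar> \<le> (A + 2 * R\<^sup>2 / \<nu>) / (real k)\<^sup>2"
      using a_le[OF t, of v k] by (simp add: add_divide_distrib)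
  qed (use nu d in auto)
  moreover have "\<forall>k. a v k 0 = g k" by (simp add: a_def)
  ultimately show ?thesis using u_le by blast
qed

section \<open>Smoothing and regularity of mild solutions\<close>

lemma exp_minus_le_inverse: "x > 0 \<Longrightarrow> exp (- x) \<le> 1 / (x::real)"
  using order.trans[OF _ exp_ge_add_one_self[of x], of x] by (simp add: exp_minus field_simps)

context fourier_solution
begin

definition q :: "nat \<Rightarrow> real \<Rightarrow> real" where "q k t = sine_coeff (\<lambda>x. (v x t)\<^sup>2) k"

definition vx :: "real \<Rightarrow> real \<Rightarrow> real" where "vx x t = (\<Sum>k. a k t * real k * cos (real k * x))"

definition vxx :: "real \<Rightarrow> real \<Rightarrow> real" where "vxx x t = sine_series (\<lambda>k. - (a k t * (real k)\<^sup>2)) x"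

definition vt :: "real \<Rightarrow> real \<Rightarrow> real" where
  "vt x t = sine_series (\<lambda>k. - (\<nu> * (real k)\<^sup>2) * a k t - q k t) x"

lemma B_nonneg: "B \<ge> 0"
  using bound[of 0 1] d by simp

lemma q_eq: "t \<in> {0..d} \<Longrightarrow> q k t = sine_coeff (\<lambda>x. (sine_series (\<lambda>k. a k t) x)\<^sup>2) k"
  by (simp add: q_def series)

lemma a_cont: "continuous_on {0..d} (a k)"
  by (rule DERIV_continuous_on[OF ode])

lemma v_cont: "continuous_on (UNIV \<times> {0..d}) (\<lambda>(x, t). v x t)"
proof -
  have "continuous_on (UNIV \<times> {0..d}) (\<lambda>(x, t). sine_series (\<lambda>k. a k t) x)"
    by (rule continuous_on_sine_series2[OF a_cont bound summable_inverse_square])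
  then show ?thesis
    by (rule continuous_on_cong[THEN iffD1, OF refl, rotated]) (auto simp: series)
qed

lemma v_cont_space: "t \<in> {0..d} \<Longrightarrow> continuous_on S (\<lambda>x. v x t)"
  using continuous_on_sine_series[OF summable_of_inverse_square_bound[OF bound[of t]]]
  by (simp add: series cong: continuous_on_cong)

lemma q_cont: "continuous_on {0..d} (q k)"
proof -
  have "continuous_on ({0..pi} \<times> {0..d}) (\<lambda>p. ((\<lambda>(x, t). v x t) p)\<^sup>2)"
    by (intro continuous_intros continuous_on_subset[OF v_cont]) auto
  then show ?thesis unfolding q_def by (intro continuous_on_sine_coeff) (simp add: case_prod_beta')
qed

text \<open>Parabolic smoothing: e^(-x) \<le> 1/x with x = \<nu> k^2 (t - s) gains two orders of
  decay on the earlier value too, at the price of a factor that is singular as t approaches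
  s.\<close>

lemma a_later_bound:
  assumes s: "s \<in> {0..d}" and t: "t \<in> {s<..d}" and k: "k \<noteq> 0"
    and Q: "\<And>r. r \<in> {s..d} \<Longrightarrow> \<bar>q k r\<bar> \<le> Q"
  shows "\<bar>a k t\<bar> \<le> \<bar>a k s\<bar> / (\<nu> * (real k)\<^sup>2 * (t - s)) + Q / (\<nu> * (real k)\<^sup>2)"
proof -
  have mu: "\<nu> * (real k)\<^sup>2 > 0" using nu k by simp
  have ss: "{s..t} \<subseteq> {0..d}" using s t by auto
  have "\<bar>a k t\<bar> \<le> exp (- (\<nu> * (real k)\<^sup>2) * (t - s)) * \<bar>a k s\<bar> + Q * min (t - s) (1 / (\<nu> * (real k)\<^sup>2))"
  proof (rule damped_ode_bound'[OF _ mu])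
    fix r assume r: "r \<in> {s..t}"
    show "(a k has_real_derivative - (\<nu> * (real k)\<^sup>2) * a k r - q k r) (at r within {s..t})"
      unfolding q_def by (rule has_field_derivative_subset[OF ode ss]) (use r ss in auto)
    show "\<bar>q k r\<bar> \<le> Q" using Q[of r] r t by auto
  qed (use t in auto)
  also have "\<dots> \<le> 1 / (\<nu> * (real k)\<^sup>2 * (t - s)) * \<bar>a k s\<bar> + Q * (1 / (\<nu> * (real k)\<^sup>2))"
  proof (intro add_mono mult_right_mono mult_left_mono)
    show "exp (- (\<nu> * (real k)\<^sup>2) * (t - s)) \<le> 1 / (\<nu> * (real k)\<^sup>2 * (t - s))"
      using exp_minus_le_inverse[of "\<nu> * (real k)\<^sup>2 * (t - s)"] mu t by simp
    show "Q \<ge> 0" using Q[of s] s by auto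
  qed auto
  finally show ?thesis by simp
qed

text \<open>First bootstrap step: 1/k^2 decay of v gives 1/k decay of the coefficients of v^2, and
  the equation adds two orders. The forcing, not the initial value, limits the gain to
  1/k^3.\<close>

lemma smoothing1:
  assumes s: "s \<in> {0<..d}"
  shows "\<exists>C. \<forall>t\<in>{s..d}. \<forall>k. \<bar>a k t\<bar> \<le> C / real k ^ 3"
proof -
  have Q: "\<bar>q k r\<bar> \<le> 2 * B\<^sup>2 * zeta2 / real k" if "r \<in> {0..d}" for k r
    unfolding q_eq[OF that] by (rule abs_sine_coeff_square_le1[OF bound[OF that]])
  have "\<bar>a k t\<bar> \<le> (B / (\<nu> * s) + 2 * B\<^sup>2 * zeta2 / \<nu>) / real k ^ 3" if t: "t \<in> {s..d}" for k t
  proof (cases "k = 0")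
    case True
    then show ?thesis using bound[of t 0] t s by simp
  next
    case False
    then have k: "real k \<ge> 1" by simp
    have t0: "t > 0" using s t by auto
    have "\<bar>a k t\<bar> \<le> \<bar>a k 0\<bar> / (\<nu> * (real k)\<^sup>2 * (t - 0)) + 2 * B\<^sup>2 * zeta2 / real k / (\<nu> * (real k)\<^sup>2)"
      by (rule a_later_bound[OF _ _ False]) (use d t t0 Q in auto)
    also have "\<bar>a k 0\<bar> / (\<nu> * (real k)\<^sup>2 * (t - 0)) \<le> (B / real k) / (\<nu> * (real k)\<^sup>2 * s)"
    proof (rule frac_le)
      have "B / (real k)\<^sup>2 \<le> B / real k" using k B_nonneg by (intro divide_left_mono) (auto simp: power2_eq_square)
      then show "\<bar>a k 0\<bar> \<le> B / real k" using bound[of 0 k] d by auto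
      show "\<nu> * (real k)\<^sup>2 * s \<le> \<nu> * (real k)\<^sup>2 * (t - 0)" using t nu by (intro mult_left_mono) auto
    qed (use s nu k B_nonneg in auto)
    also have "(B / real k) / (\<nu> * (real k)\<^sup>2 * s) + 2 * B\<^sup>2 * zeta2 / real k / (\<nu> * (real k)\<^sup>2)
        = (B / (\<nu> * s) + 2 * B\<^sup>2 * zeta2 / \<nu>) / real k ^ 3"
      using k s nu by (simp add: field_simps power2_eq_square power3_eq_cube)
    finally show ?thesis by simp
  qed
  then show ?thesis by blast
qed

text \<open>Second bootstrap step: 1/k^3 decay gives 1/k^2 for v^2 and then 1/k^4 for v, enough for
  two termwise space derivatives. Restarting at s/2 leaves positive time for each of the two
  steps.\<close>

lemma smoothing2:
  assumes s: "s \<in> {0<..d}"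
  shows "\<exists>C\<ge>0. \<forall>t\<in>{s..d}. \<forall>k. \<bar>a k t\<bar> \<le> C / real k ^ 4 \<and> \<bar>q k t\<bar> \<le> C / (real k)\<^sup>2"
proof -
  let ?r = "s / 2"
  have r: "?r \<in> {0<..d}" using s by auto
  obtain C where C: "\<And>t k. t \<in> {?r..d} \<Longrightarrow> \<bar>a k t\<bar> \<le> C / real k ^ 3" using smoothing1[OF r] by blast
  have C0: "C \<ge> 0" using C[of ?r 1] r by auto
  define D where "D = 4 * C\<^sup>2 * zeta2"
  have D0: "D \<ge> 0" using zeta2_nonneg by (simp add: D_def)
  have Q: "\<bar>q k t\<bar> \<le> D / (real k)\<^sup>2" if t: "t \<in> {?r..d}" for k t
  proof -
    have t': "t \<in> {0..d}" using t r by auto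
    show ?thesis unfolding q_eq[OF t'] D_def by (rule abs_sine_coeff_square_le2[OF C[OF t]])
  qed
  define M where "M = C / (\<nu> * ?r) + D / \<nu> + D"
  have M: "D \<le> M" "C / (\<nu> * ?r) + D / \<nu> \<le> M" "M \<ge> 0"
    using C0 D0 nu s by (auto simp: M_def)
  have "\<bar>a k t\<bar> \<le> M / real k ^ 4 \<and> \<bar>q k t\<bar> \<le> M / (real k)\<^sup>2" if t: "t \<in> {s..d}" for k t
  proof (cases "k = 0")
    case True
    then show ?thesis using bound[of t 0] t s by (auto simp: q_def)
  next
    case False
    then have k: "real k \<ge> 1" by simp
    have "\<bar>a k t\<bar> \<le> \<bar>a k ?r\<bar> / (\<nu> * (real k)\<^sup>2 * (t - ?r)) + D / (real k)\<^sup>2 / (\<nu> * (real k)\<^sup>2)"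
      by (rule a_later_bound[OF _ _ False]) (use r t s Q in auto)
    also have "\<bar>a k ?r\<bar> / (\<nu> * (real k)\<^sup>2 * (t - ?r)) \<le> (C / (real k)\<^sup>2) / (\<nu> * (real k)\<^sup>2 * ?r)"
    proof (rule frac_le)
      have "C / real k ^ 3 \<le> C / (real k)\<^sup>2" using k C0 by (intro divide_left_mono power_increasing) auto
      then show "\<bar>a k ?r\<bar> \<le> C / (real k)\<^sup>2" using C[of ?r k] r by auto
      show "\<nu> * (real k)\<^sup>2 * ?r \<le> \<nu> * (real k)\<^sup>2 * (t - ?r)" using t nu by (intro mult_left_mono) auto
    qed (use s nu k C0 in auto)
    also have "(C / (real k)\<^sup>2) / (\<nu> * (real k)\<^sup>2 * ?r) + D / (real k)\<^sup>2 / (\<nu> * (real k)\<^sup>2)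
        = (C / (\<nu> * ?r) + D / \<nu>) / real k ^ 4"
      using k s nu by (simp add: field_simps power2_eq_square power4_eq_xxxx)
    also have "\<dots> \<le> M / real k ^ 4" by (intro divide_right_mono M) auto
    finally have "\<bar>a k t\<bar> \<le> M / real k ^ 4" by simp
    moreover have "\<bar>q k t\<bar> \<le> D / (real k)\<^sup>2" using Q[of t k] t s by auto
    moreover have "D / (real k)\<^sup>2 \<le> M / (real k)\<^sup>2" by (intro divide_right_mono M) auto
    ultimately show ?thesis by linarith
  qed
  with M show ?thesis by blast
qed

text \<open>Supplies a single summable majorant for the series of v, its derivatives and v^2,
  uniform on [s,d] for each s > 0; this is the input of every Weierstrass test below.\<close>

lemma smooth_ex:
  assumes s: "s \<in> {0<..d}"
  shows "\<exists>C\<ge>0. \<forall>t\<in>{s..d}. \<forall>k.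
     \<bar>a k t\<bar> \<le> C / (real k)\<^sup>2 \<and> \<bar>a k t * real k\<bar> \<le> C / (real k)\<^sup>2 \<and> \<bar>- (a k t * (real k)\<^sup>2)\<bar> \<le> C / (real k)\<^sup>2 \<and>
     \<bar>q k t\<bar> \<le> C / (real k)\<^sup>2 \<and> \<bar>- (\<nu> * (real k)\<^sup>2) * a k t - q k t\<bar> \<le> C / (real k)\<^sup>2"
proof -
  obtain C where C0: "C \<ge> 0" and C: "\<And>t k. t \<in> {s..d} \<Longrightarrow> \<bar>a k t\<bar> \<le> C / real k ^ 4"
    "\<And>t k. t \<in> {s..d} \<Longrightarrow> \<bar>q k t\<bar> \<le> C / (real k)\<^sup>2" using smoothing2[OF s] by blast
  have "\<bar>a k t\<bar> \<le> (C * (1 + \<nu>)) / (real k)\<^sup>2 \<and> \<bar>a k t * real k\<bar> \<le> (C * (1 + \<nu>)) / (real k)\<^sup>2 \<and>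
     \<bar>- (a k t * (real k)\<^sup>2)\<bar> \<le> (C * (1 + \<nu>)) / (real k)\<^sup>2 \<and>
     \<bar>q k t\<bar> \<le> (C * (1 + \<nu>)) / (real k)\<^sup>2 \<and> \<bar>- (\<nu> * (real k)\<^sup>2) * a k t - q k t\<bar> \<le> (C * (1 + \<nu>)) / (real k)\<^sup>2"
    if t: "t \<in> {s..d}" for t k
  proof (cases "k = 0")
    case True
    then show ?thesis using bound[of t 0] t s by (auto simp: q_def)
  next
    case False
    then have k: "real k \<ge> 1" by simp
    have 3: "\<bar>a k t\<bar> * (real k)\<^sup>2 \<le> C / (real k)\<^sup>2"
    proof -
      have "\<bar>a k t\<bar> * (real k)\<^sup>2 \<le> C / real k ^ 4 * (real k)\<^sup>2" by (intro mult_right_mono C t) auto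
      also have "\<dots> = C / (real k)\<^sup>2" using k by (simp add: field_simps power2_eq_square power4_eq_xxxx)
      finally show ?thesis .
    qed
    have 2: "\<bar>a k t\<bar> * real k \<le> \<bar>a k t\<bar> * (real k)\<^sup>2"
      using k by (intro mult_left_mono) (auto simp: power2_eq_square)
    have 1: "\<bar>a k t\<bar> * 1 \<le> \<bar>a k t\<bar> * real k" using k by (intro mult_left_mono) auto
    have 4: "\<nu> * (\<bar>a k t\<bar> * (real k)\<^sup>2) \<le> \<nu> * (C / (real k)\<^sup>2)" using nu by (intro mult_left_mono 3) auto
    have 5: "\<bar>- (\<nu> * (real k)\<^sup>2) * a k t - q k t\<bar> \<le> \<nu> * (\<bar>a k t\<bar> * (real k)\<^sup>2) + \<bar>q k t\<bar>"
      using abs_triangle_ineq4[of "- (\<nu> * (real k)\<^sup>2) * a k t" "q k t"] nu by (simp add: abs_mult mult_ac)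
    have eq: "(C * (1 + \<nu>)) / (real k)\<^sup>2 = C / (real k)\<^sup>2 + \<nu> * (C / (real k)\<^sup>2)"
      by (simp add: distrib_left add_divide_distrib mult.commute)
    have 6: "\<nu> * (C / (real k)\<^sup>2) \<ge> 0" using nu C0 by simp
    show ?thesis
      unfolding eq using 1 2 3 4 5 6 C(2)[OF t, of k] by (auto simp: abs_mult)
  qed
  moreover have "C * (1 + \<nu>) \<ge> 0" using C0 nu by simp
  ultimately show ?thesis by blast
qed

lemma v_deriv_t:
  assumes t: "t \<in> {0<..<d}"
  shows "((\<lambda>s. v x s) has_real_derivative vt x t) (at t)"
proof -
  let ?S = "{t / 2..d}"
  have s: "t / 2 \<in> {0<..d}" using t by auto
  obtain C where C: "\<And>r k. r \<in> ?S \<Longrightarrow> \<bar>a k r\<bar> \<le> C / (real k)\<^sup>2"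
     "\<And>r k. r \<in> ?S \<Longrightarrow> \<bar>- (\<nu> * (real k)\<^sup>2) * a k r - q k r\<bar> \<le> C / (real k)\<^sup>2"
    using smooth_ex[OF s] by blast
  let ?f' = "\<lambda>k r. (- (\<nu> * (real k)\<^sup>2) * a k r - q k r) * sin (real k * x)"
  have "((\<lambda>r. \<Sum>k. a k r * sin (real k * x)) has_real_derivative (\<Sum>k. ?f' k t)) (at t)"
  proof (rule has_field_derivative_series'[of ?S])
    fix k r assume r: "r \<in> ?S"
    have "(a k has_real_derivative - (\<nu> * (real k)\<^sup>2) * a k r - q k r) (at r within ?S)"
      unfolding q_def by (rule has_field_derivative_subset[OF ode]) (use r t in auto)
    then show "((\<lambda>r. a k r * sin (real k * x)) has_real_derivative ?f' k r) (at r within ?S)"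
      by (rule DERIV_cmult_right)
  next
    have "\<bar>?f' k r\<bar> \<le> C / (real k)\<^sup>2" if r: "r \<in> ?S" for k r
    proof -
      have "\<bar>- (\<nu> * (real k)\<^sup>2) * a k r - q k r\<bar> * \<bar>sin (real k * x)\<bar> \<le> C / (real k)\<^sup>2 * 1"
        using C(2)[OF r, of k] by (intro mult_mono) (auto intro: order.trans[OF abs_ge_zero])
      then show ?thesis by (simp add: abs_mult)
    qed
    then show "uniformly_convergent_on ?S (\<lambda>n r. \<Sum>i<n. ?f' i r)"
      by (intro Weierstrass_m_test'[OF _ summable_inverse_square[of C]]) simp
    show "summable (\<lambda>k. a k t * sin (real k * x))"
      by (rule summable_sine_series[OF summable_of_inverse_square_bound[OF C(1)]]) (use t in auto)
  qed (use t in auto)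
  then have "((\<lambda>r. sine_series (\<lambda>k. a k r) x) has_real_derivative vt x t) (at t)"
    by (simp add: sine_series_def vt_def)
  then show ?thesis
  proof (rule DERIV_cong_ev[THEN iffD1, OF refl _ refl, rotated])
    show "eventually (\<lambda>r. sine_series (\<lambda>k. a k r) x = v x r) (nhds t)"
      using eventually_nhds_in_open[of "{0<..<d}" t] t by (auto elim!: eventually_mono simp: series)
  qed
qed

lemma v_deriv_x:
  assumes t: "t \<in> {0<..d}"
  shows "((\<lambda>y. v y t) has_real_derivative vx x t) (at x)"
    and "((\<lambda>y. vx y t) has_real_derivative vxx x t) (at x)"
proof -
  obtain C where C: "\<And>k. \<bar>a k t\<bar> \<le> C / (real k)\<^sup>2" "\<And>k. \<bar>a k t * real k\<bar> \<le> C / (real k)\<^sup>2"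
     "\<And>k. \<bar>- (a k t * (real k)\<^sup>2)\<bar> \<le> C / (real k)\<^sup>2"
    using smooth_ex[OF t] t by (auto dest!: bspec[of _ _ t])
  have le: "norm (b * e) \<le> C / (real k)\<^sup>2" if "\<bar>b\<bar> \<le> C / (real k)\<^sup>2" "\<bar>e\<bar> \<le> 1" for b e :: real and k
    using mult_mono[OF that] order.trans[OF abs_ge_zero that(1)] by (simp add: abs_mult)
  have "((\<lambda>y. \<Sum>k. a k t * sin (real k * y)) has_real_derivative (\<Sum>k. a k t * real k * cos (real k * x))) (at x)"
  proof (rule has_field_derivative_series'[of UNIV _ _ 0])
    show "((\<lambda>y. a k t * sin (real k * y)) has_real_derivative a k t * real k * cos (real k * y)) (at y within UNIV)" for k y
      by (auto intro!: derivative_eq_intros)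
    show "uniformly_convergent_on UNIV (\<lambda>n y. \<Sum>i<n. a i t * real i * cos (real i * y))"
      by (rule Weierstrass_m_test'[OF le[OF C(2)] summable_inverse_square]) simp
  qed auto
  then show "((\<lambda>y. v y t) has_real_derivative vx x t) (at x)"
    using t by (simp add: series sine_series_def vx_def)
  have "((\<lambda>y. \<Sum>k. a k t * real k * cos (real k * y)) has_real_derivative (\<Sum>k. - (a k t * (real k)\<^sup>2) * sin (real k * x))) (at x)"
  proof (rule has_field_derivative_series'[of UNIV _ _ 0])
    show "((\<lambda>y. a k t * real k * cos (real k * y)) has_real_derivative - (a k t * (real k)\<^sup>2) * sin (real k * y)) (at y within UNIV)" for k y
      by (auto intro!: derivative_eq_intros simp: power2_eq_square)
    show "uniformly_convergent_on UNIV (\<lambda>n y. \<Sum>i<n. - (a i t * (real i)\<^sup>2) * sin (real i * y))"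
      by (rule Weierstrass_m_test'[OF le[OF C(3)] summable_inverse_square]) simp
    show "summable (\<lambda>k. a k t * real k * cos (real k * 0))"
      by (rule summable_comparison_test'[OF summable_inverse_square[of C], of 0]) (use C(2) in simp)
  qed auto
  then show "((\<lambda>y. vx y t) has_real_derivative vxx x t) (at x)"
    by (simp add: sine_series_def vx_def[abs_def] vxx_def)
qed

lemma derivs_cont:
  "continuous_on (UNIV \<times> {0<..<d}) (\<lambda>(x, t). vt x t)"
  "continuous_on (UNIV \<times> {0<..<d}) (\<lambda>(x, t). vx x t)"
  "continuous_on (UNIV \<times> {0<..<d}) (\<lambda>(x, t). vxx x t)"
proof -
  \<comment> \<open>The majorants are uniform only away from t = 0, so continuity is proved on each
    closed strip and then used pointwise.\<close>
  have local: "continuous_on (UNIV \<times> {0<..<d}) f"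
    if f: "\<And>s. s \<in> {0<..d} \<Longrightarrow> continuous_on (UNIV \<times> {s..d}) f" for f :: "real \<times> real \<Rightarrow> real"
  proof (subst continuous_on_eq_continuous_at)
    show "open (UNIV \<times> {0<..<d} :: (real \<times> real) set)" by (intro open_Times) auto
    show "\<forall>p\<in>UNIV \<times> {0<..<d}. isCont f p"
    proof
      fix p :: "real \<times> real" assume p: "p \<in> UNIV \<times> {0<..<d}"
      let ?U = "UNIV \<times> {snd p / 2<..<d} :: (real \<times> real) set"
      have "continuous_on ?U f"
        by (rule continuous_on_subset[OF f[of "snd p / 2"]]) (use p in auto)
      moreover have "open ?U" by (intro open_Times) auto
      moreover have "p \<in> ?U" using p by (cases p) auto
      ultimately show "isCont f p" using continuous_on_eq_continuous_at by blast
    qed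
  qed
  have ac: "continuous_on {s..d} (a k)" and qc: "continuous_on {s..d} (q k)" if "s \<in> {0<..d}" for s k
    using continuous_on_subset[OF a_cont] continuous_on_subset[OF q_cont] that by auto
  have "continuous_on (UNIV \<times> {s..d}) (\<lambda>(x, t). vt x t)" if s: "s \<in> {0<..d}" for s
  proof -
    obtain C where C: "\<And>r k. r \<in> {s..d} \<Longrightarrow> \<bar>- (\<nu> * (real k)\<^sup>2) * a k r - q k r\<bar> \<le> C / (real k)\<^sup>2"
      using smooth_ex[OF s] by blast
    show ?thesis unfolding vt_def
      by (rule continuous_on_sine_series2[OF _ C summable_inverse_square]) (intro continuous_intros ac qc s)
  qed
  then show "continuous_on (UNIV \<times> {0<..<d}) (\<lambda>(x, t). vt x t)" by (rule local)
  have "continuous_on (UNIV \<times> {s..d}) (\<lambda>(x, t). vxx x t)" if s: "s \<in> {0<..d}" for s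
  proof -
    obtain C where C: "\<And>r k. r \<in> {s..d} \<Longrightarrow> \<bar>- (a k r * (real k)\<^sup>2)\<bar> \<le> C / (real k)\<^sup>2"
      using smooth_ex[OF s] by blast
    show ?thesis unfolding vxx_def
      by (rule continuous_on_sine_series2[OF _ C summable_inverse_square]) (intro continuous_intros ac s)
  qed
  then show "continuous_on (UNIV \<times> {0<..<d}) (\<lambda>(x, t). vxx x t)" by (rule local)
  have "continuous_on (UNIV \<times> {s..d}) (\<lambda>p. vx (fst p) (snd p))" if s: "s \<in> {0<..d}" for s
  proof -
    obtain C where C: "\<And>r k. r \<in> {s..d} \<Longrightarrow> \<bar>a k r * real k\<bar> \<le> C / (real k)\<^sup>2"
      using smooth_ex[OF s] by blast
    show ?thesis unfolding vx_def
    proof (rule continuous_on_suminf[OF _ _ summable_inverse_square[of C]])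
      fix k
      have "continuous_on (UNIV \<times> {s..d}) (\<lambda>p::real \<times> real. a k (snd p))"
        by (rule continuous_on_compose2[OF ac[OF s]]) (auto intro!: continuous_intros)
      then show "continuous_on (UNIV \<times> {s..d}) (\<lambda>p::real \<times> real. a k (snd p) * real k * cos (real k * fst p))"
        by (intro continuous_intros)
      fix p :: "real \<times> real" assume p: "p \<in> UNIV \<times> {s..d}"
      then have "snd p \<in> {s..d}" by auto
      from mult_mono[OF C[OF this, of k] abs_cos_le_one[of "real k * fst p"]] order.trans[OF abs_ge_zero C[OF this, of k]]
      show "\<bar>a k (snd p) * real k * cos (real k * fst p)\<bar> \<le> C / (real k)\<^sup>2" by (simp add: abs_mult)
    qed
  qed
  then show "continuous_on (UNIV \<times> {0<..<d}) (\<lambda>(x, t). vx x t)"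
    unfolding case_prod_beta' by (rule local)
qed

text \<open>The mode equations add up to the differential equation because the coefficients of v^2
  are now summable, so that their sine series really sums to v^2.\<close>

lemma v_pde:
  assumes t: "t \<in> {0<..d}" and x: "x \<in> {0..pi}"
  shows "vt x t = \<nu> * vxx x t - (v x t)\<^sup>2"
proof -
  obtain C where C: "\<And>k. \<bar>- (a k t * (real k)\<^sup>2)\<bar> \<le> C / (real k)\<^sup>2" "\<And>k. \<bar>q k t\<bar> \<le> C / (real k)\<^sup>2"
    using smooth_ex[OF t] t by (auto dest!: bspec[of _ _ t])
  have t': "t \<in> {0..d}" using t by auto
  have sq: "summable (\<lambda>k. \<bar>q k t\<bar>)" by (rule summable_of_inverse_square_bound[OF C(2)])
  have s2: "summable (\<lambda>k. \<bar>- (a k t * (real k)\<^sup>2)\<bar>)" by (rule summable_of_inverse_square_bound[OF C(1)])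
  have "sine_series (\<lambda>k. q k t) x = (v x t)\<^sup>2"
    using sine_series_sine_coeff[of "\<lambda>x. (v x t)\<^sup>2", OF _ _ x] sq v_cont_space[OF t']
    unfolding q_def by (simp add: continuous_intros)
  moreover have "(\<Sum>k. (- (\<nu> * (real k)\<^sup>2) * a k t - q k t) * sin (real k * x)) =
    \<nu> * (\<Sum>k. - (a k t * (real k)\<^sup>2) * sin (real k * x)) - (\<Sum>k. q k t * sin (real k * x))"
    unfolding suminf_mult[OF summable_sine_series[OF s2], symmetric]
    by (subst suminf_diff[OF summable_mult[OF summable_sine_series[OF s2]] summable_sine_series[OF sq]])
       (simp add: algebra_simps)
  ultimately show ?thesis by (simp add: vt_def vxx_def sine_series_def)
qed

end

section \<open>Uniqueness and continuation\<close>

text \<open>Both solutions satisfy the same coefficient equations, so the contraction estimate applies to their difference.\<close>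

lemma (in dirichlet_solution) eq_fourier_solution:
  assumes "fourier_solution \<nu> d B v \<alpha>" and t0: "t0 \<in> {a<..<b}" and init: "\<And>k. \<alpha> k 0 = coeff k t0"
    and vR: "\<And>x t. t \<in> {0..d} \<Longrightarrow> \<bar>v x t\<bar> \<le> R"
    and wR: "\<And>x t. x \<in> {0..pi} \<Longrightarrow> t \<in> {t0..<b} \<Longrightarrow> \<bar>w x t\<bar> \<le> R"
    and small: "4 * R * duhamel_sum \<nu> d \<le> 1 / 2"
    and x: "x \<in> {0..pi}" and t: "t \<in> {t0..<b}" "t \<le> t0 + d"
  shows "w x t = v x (t - t0)"
proof -
  interpret f: fourier_solution \<nu> d B v \<alpha> by fact
  define I where "I = {t. t0 \<le> t \<and> t < b \<and> t \<le> t0 + d}"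
  define X where "X = (\<lambda>(x, t). \<bar>w x t - v x (t - t0)\<bar>) ` ({0..pi} \<times> I)"
  \<comment> \<open>Finite, since both solutions are bounded by R. The contraction estimate will
    give m \<le> m/2, hence m = 0.\<close>
  define m where "m = Sup X"
  have dom: "s \<in> {a<..<b}" "s \<in> {t0..<b}" "s - t0 \<in> {0..d}" if "s \<in> I" for s
    using that t0 by (auto simp: I_def)
  have R0: "R \<ge> 0" using vR[of 0 0] f.d by auto
  have le2R: "\<bar>w x s - v x (s - t0)\<bar> \<le> 2 * R" if "x \<in> {0..pi}" "s \<in> I" for x s
    using wR[OF that(1) dom(2)[OF that(2)]] vR[OF dom(3)[OF that(2)], of x] by linarith
  have bdd: "bdd_above X" unfolding X_def by (rule bdd_aboveI[of _ "2 * R"]) (use le2R in auto)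
  have le_m: "\<bar>w x s - v x (s - t0)\<bar> \<le> m" if "x \<in> {0..pi}" "s \<in> I" for x s
    unfolding m_def by (rule cSup_upper[OF _ bdd]) (use that in \<open>auto simp: X_def\<close>)
  have tI: "t \<in> I" using t by (auto simp: I_def)
  have m0: "m \<ge> 0" using le_m[OF x tI] by linarith
  \<comment> \<open>The difference of squares is at most 2 R m, so each mode of the difference
    solves a damped equation with zero initial value and forcing at most 4 R m; summing over the
    modes uses \<open>small\<close>.\<close>
  have half: "\<bar>w y s - v y (s - t0)\<bar> \<le> 1 / 2 * m" if y: "y \<in> {0..pi}" and s: "s \<in> I" for y s
  proof -
    have coeff_le: "\<bar>coeff k s - \<alpha> k (s - t0)\<bar> \<le> 4 * R * m * min d (1 / (\<nu> * (real k)\<^sup>2))" for k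
    proof (cases "k = 0")
      case True
      then show ?thesis using f.bound[OF dom(3)[OF s], of 0] f.d by (simp add: coeff_def)
    next
      case False
      then have mu: "\<nu> * (real k)\<^sup>2 > 0" using nu by simp
      have "\<bar>coeff k s - \<alpha> k (s - t0)\<bar> \<le> exp (- (\<nu> * (real k)\<^sup>2) * (s - t0)) * \<bar>coeff k t0 - \<alpha> k (t0 - t0)\<bar>
          + 2 * (2 * R * m) * min (s - t0) (1 / (\<nu> * (real k)\<^sup>2))"
      proof (rule damped_ode_bound'[OF _ mu])
        show "t0 \<le> s" using s by (simp add: I_def)
        fix r assume r: "r \<in> {t0..s}"
        then have rI: "r \<in> I" using s by (auto simp: I_def)
        have sub: "(\<lambda>r. r - t0) ` {t0..s} \<subseteq> {0..d}" using s by (auto simp: I_def)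
        have "(\<alpha> k \<circ> (\<lambda>r. r - t0) has_real_derivative (- (\<nu> * (real k)\<^sup>2) * \<alpha> k (r - t0) - f.q k (r - t0)) * 1) (at r within {t0..s})"
          unfolding f.q_def
          by (rule DERIV_image_chain[OF has_field_derivative_subset[OF f.ode[OF dom(3)[OF rI]] sub]])
             (auto intro!: derivative_eq_intros)
        from DERIV_diff[OF has_field_derivative_at_within[OF coeff_deriv[OF dom(1)[OF rI]]] this]
        show "((\<lambda>r. coeff k r - \<alpha> k (r - t0)) has_real_derivative
           - (\<nu> * (real k)\<^sup>2) * (coeff k r - \<alpha> k (r - t0)) - (sq_coeff k r - f.q k (r - t0))) (at r within {t0..s})"
          by (simp add: o_def algebra_simps)
        have "sq_coeff k r - f.q k (r - t0) = sine_coeff (\<lambda>x. (w x r)\<^sup>2 - (v x (r - t0))\<^sup>2) k"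
          unfolding sq_coeff_def f.q_def
          by (rule sine_coeff_diff[symmetric]) (intro continuous_intros cont_space dom rI f.v_cont_space)+
        also have "\<bar>\<dots>\<bar> \<le> 2 * (2 * R * m)"
        proof (rule abs_sine_coeff_le)
          show "continuous_on {0..pi} (\<lambda>x. (w x r)\<^sup>2 - (v x (r - t0))\<^sup>2)"
            by (intro continuous_intros cont_space dom rI f.v_cont_space)
          fix x assume x: "x \<in> {0..pi}"
          have "\<bar>(w x r)\<^sup>2 - (v x (r - t0))\<^sup>2\<bar> = \<bar>w x r + v x (r - t0)\<bar> * \<bar>w x r - v x (r - t0)\<bar>"
            by (simp add: abs_mult[symmetric] power2_eq_square algebra_simps)
          also have "\<dots> \<le> (2 * R) * m"
          proof (rule mult_mono)
            show "\<bar>w x r + v x (r - t0)\<bar> \<le> 2 * R"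
              using wR[OF x dom(2)[OF rI]] vR[OF dom(3)[OF rI], of x] by linarith
          qed (use le_m[OF x rI] R0 in auto)
          finally show "\<bar>(w x r)\<^sup>2 - (v x (r - t0))\<^sup>2\<bar> \<le> 2 * R * m" .
        qed
        finally show "\<bar>sq_coeff k r - f.q k (r - t0)\<bar> \<le> 2 * (2 * R * m)" .
      qed
      also have "\<dots> = 2 * (2 * R * m) * min (s - t0) (1 / (\<nu> * (real k)\<^sup>2))" by (simp add: init)
      also have "\<dots> \<le> 2 * (2 * R * m) * min d (1 / (\<nu> * (real k)\<^sup>2))"
        using R0 m0 dom(3)[OF s] by (intro mult_left_mono) auto
      finally show ?thesis by simp
    qed
    have sd: "summable (\<lambda>k. min d (1 / (\<nu> * (real k)\<^sup>2)))"
      by (rule summable_min_inverse_square) (use nu f.d in auto)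
    have sdiff: "summable (\<lambda>k. \<bar>coeff k s - \<alpha> k (s - t0)\<bar>)"
      by (rule summable_comparison_test'[OF summable_mult[OF sd, of "4 * R * m"], of 0]) (use coeff_le in simp)
    have "w y s - v y (s - t0) = sine_series (\<lambda>k. coeff k s - \<alpha> k (s - t0)) y"
      unfolding f.series[OF dom(3)[OF s]] sine_series_coeff[OF dom(1)[OF s] y, symmetric]
      by (rule sine_series_diff[OF summable_coeff[OF dom(1)[OF s]] summable_of_inverse_square_bound[OF f.bound[OF dom(3)[OF s]]]])
    then have "\<bar>w y s - v y (s - t0)\<bar> \<le> (\<Sum>k. \<bar>coeff k s - \<alpha> k (s - t0)\<bar>)"
      using abs_sine_series_le[OF sdiff] by simp
    also have "\<dots> \<le> (\<Sum>k. 4 * R * m * min d (1 / (\<nu> * (real k)\<^sup>2)))"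
      by (rule suminf_le[OF coeff_le sdiff summable_mult[OF sd]])
    also have "\<dots> = 4 * R * duhamel_sum \<nu> d * m"
      by (simp add: suminf_mult[OF sd] duhamel_sum_def)
    also have "\<dots> \<le> 1 / 2 * m" by (intro mult_right_mono small m0)
    finally show ?thesis .
  qed
  have "m \<le> 1 / 2 * m"
    unfolding m_def by (rule cSup_least) (use half x tI in \<open>auto simp: X_def m_def\<close>)
  then show ?thesis using le_m[OF x tI] by linarith
qed

text \<open>The pieces overlap for t0 < t < T, so both are relatively open in D and cover it; no
  matching at the single time T is needed.\<close>

lemma continuous_on_glue_time:
  fixes f g :: "real \<times> real \<Rightarrow> real"
  assumes "continuous_on (D \<inter> UNIV \<times> {..<T}) f" "continuous_on (D \<inter> UNIV \<times> {t0<..}) g" and t0: "t0 < T"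
    and eq: "\<And>p. p \<in> D \<Longrightarrow> t0 < snd p \<Longrightarrow> snd p < T \<Longrightarrow> f p = g p"
  shows "continuous_on D (\<lambda>p. if snd p < T then f p else g p)"
proof -
  have D: "(D \<inter> UNIV \<times> {..<T}) \<union> (D \<inter> UNIV \<times> {t0<..}) = D"
  proof
    show "D \<subseteq> (D \<inter> UNIV \<times> {..<T}) \<union> (D \<inter> UNIV \<times> {t0<..})"
      using t0 by (auto simp: not_less)
  qed auto
  have "continuous_on ((D \<inter> UNIV \<times> {..<T}) \<union> (D \<inter> UNIV \<times> {t0<..})) (\<lambda>p. if snd p < T then f p else g p)"
  proof (rule continuous_on_cases_local_open)
    show "openin (top_of_set (D \<inter> UNIV \<times> {..<T} \<union> D \<inter> UNIV \<times> {t0<..})) (D \<inter> UNIV \<times> {..<T})"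
      unfolding D by (intro openin_open_Int open_Times) auto
    show "openin (top_of_set (D \<inter> UNIV \<times> {..<T} \<union> D \<inter> UNIV \<times> {t0<..})) (D \<inter> UNIV \<times> {t0<..})"
      unfolding D by (intro openin_open_Int open_Times) auto
  qed (use assms in auto)
  then show ?thesis unfolding D .
qed

lemma real_derivative_unique_within_Icc:
  fixes f :: "real \<Rightarrow> real"
  assumes "x \<in> {0..pi}" "(f has_real_derivative D) (at x within {0..pi})" "(f has_real_derivative D') (at x within {0..pi})"
  shows "D = D'"
  using vector_derivative_unique_within_closed_interval[of 0 pi x f D D'] assms
  by (simp add: has_real_derivative_iff_has_vector_derivative)

text \<open>The two solutions coincide on [t0,T), so their derivatives coincide for t0 < t < T by
  uniqueness. Near T the glued function is the shifted v, which is smooth there because 0 < T - t0 <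
  d; near t = 0 nothing changes.\<close>

lemma classical_solution_extend:
  assumes sol: "classical_solution \<nu> \<omega>\<^sub>0 (ereal T) w" and f: "fourier_solution \<nu> d B v \<alpha>"
    and t0: "0 < t0" "t0 < T" "T < t0 + d"
    and eq: "\<And>x t. x \<in> {0..pi} \<Longrightarrow> t \<in> {t0..<T} \<Longrightarrow> w x t = v x (t - t0)"
  shows "classical_solution \<nu> \<omega>\<^sub>0 (ereal (t0 + d)) (\<lambda>x t. if t < T then w x t else v x (t - t0))"
proof -
  interpret f: fourier_solution \<nu> d B v \<alpha> by fact
  obtain wt wx wxx where C21: "C21_with (ereal T) w wt wx wxx"
    and pde: "\<And>x t. x \<in> {0<..<pi} \<Longrightarrow> 0 < t \<Longrightarrow> t < T \<Longrightarrow> wt x t = \<nu> * wxx x t - (w x t)\<^sup>2"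
    using sol unfolding classical_solution_def by (auto simp del: greaterThanLessThan_iff)
  have dt: "((\<lambda>s. w x s) has_real_derivative wt x t) (at t)"
    and dx: "((\<lambda>y. w y t) has_real_derivative wx x t) (at x within {0..pi})"
    and dxx: "((\<lambda>y. wx y t) has_real_derivative wxx x t) (at x within {0..pi})"
    if "x \<in> {0..pi}" "0 < t" "t < T" for x t
    using C21 that unfolding C21_with_def by auto
  have cont: "continuous_on ({0..pi} \<times> {t. 0 < t \<and> ereal t < T}) (\<lambda>(x, t). wt x t)"
     "continuous_on ({0..pi} \<times> {t. 0 < t \<and> ereal t < T}) (\<lambda>(x, t). wx x t)"
     "continuous_on ({0..pi} \<times> {t. 0 < t \<and> ereal t < T}) (\<lambda>(x, t). wxx x t)"
    using C21 unfolding C21_with_def by blast+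
  have bc: "w 0 t = 0" "w pi t = 0" if "0 < t" "t < T" for t
    using sol that unfolding classical_solution_def by auto
  have init: "w x 0 = \<omega>\<^sub>0 x" if "x \<in> {0..pi}" for x
    using sol that unfolding classical_solution_def by auto
  have contw: "continuous_on ({0..pi} \<times> {t. 0 \<le> t \<and> ereal t < T} - {(0, 0), (pi, 0)}) (\<lambda>(x, t). w x t)"
    using sol unfolding classical_solution_def by blast
  obtain \<tau> where \<tau>: "\<tau> > 0" "\<tau> < T" "bounded ((\<lambda>(x, t). w x t) ` ({0..pi} \<times> {0..\<tau>}))"
    using sol unfolding classical_solution_def by auto
  have shift: "((\<lambda>s. v x (s - t0)) has_real_derivative f.vt x (t - t0)) (at t)" if "t0 < t" "t < t0 + d" for x t
  proof -
    have "((\<lambda>s. v x s) has_real_derivative f.vt x (t - t0)) (at (t + - t0))"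
      using f.v_deriv_t[of "t - t0" x] that by simp
    then show ?thesis using DERIV_shift[of "\<lambda>s. v x s" "f.vt x (t - t0)" t "- t0"] by simp
  qed
  have vx: "((\<lambda>y. v y s) has_real_derivative f.vx x s) (at x within {0..pi})"
    "((\<lambda>y. f.vx y s) has_real_derivative f.vxx x s) (at x within {0..pi})" if "s \<in> {0<..d}" for x s
    using f.v_deriv_x[OF that, of x] by (auto intro: has_field_derivative_at_within)
  have eqt: "wt x t = f.vt x (t - t0)" if "x \<in> {0..pi}" "t0 < t" "t < T" for x t
  proof (rule DERIV_unique)
    show "((\<lambda>s. v x (s - t0)) has_real_derivative f.vt x (t - t0)) (at t)"
      by (rule shift) (use that t0 in auto)
    show "((\<lambda>s. v x (s - t0)) has_real_derivative wt x t) (at t)"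
    proof (rule DERIV_cong_ev[THEN iffD1, OF refl _ refl dt])
      show "eventually (\<lambda>s. w x s = v x (s - t0)) (nhds t)"
        using eventually_nhds_in_open[of "{t0<..<T}" t] that by (auto elim!: eventually_mono intro: eq)
    qed (use that t0 in auto)
  qed
  have eqx: "wx x t = f.vx x (t - t0)" if "x \<in> {0..pi}" "t0 < t" "t < T" for x t
  proof (rule real_derivative_unique_within_Icc[OF that(1)])
    show "((\<lambda>y. w y t) has_real_derivative wx x t) (at x within {0..pi})"
      by (rule dx) (use that t0 in auto)
    show "((\<lambda>y. w y t) has_real_derivative f.vx x (t - t0)) (at x within {0..pi})"
      by (rule has_field_derivative_transform_within[OF vx(1)[of "t - t0"] zero_less_one that(1)]) (use that t0 eq in auto)
  qed
  have eqxx: "wxx x t = f.vxx x (t - t0)" if "x \<in> {0..pi}" "t0 < t" "t < T" for x t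
  proof (rule real_derivative_unique_within_Icc[OF that(1)])
    show "((\<lambda>y. wx y t) has_real_derivative wxx x t) (at x within {0..pi})"
      by (rule dxx) (use that t0 in auto)
    show "((\<lambda>y. wx y t) has_real_derivative f.vxx x (t - t0)) (at x within {0..pi})"
      by (rule has_field_derivative_transform_within[OF vx(2)[of "t - t0"] zero_less_one that(1)]) (use that t0 eqx in auto)
  qed
  let ?w = "\<lambda>x t. if t < T then w x t else v x (t - t0)"
  let ?wt = "\<lambda>x t. if t < T then wt x t else f.vt x (t - t0)"
  let ?wx = "\<lambda>x t. if t < T then wx x t else f.vx x (t - t0)"
  let ?wxx = "\<lambda>x t. if t < T then wxx x t else f.vxx x (t - t0)"
  have glue: "continuous_on D (\<lambda>(x, t). if t < T then h x t else g x (t - t0))"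
    if h: "continuous_on (D \<inter> UNIV \<times> {..<T}) (\<lambda>(x, t). h x t)"
      and g: "continuous_on (UNIV \<times> {0<..<d}) (\<lambda>(x, t). g x t)"
      and D: "D \<subseteq> {0..pi} \<times> {..<t0 + d}"
      and eq: "\<And>x t. x \<in> {0..pi} \<Longrightarrow> t0 < t \<Longrightarrow> t < T \<Longrightarrow> h x t = g x (t - t0)"
    for D and h g :: "real \<Rightarrow> real \<Rightarrow> real"
  proof -
    have "continuous_on (D \<inter> UNIV \<times> {t0<..}) (\<lambda>p. (\<lambda>(x, t). g x t) (fst p, snd p - t0))"
      by (rule continuous_on_compose2[OF g]) (use D in \<open>auto intro!: continuous_intros\<close>)
    then have "continuous_on D (\<lambda>p. if snd p < T then (\<lambda>(x, t). h x t) p else (\<lambda>(x, t). g x t) (fst p, snd p - t0))"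
    proof (rule continuous_on_glue_time[OF h _ t0(2)])
      fix p assume p: "p \<in> D" "t0 < snd p" "snd p < T"
      then have "fst p \<in> {0..pi}" using D by auto
      from eq[OF this p(2,3)]
      show "(\<lambda>(x, t). h x t) p = (\<lambda>(x, t). g x t) (fst p, snd p - t0)" by (simp add: case_prod_beta')
    qed
    moreover have "(\<lambda>p. if snd p < T then (\<lambda>(x, t). h x t) p else (\<lambda>(x, t). g x t) (fst p, snd p - t0)) =
        (\<lambda>(x, t). if t < T then h x t else g x (t - t0))"
      by (rule ext) (simp split: prod.split)
    ultimately show ?thesis by (simp only:)
  qed
  have glue': "continuous_on ({0..pi} \<times> {t. 0 < t \<and> ereal t < ereal (t0 + d)}) (\<lambda>(x, t). if t < T then h x t else g x (t - t0))"
    if "continuous_on ({0..pi} \<times> {t. 0 < t \<and> ereal t < T}) (\<lambda>(x, t). h x t)"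
      "continuous_on (UNIV \<times> {0<..<d}) (\<lambda>(x, t). g x t)"
      "\<And>x t. x \<in> {0..pi} \<Longrightarrow> t0 < t \<Longrightarrow> t < T \<Longrightarrow> h x t = g x (t - t0)" for h g :: "real \<Rightarrow> real \<Rightarrow> real"
    by (rule glue[OF continuous_on_subset[OF that(1)] that(2) _ that(3)]) auto
  have "C21_with (ereal (t0 + d)) ?w ?wt ?wx ?wxx"
    unfolding C21_with_def
  proof (intro conjI ballI allI impI)
    fix x t :: real assume x: "x \<in> {0..pi}" and t: "0 < t" "ereal t < ereal (t0 + d)"
    show "((\<lambda>s. ?w x s) has_real_derivative ?wt x t) (at t)"
    proof (cases "t < T")
      case True
      have "((\<lambda>s. ?w x s) has_real_derivative wt x t) (at t)"
      proof (rule DERIV_cong_ev[THEN iffD1, OF refl _ refl dt[OF x t(1) True]])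
        show "eventually (\<lambda>s. w x s = ?w x s) (nhds t)"
          using eventually_nhds_in_open[of "{..<T}" t] True by (auto elim!: eventually_mono)
      qed
      then show ?thesis using True by simp
    next
      case False
      \<comment> \<open>This case includes t = T: the shifted v represents the glued function on
        both sides of T.\<close>
      have "((\<lambda>s. ?w x s) has_real_derivative f.vt x (t - t0)) (at t)"
      proof (rule DERIV_cong_ev[THEN iffD1, OF refl _ refl shift])
        show "eventually (\<lambda>s. v x (s - t0) = ?w x s) (nhds t)"
          using eventually_nhds_in_open[of "{t0<..}" t] False t0 x by (auto elim!: eventually_mono simp: eq)
      qed (use False t t0 in auto)
      then show ?thesis using False by simp
    qed
    show "((\<lambda>y. ?w y t) has_real_derivative ?wx x t) (at x within {0..pi})"
      using dx[OF x t(1)] vx(1)[of "t - t0" x] t t0 by auto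
    show "((\<lambda>y. ?wx y t) has_real_derivative ?wxx x t) (at x within {0..pi})"
      using dxx[OF x t(1)] vx(2)[of "t - t0" x] t t0 by auto
  qed (rule glue'[OF cont(1) f.derivs_cont(1) eqt] glue'[OF cont(2) f.derivs_cont(2) eqx] glue'[OF cont(3) f.derivs_cont(3) eqxx]; assumption)+
  moreover have "?wt x t = \<nu> * ?wxx x t - (?w x t)\<^sup>2" if "x \<in> {0<..<pi}" "t > 0" "ereal t < ereal (t0 + d)" for x t
    using pde[of x t] f.v_pde[of "t - t0" x] that t0 by auto
  moreover have "continuous_on ({0..pi} \<times> {t. 0 \<le> t \<and> ereal t < ereal (t0 + d)} - {(0, 0), (pi, 0)}) (\<lambda>(x, t). ?w x t)"
  proof (rule glue)
    show "continuous_on (({0..pi} \<times> {t. 0 \<le> t \<and> ereal t < ereal (t0 + d)} - {(0, 0), (pi, 0)}) \<inter> UNIV \<times> {..<T}) (\<lambda>(x, t). w x t)"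
      by (rule continuous_on_subset[OF contw]) auto
    show "continuous_on (UNIV \<times> {0<..<d}) (\<lambda>(x, t). v x t)"
      by (rule continuous_on_subset[OF f.v_cont]) auto
  qed (use eq in auto)
  moreover have "?w 0 t = 0 \<and> ?w pi t = 0" if "t > 0" "ereal t < ereal (t0 + d)" for t
    using bc[of t] f.series[of "t - t0" 0] f.series[of "t - t0" pi] that t0 by auto
  moreover have "?w x 0 = \<omega>\<^sub>0 x" if "x \<in> {0..pi}" for x using init[OF that] t0 by simp
  moreover have "\<exists>\<tau>>0. ereal \<tau> < ereal (t0 + d) \<and> bounded ((\<lambda>(x, t). ?w x t) ` ({0..pi} \<times> {0..\<tau>}))"
  proof (intro exI conjI)
    have "(\<lambda>(x, t). ?w x t) ` ({0..pi} \<times> {0..\<tau>}) = (\<lambda>(x, t). w x t) ` ({0..pi} \<times> {0..\<tau>})"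
      by (rule image_cong) (use \<tau> in auto)
    then show "bounded ((\<lambda>(x, t). ?w x t) ` ({0..pi} \<times> {0..\<tau>}))" using \<tau> by simp
  qed (use \<tau> t0 in auto)
  moreover have "0 < ereal (t0 + d)" using t0 f.d by simp
  ultimately show ?thesis unfolding classical_solution_def by blast
qed

section \<open>Passage from classical solutions to the estimates, and the initial value of F\<close>

lemma classical_solution_imp_dirichlet:
  assumes "classical_solution \<nu> \<omega>\<^sub>0 T w" "\<nu> > 0" "ereal b \<le> T"
  shows "\<exists>wt wx wxx. dirichlet_solution \<nu> 0 b w wt wx wxx"
proof -
  have lt: "ereal t < T" if "t < b" for t using that assms(3) less_ereal.simps(1) less_le_trans by blast
  obtain wt wx wxx where C21: "C21_with T w wt wx wxx"
    and pde: "\<And>x t. x \<in> {0<..<pi} \<Longrightarrow> 0 < t \<Longrightarrow> ereal t < T \<Longrightarrow> wt x t = \<nu> * wxx x t - (w x t)\<^sup>2"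
    using assms(1) unfolding classical_solution_def by (auto simp del: greaterThanLessThan_iff)
  have sub: "{0..pi} \<times> {0<..<b} \<subseteq> {0..pi} \<times> {t. 0 < t \<and> ereal t < T}"
    "{0..pi} \<times> {0<..<b} \<subseteq> {0..pi} \<times> {t. 0 \<le> t \<and> ereal t < T} - {(0, 0), (pi, 0)}"
    using lt by auto
  have contw: "continuous_on ({0..pi} \<times> {t. 0 \<le> t \<and> ereal t < T} - {(0, 0), (pi, 0)}) (\<lambda>(x, t). w x t)"
    and bc: "\<And>t. t > 0 \<Longrightarrow> ereal t < T \<Longrightarrow> w 0 t = 0 \<and> w pi t = 0"
    using assms(1) unfolding classical_solution_def by blast+
  have "dirichlet_solution \<nu> 0 b w wt wx wxx"
  proof
    show "continuous_on ({0..pi} \<times> {0<..<b}) (\<lambda>(x, t). w x t)" by (rule continuous_on_subset[OF contw sub(2)])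
    show "continuous_on ({0..pi} \<times> {0<..<b}) (\<lambda>(x, t). wt x t)" "continuous_on ({0..pi} \<times> {0<..<b}) (\<lambda>(x, t). wxx x t)"
      using C21 unfolding C21_with_def by (auto intro: continuous_on_subset[OF _ sub(1)])
  next
    fix x t assume "x \<in> {0..pi}" "t \<in> {0<..<b}"
    then have "x \<in> {0..pi}" "t > 0" "ereal t < T" using lt by auto
    with C21 show "((\<lambda>s. w x s) has_real_derivative wt x t) (at t)"
      "((\<lambda>y. w y t) has_real_derivative wx x t) (at x within {0..pi})"
      "((\<lambda>y. wx y t) has_real_derivative wxx x t) (at x within {0..pi})"
      unfolding C21_with_def by blast+
  qed (use assms(2) pde bc lt in auto)
  then show ?thesis by blast
qed

text \<open>The weight \<open>sin\<close> hides the possible discontinuity of \<open>w\<close> at the two corners.\<close>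

lemma classical_solution_integral_tendsto:
  assumes sol: "classical_solution \<nu> \<omega>\<^sub>0 T w" and nu: "\<nu> > 0"
  shows "((\<lambda>t. integral {0..pi} (\<lambda>x. w x t * sin x)) \<longlongrightarrow> integral {0..pi} (\<lambda>x. \<omega>\<^sub>0 x * sin x)) (at_right 0)"
proof -
  obtain \<tau> where \<tau>: "\<tau> > 0" "ereal \<tau> < T" "bounded ((\<lambda>(x, t). w x t) ` ({0..pi} \<times> {0..\<tau>}))"
    and init: "\<And>x. x \<in> {0..pi} \<Longrightarrow> w x 0 = \<omega>\<^sub>0 x"
    and contw: "continuous_on ({0..pi} \<times> {t. 0 \<le> t \<and> ereal t < T} - {(0, 0), (pi, 0)}) (\<lambda>(x, t). w x t)"
    using sol unfolding classical_solution_def by blast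
  \<comment> \<open>The boundedness clause of \<open>classical_solution\<close> provides the
    dominating constant; pointwise convergence can fail only at the end points, where sin
    vanishes.\<close>
  obtain K where "\<forall>y\<in>(\<lambda>(x, t). w x t) ` ({0..pi} \<times> {0..\<tau>}). norm y \<le> K"
    using \<tau>(3) unfolding bounded_iff by blast
  then have K: "\<bar>w x t\<bar> \<le> K" if "x \<in> {0..pi}" "t \<in> {0..\<tau>}" for x t using that by force
  obtain wt wx wxx where "dirichlet_solution \<nu> 0 \<tau> w wt wx wxx"
    using classical_solution_imp_dirichlet[OF sol nu] \<tau>(2) by (meson order.strict_implies_order)
  then interpret dirichlet_solution \<nu> 0 \<tau> w wt wx wxx .
  show ?thesis
  proof (rule tendsto_at_right_sequentially[OF \<tau>(1)])
    fix S :: "nat \<Rightarrow> real" assume S: "\<And>n. 0 < S n" "\<And>n. S n < \<tau>" "S \<longlonglongrightarrow> 0"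
    show "(\<lambda>n. integral {0..pi} (\<lambda>x. w x (S n) * sin x)) \<longlonglongrightarrow> integral {0..pi} (\<lambda>x. \<omega>\<^sub>0 x * sin x)"
    proof (rule dominated_convergence(2)[where h = "\<lambda>_. K"])
      show "(\<lambda>x. w x (S n) * sin x) integrable_on {0..pi}" for n
        by (intro integrable_continuous_real continuous_intros cont_space) (use S in auto)
      show "norm (w x (S n) * sin x) \<le> K" if "x \<in> {0..pi}" for n x
      proof -
        have "\<bar>w x (S n)\<bar> * \<bar>sin x\<bar> \<le> K * 1"
          using K[OF that, of "S n"] S(1,2)[of n] by (intro mult_mono) (auto intro: order.trans[OF abs_ge_zero])
        then show ?thesis by (simp add: abs_mult)
      qed
      show "(\<lambda>n. w x (S n) * sin x) \<longlonglongrightarrow> \<omega>\<^sub>0 x * sin x" if x: "x \<in> {0..pi}" for x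
      proof (cases "x = 0 \<or> x = pi")
        case True
        then show ?thesis by auto
      next
        case False
        have "(\<lambda>n. (\<lambda>(x, t). w x t) (x, S n)) \<longlonglongrightarrow> (\<lambda>(x, t). w x t) (x, 0)"
        proof (rule continuous_on_tendsto_compose[OF contw])
          show "(\<lambda>n. (x, S n)) \<longlonglongrightarrow> (x, 0)" by (intro tendsto_intros S)
          show "(x, 0) \<in> {0..pi} \<times> {t. 0 \<le> t \<and> ereal t < T} - {(0, 0), (pi, 0)}"
            using x False sol by (auto simp: classical_solution_def zero_ereal_def)
          have "ereal (S n) < T" for n using S(2)[of n] \<tau>(2) by (meson ereal_less_eq(3) le_less_trans less_imp_le)
          then show "\<forall>\<^sub>F n in sequentially. (x, S n) \<in> {0..pi} \<times> {t. 0 \<le> t \<and> ereal t < T} - {(0, 0), (pi, 0)}"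
            using x False S(1) by (auto intro!: always_eventually less_imp_le)
        qed
        then show ?thesis using init[OF x] by (intro tendsto_intros) simp
      qed
    qed (rule integrable_const_ivl)
  qed
qed

theorem theorem6p1:
  fixes \<nu> :: real
  assumes "\<nu> > 0"
  shows "\<exists>M>0. \<forall>(\<omega>\<^sub>0 :: real \<Rightarrow> real) (T :: ereal) (\<omega> :: real \<Rightarrow> real \<Rightarrow> real).
           continuous_on {0..pi} \<omega>\<^sub>0 \<longrightarrow>
           integral {0..pi} (\<lambda>x. \<omega>\<^sub>0 x * sin x) < - M \<longrightarrow>
           maximal_solution \<nu> \<omega>\<^sub>0 T \<omega> \<longrightarrow>
           (\<exists>Tstar>0. T = ereal Tstar \<and>
              filterlim (\<lambda>t. integral {0..pi} (\<lambda>x. \<omega> x t * sin x)) at_bot (at_left Tstar))"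
proof (rule exI[of _ "2 * \<nu>"], intro conjI allI impI)
  show "2 * \<nu> > 0" using assms by simp
  fix \<omega>\<^sub>0 :: "real \<Rightarrow> real" and T :: ereal and w :: "real \<Rightarrow> real \<Rightarrow> real"
  assume small: "integral {0..pi} (\<lambda>x. \<omega>\<^sub>0 x * sin x) < - (2 * \<nu>)" and max: "maximal_solution \<nu> \<omega>\<^sub>0 T w"
  have sol: "classical_solution \<nu> \<omega>\<^sub>0 T w" using max by (simp add: maximal_solution_def)
  define F0 where "F0 = integral {0..pi} (\<lambda>x. \<omega>\<^sub>0 x * sin x)"
  have F0: "F0 < - (2 * \<nu>)" "F0 < 0" using small assms by (auto simp: F0_def)
  have T0: "T > 0" using sol by (simp add: classical_solution_def)
  have lim: "((\<lambda>t. integral {0..pi} (\<lambda>x. w x t * sin x)) \<longlongrightarrow> F0) (at_right 0)"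
    unfolding F0_def by (rule classical_solution_integral_tendsto[OF sol assms])
  have "T \<noteq> \<infinity>"
  proof
    assume T: "T = \<infinity>"
    define r where "r = - 2 * \<nu> / F0"
    have r: "0 < r" "r < 1" using F0 assms by (auto simp: r_def field_simps)
    \<comment> \<open>Chosen so that 1 - e^(-\<nu> t) = (1 + r)/2, which exceeds r because r <
      1.\<close>
    define t where "t = - ln ((1 - r) / 2) / \<nu>"
    have "ln ((1 - r) / 2) < 0" using r by (intro ln_less_zero) auto
    then have t: "t > 0" using assms by (simp add: t_def divide_neg_pos)
    obtain wt wx wxx where "dirichlet_solution \<nu> 0 (t + 1) w wt wx wxx"
      using classical_solution_imp_dirichlet[OF sol assms, of "t + 1"] T by auto
    then interpret dirichlet_solution \<nu> 0 "t + 1" w wt wx wxx .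
    have "1 - exp (- \<nu> * t) \<le> - 2 * \<nu> / F0"
      by (rule blow_up_time_bound[OF refl _ F0(2)]) (use t lim in \<open>auto simp: F_def[abs_def]\<close>)
    moreover have "exp (- \<nu> * t) = (1 - r) / 2" using r assms by (simp add: t_def)
    ultimately show False using r by (simp add: r_def)
  qed
  then obtain Ts where T: "T = ereal Ts" using T0 by (cases T) auto
  have Ts: "Ts > 0" using T T0 by simp
  obtain wt wx wxx where "dirichlet_solution \<nu> 0 Ts w wt wx wxx"
    using classical_solution_imp_dirichlet[OF sol assms, of Ts] T by auto
  then interpret dirichlet_solution \<nu> 0 Ts w wt wx wxx .
  have "filterlim F at_bot (at_left Ts)"
  \<comment> \<open>Since e^(\<nu> t) F is nonincreasing, failure of a lower bound already means
    divergence to minus infinity at \<open>Ts\<close>; the other case must contradict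
    maximality.\<close>
  proof (cases "\<exists>G. \<forall>t\<in>{0<..<Ts}. exp (\<nu> * t) * F t \<ge> - G")
    case False
    show ?thesis unfolding filterlim_at_bot
    proof
      fix Z :: real
      \<comment> \<open>The factor exp (\<nu> Ts) compensates for e^(\<nu> t) \<le> e^(\<nu> Ts), so
        that F itself, and not only e^(\<nu> t) F, drops below Z.\<close>
      obtain s where s: "s \<in> {0<..<Ts}" "exp (\<nu> * s) * F s < - (\<bar>Z\<bar> * exp (\<nu> * Ts))"
        using False by (meson not_le)
      have "F t \<le> Z" if t: "t \<in> {s<..<Ts}" for t
      proof (rule ccontr)
        assume "\<not> F t \<le> Z"
        then have "- \<bar>Z\<bar> \<le> F t" by linarith
        then have "exp (\<nu> * t) * - \<bar>Z\<bar> \<le> exp (\<nu> * t) * F t" by (intro mult_left_mono) auto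
        also have "\<dots> \<le> exp (\<nu> * s) * F s" by (rule exp_F_antimono) (use s t in auto)
        also have "\<dots> < - (\<bar>Z\<bar> * exp (\<nu> * Ts))" by (rule s(2))
        finally have "\<bar>Z\<bar> * exp (\<nu> * Ts) < \<bar>Z\<bar> * exp (\<nu> * t)" by (simp add: mult.commute)
        moreover have "\<bar>Z\<bar> * exp (\<nu> * t) \<le> \<bar>Z\<bar> * exp (\<nu> * Ts)"
          using t assms by (intro mult_left_mono) auto
        ultimately show False by linarith
      qed
      then show "eventually (\<lambda>t. F t \<le> Z) (at_left Ts)"
        using eventually_at_left_real[of s Ts] s by (auto elim!: eventually_mono)
    qed
  next
    case True
    then obtain G where G: "\<And>t. t \<in> {0<..<Ts} \<Longrightarrow> exp (\<nu> * t) * F t \<ge> - G" by blast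
    have half: "Ts / 2 \<in> {0<..<Ts}" using Ts by auto
    have "\<exists>Es. \<forall>t\<in>{Ts / 2..<Ts}. E t \<le> Es"
      by (rule E_bounded[OF order_refl half, of G]) (use G Ts in auto)
    then obtain Es where Es: "\<And>t. t \<in> {Ts / 2..<Ts} \<Longrightarrow> E t \<le> Es" by blast
    obtain A where A: "\<And>t k. t \<in> {Ts / 2..<Ts} \<Longrightarrow> \<bar>coeff k t\<bar> \<le> A / (real k)\<^sup>2"
      using coeff_uniform_bound[OF half Es] by blast
    have A0: "A \<ge> 0" using A[of "Ts / 2" 1] half by auto
    \<comment> \<open>The given solution is at most A \<open>zeta2\<close> on [Ts/2,Ts), and the
      summand 1 is the room \<open>small1\<close> leaves for the Duhamel term. R, and hence d,
      depends on A but not on the restart time.\<close>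
    define R where "R = A * zeta2 + 1"
    have R: "R \<ge> 1" using A0 zeta2_nonneg by (simp add: R_def)
    obtain d where d: "d > 0" "duhamel_sum \<nu> d \<le> 1 / (8 * R\<^sup>2)"
      using duhamel_sum_small[OF assms, of "1 / (8 * R\<^sup>2)"] R by auto
    have small1: "2 * R\<^sup>2 * duhamel_sum \<nu> d \<le> 1"
      using mult_left_mono[OF d(2), of "2 * R\<^sup>2"] R by simp
    have small2: "4 * R * duhamel_sum \<nu> d \<le> 1 / 2"
    proof -
      have "4 * R * duhamel_sum \<nu> d \<le> 4 * R * (1 / (8 * R\<^sup>2))" using R by (intro mult_left_mono d) auto
      also have "\<dots> \<le> 1 / 2" using R by (simp add: field_simps power2_eq_square)
      finally show ?thesis .
    qed
    \<comment> \<open>Late enough that a step of length d passes \<open>Ts\<close>, and not before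
      Ts/2, where the bound A starts to hold.\<close>
    define t0 where "t0 = max (Ts / 2) (Ts - d / 2)"
    have t0: "t0 \<in> {Ts / 2..<Ts}" "Ts < t0 + d" using d(1) Ts by (auto simp: t0_def)
    obtain v \<alpha> B where f: "fourier_solution \<nu> d B v \<alpha>" and init: "\<And>k. \<alpha> k 0 = coeff k t0"
      and vR: "\<And>x t. t \<in> {0..d} \<Longrightarrow> \<bar>v x t\<bar> \<le> R"
      using fourier_solution_exists[OF assms d(1) A[OF t0(1)] _ small1 small2] unfolding R_def by blast
    have wR: "\<bar>w x t\<bar> \<le> R" if "x \<in> {0..pi}" "t \<in> {t0..<Ts}" for x t
    proof -
      have t: "t \<in> {Ts / 2..<Ts}" "t \<in> {0<..<Ts}" using that t0 Ts by auto
      show ?thesis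
        using abs_sine_series_inverse_square_le[OF A[OF t(1)], of x] sine_series_coeff[OF t(2) that(1)]
        by (simp add: R_def)
    qed
    have t0': "t0 \<in> {0<..<Ts}" using t0 Ts by auto
    have "w x t = v x (t - t0)" if "x \<in> {0..pi}" "t \<in> {t0..<Ts}" for x t
      by (rule eq_fourier_solution[OF f t0' init vR wR small2 that]) (use that t0 in auto)
    then have "classical_solution \<nu> \<omega>\<^sub>0 (ereal (t0 + d)) (\<lambda>x t. if t < Ts then w x t else v x (t - t0))"
      using sol f t0 t0' unfolding T by (intro classical_solution_extend) auto
    moreover have "T < ereal (t0 + d)" using T t0 by simp
    moreover have "\<forall>x\<in>{0..pi}. \<forall>t\<ge>0. ereal t < T \<longrightarrow> (if t < Ts then w x t else v x (t - t0)) = w x t"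
      using T by simp
    ultimately have False using max unfolding maximal_solution_def by blast
    then show ?thesis ..
  qed
  then show "\<exists>Tstar>0. T = ereal Tstar \<and>
      filterlim (\<lambda>t. integral {0..pi} (\<lambda>x. w x t * sin x)) at_bot (at_left Tstar)"
    using T Ts unfolding F_def[abs_def] by blast
qed

end
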